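(* Let $\mathbb{X}$ be a random cubical filtration in $\mathbb{R}^d$ that is stationary and $R$-dependent for some integer $R\ge0$. Fix an integer $0\le q<d$ and a finite family $\mathcal{P}=\{(s_i,t_i)\}_{i=1}^h$ with $0\le s_i\le t_i<\infty$. Then for every $\lambda=(\lambda_1,\dots,\lambda_h)\in\mathbb{R}^h$ the limit \[ \varphi_{q,\mathcal{P}}(\lambda)=\lim_{n\to\infty}|\Lambda^n|^{-1}\log\mathbb{E}\Bigl[\exp\Bigl(\sum_{i=1}^h\lambda_i\beta_q^{\mathbb{X}^n}(s_i,t_i)\Bigr)\Bigr] \] exists in $\mathbb{R}$, and the $\mathbb{R}^h$-valued process $\bigl\{\bigl(\beta_q^{\mathbb{X}^n}(s_1,t_1),\dots,\beta_q^{\mathbb{X}^n}(s_h,t_h)\bigr)/|\Lambda^n|\bigr\}_{n\in\mathbb{N}}$ satisfies the LDP with speed $|\Lambda^n|$ and good convex rate function $\varphi_{q,\mathcal{P}}^*$. Moreover $\varphi_{q,\mathcal{P}}^*(x)=0$ if and only if $x=(\widehat\beta_q(s_1,t_1),\dots,\widehat\beta_q(s_h,t_h))$, where $\widehat\beta_q(s,t)=\lim_{n\to\infty}\mathbb{E}[\beta_q^{\mathbb{X}^n}(s,t)]/|\Lambda^n|$.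
   Context: Fix $d\in\mathbb{N}$. Cubical filtrations, random cubical filtrations, stationarity, $R$-dependence, persistent Betti numbers $\beta_q^{\mathbb{X}}(s,t)$ (rank of $H_q(X(s))\to H_q(X(t))$, real-coefficient cubical homology), $\Lambda^n=[-n,n]^d$, $|\Lambda^n|=(2n)^d$, $\mathbb{X}^n=\{X(t)\cap\Lambda^n\}_t$ are as in the strong law of large numbers for persistent Betti numbers (where the limit $\widehat\beta_q(s,t)$ is shown to exist). LDP: a process $\{S^n\}$ in a Hausdorff space $\mathcal{X}$ satisfies the LDP with speed $a_n\to\infty$ and rate function $I$ (lower semicontinuous, $[0,\infty]$-valued) if $\limsup a_n^{-1}\log P(S^n\in F)\le-\inf_F I$ for closed $F$ and $\liminf a_n^{-1}\log P(S^n\in G)\ge-\inf_G I$ for open $G$; $I$ is good if its sublevel sets $\{I\le\alpha\}$ are compact. Fenchel–Legendre transform: $\varphi^*(x)=\sup_{\lambda\in\mathbb{R}^h}\{\langle\lambda,x\rangle-\varphi(\lambda)\}$. *)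

theory Defs
  imports "HOL-Probability.Probability" "HOL-Library.Function_Algebras"
begin

text \<open>The ambient dimension d is CARD('d) for a finite, linearly ordered index type 'd
 (the order is only used for the sign convention of the cubical boundary).
 An elementary cube I_1 x ... x I_d is given coordinatewise by a pair (k, b):
 b = True means the interval [k, k+1], b = False means the degenerate interval [k, k].\<close>

type_synonym 'd cube = "'d \<Rightarrow> int \<times> bool"

definition cube_set :: "'d::finite cube \<Rightarrow> (real ^ 'd) set" where
  "cube_set Q = {x. \<forall>i. real_of_int (fst (Q i)) \<le> x $ i \<and>
       x $ i \<le> real_of_int (fst (Q i)) + (if snd (Q i) then 1 else 0)}"

definition cube_dim :: "'d::finite cube \<Rightarrow> nat" where
  "cube_dim Q = card {i. snd (Q i)}"

definition is_face :: "'d cube \<Rightarrow> 'd cube \<Rightarrow> bool" where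
  "is_face P Q \<longleftrightarrow> (\<forall>i. P i = Q i \<or>
      (snd (Q i) \<and> \<not> snd (P i) \<and> (fst (P i) = fst (Q i) \<or> fst (P i) = fst (Q i) + 1)))"

definition cubical_complex :: "'d cube set \<Rightarrow> bool" where
  "cubical_complex K \<longleftrightarrow> (\<forall>Q\<in>K. \<forall>P. is_face P Q \<longrightarrow> P \<in> K)"

definition shift_cube :: "('d \<Rightarrow> int) \<Rightarrow> 'd cube \<Rightarrow> 'd cube" where
  "shift_cube z Q = (\<lambda>i. (fst (Q i) + z i, snd (Q i)))"

type_synonym 'd chain = "'d cube \<Rightarrow> real"

definition chain_scale :: "real \<Rightarrow> 'd chain \<Rightarrow> 'd chain" where
  "chain_scale r c = (\<lambda>Q. r * c Q)"

text \<open>Boundary of an elementary cube (Kaczynski--Mischaikow--Mrozek convention):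
 d(I_1 x ... x I_d) = sum over nondegenerate coordinates j of
 (-1)^(number of nondegenerate coordinates before j) times
 (upper face in direction j - lower face in direction j).\<close>
definition bd_cube :: "'d::{finite,linorder} cube \<Rightarrow> 'd chain" where
  "bd_cube Q = (\<lambda>P. \<Sum>j\<in>{j. snd (Q j)}.
      (-1) ^ card {i. i < j \<and> snd (Q i)} *
      ((if P = Q(j := (fst (Q j) + 1, False)) then 1 else 0)
     - (if P = Q(j := (fst (Q j), False)) then 1 else 0)))"

definition bd :: "'d::{finite,linorder} chain \<Rightarrow> 'd chain" where
  "bd c = (\<lambda>P. \<Sum>Q\<in>{Q. c Q \<noteq> 0}. c Q * bd_cube Q P)"

definition chains :: "'d::finite cube set \<Rightarrow> nat \<Rightarrow> 'd chain set" where
  "chains K q = {c. finite {Q. c Q \<noteq> 0} \<and> (\<forall>Q. c Q \<noteq> 0 \<longrightarrow> Q \<in> K \<and> cube_dim Q = q)}"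

definition cycles :: "'d::{finite,linorder} cube set \<Rightarrow> nat \<Rightarrow> 'd chain set" where
  "cycles K q = {c \<in> chains K q. bd c = 0}"

definition boundaries :: "'d::{finite,linorder} cube set \<Rightarrow> nat \<Rightarrow> 'd chain set" where
  "boundaries K q = bd ` chains K (Suc q)"

definition vdim :: "'d chain set \<Rightarrow> nat" where
  "vdim V = vector_space.dim chain_scale V"

lemma vector_space_chain_scale: "vector_space (chain_scale :: real \<Rightarrow> 'd chain \<Rightarrow> 'd chain)"
  by unfold_locales (auto simp: chain_scale_def fun_eq_iff algebra_simps)

definition cubical_filtration :: "(real \<Rightarrow> 'd cube set) \<Rightarrow> bool" where
  "cubical_filtration X \<longleftrightarrow> (\<forall>t\<ge>0. cubical_complex (X t)) \<and>
     (\<forall>s t. 0 \<le> s \<longrightarrow> s \<le> t \<longrightarrow> X s \<subseteq> X t)"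

text \<open>Persistent Betti number beta_q^X(s,t) = rank of H_q(X(s)) -> H_q(X(t)) with real
 coefficients. The image of H_q(X(s)) = Z_q(X(s))/B_q(X(s)) in H_q(X(t)) = Z_q(X(t))/B_q(X(t))
 is (Z_q(X(s)) + B_q(X(t)))/B_q(X(t)), so its dimension is the difference below.\<close>
definition pbetti :: "(real \<Rightarrow> 'd::{finite,linorder} cube set) \<Rightarrow> nat \<Rightarrow> real \<Rightarrow> real \<Rightarrow> nat" where
  "pbetti X q s t =
     vdim {a + b | a b. a \<in> cycles (X s) q \<and> b \<in> boundaries (X t) q}
   - vdim (boundaries (X t) q)"

definition Lambda :: "nat \<Rightarrow> (real ^ 'd::finite) set" where
  "Lambda n = {x. \<forall>i. - real n \<le> x $ i \<and> x $ i \<le> real n}"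

definition vol_Lambda :: "'d::finite itself \<Rightarrow> nat \<Rightarrow> real" where
  "vol_Lambda _ n = (2 * real n) ^ CARD('d)"

definition restrict_box :: "nat \<Rightarrow> (real \<Rightarrow> 'd::finite cube set) \<Rightarrow> (real \<Rightarrow> 'd cube set)" where
  "restrict_box n X = (\<lambda>t. {Q \<in> X t. cube_set Q \<subseteq> Lambda n})"

definition random_cubical_filtration ::
    "'w measure \<Rightarrow> ('w \<Rightarrow> real \<Rightarrow> 'd cube set) \<Rightarrow> bool" where
  "random_cubical_filtration M X \<longleftrightarrow> prob_space M \<and>
     (\<forall>\<omega>\<in>space M. cubical_filtration (X \<omega>)) \<and>
     (\<forall>Q t. t \<ge> 0 \<longrightarrow> {\<omega> \<in> space M. Q \<in> X \<omega> t} \<in> sets M)"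

text \<open>Stationarity: all finite-dimensional distributions of the indicator process
 (Q,t) |-> [Q \<in> X(t)] are invariant under integer translations.\<close>
definition stationary :: "'w measure \<Rightarrow> ('w \<Rightarrow> real \<Rightarrow> 'd cube set) \<Rightarrow> bool" where
  "stationary M X \<longleftrightarrow> (\<forall>(z::'d \<Rightarrow> int) (ps :: ('d cube \<times> real) list) (bs :: bool list).
     (\<forall>p\<in>set ps. 0 \<le> snd p) \<longrightarrow>
     measure M {\<omega> \<in> space M. map (\<lambda>(Q,t). Q \<in> X \<omega> t) ps = bs}
   = measure M {\<omega> \<in> space M. map (\<lambda>(Q,t). shift_cube z Q \<in> X \<omega> t) ps = bs})"

definition restr_sigma :: "'w measure \<Rightarrow> ('w \<Rightarrow> real \<Rightarrow> 'd cube set) \<Rightarrow> 'd cube set \<Rightarrow> 'w set set" where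
  "restr_sigma M X S = sigma_sets (space M)
     {{\<omega> \<in> space M. Q \<in> X \<omega> t} | Q t. Q \<in> S \<and> 0 \<le> t}"

definition R_dependent :: "'w measure \<Rightarrow> ('w \<Rightarrow> real \<Rightarrow> 'd::finite cube set) \<Rightarrow> nat \<Rightarrow> bool" where
  "R_dependent M X R \<longleftrightarrow> (\<forall>A B :: (real ^ 'd) set. setdist A B > real R \<longrightarrow>
     prob_space.indep_set M (restr_sigma M X {Q. cube_set Q \<subseteq> A})
                            (restr_sigma M X {Q. cube_set Q \<subseteq> B}))"

definition log_ereal :: "real \<Rightarrow> ereal" where
  "log_ereal p = (if p = 0 then -\<infinity> else ereal (ln p))"

definition rate_function :: "('a::topological_space \<Rightarrow> ereal) \<Rightarrow> bool" where
  "rate_function I \<longleftrightarrow> (\<forall>x. 0 \<le> I x) \<and> (\<forall>\<alpha>::real. closed {x. I x \<le> ereal \<alpha>})"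

definition good_rate_function :: "('a::topological_space \<Rightarrow> ereal) \<Rightarrow> bool" where
  "good_rate_function I \<longleftrightarrow> rate_function I \<and> (\<forall>\<alpha>::real. compact {x. I x \<le> ereal \<alpha>})"

definition convex_ereal_fun :: "('a::real_vector \<Rightarrow> ereal) \<Rightarrow> bool" where
  "convex_ereal_fun I \<longleftrightarrow> (\<forall>x y (u::real). 0 \<le> u \<longrightarrow> u \<le> 1 \<longrightarrow>
     I (u *\<^sub>R x + (1 - u) *\<^sub>R y) \<le> ereal u * I x + ereal (1 - u) * I y)"

definition LDP :: "'w measure \<Rightarrow> (nat \<Rightarrow> 'w \<Rightarrow> 'a::topological_space) \<Rightarrow> (nat \<Rightarrow> real)
                   \<Rightarrow> ('a \<Rightarrow> ereal) \<Rightarrow> bool" where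
  "LDP M S a I \<longleftrightarrow> rate_function I \<and>
     (\<forall>F. closed F \<longrightarrow>
        limsup (\<lambda>n. log_ereal (measure M {\<omega> \<in> space M. S n \<omega> \<in> F}) / ereal (a n))
          \<le> - (INF x\<in>F. I x)) \<and>
     (\<forall>G. open G \<longrightarrow>
        liminf (\<lambda>n. log_ereal (measure M {\<omega> \<in> space M. S n \<omega> \<in> G}) / ereal (a n))
          \<ge> - (INF x\<in>G. I x))"

definition fenchel_legendre :: "(real ^ 'h \<Rightarrow> real) \<Rightarrow> real ^ 'h \<Rightarrow> ereal" where
  "fenchel_legendre \<phi> x = (SUP l. ereal (l \<bullet> x - \<phi> l))"

end

theory Submission
  imports Defs "HOL-Real_Asymp.Real_Asymp"
begin

text \<open>Adding a cube to a complex changes a persistent Betti number by a bounded amount, and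
 persistent Betti numbers are additive over disjoint complexes. Hence the Betti vector of a large
 box is, up to a negligible fraction of its volume, the sum of the Betti vectors of translated
 copies of a fixed box that are separated by gaps wider than \<open>R\<close>, and these summands are
 independent and identically distributed.

 This gives the limit \<open>\<phi>\<close> of the logarithmic moment generating functions, and the upper bound by
 covering a compact set with half-spaces. As \<open>\<phi>\<close> need not be differentiable, the lower bound does
 not come from tilting. The Betti vector of a box of radius \<open>K\<close> takes only polynomially many values
 \<open>v\<close>, so its moment generating function is governed by the largest of the terms
 \<open>exp (l \<bullet> v) * P(v)\<close>. Separating the convex hull of the points \<open>(v, - log P(v))\<close>, divided by the
 volume, from \<open>cball x \<epsilon> \<times> {..\<phi>\<^sup>*(x) + \<epsilon>}\<close> shows that \<open>x\<close> is nearly a mixture of values \<open>v\<close> of cost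
 nearly \<open>\<phi>\<^sup>*(x)\<close>; prescribing these values on the independent blocks realises the mixture. The rate
 function vanishes only at the limiting mean because, up to a small multiple of the norm of \<open>l\<close>,
 \<open>\<phi> l\<close> is bounded by the first order expansion of the cumulant generating function of a single block.\<close>

section \<open>Dimension of finite-dimensional subspaces\<close>

text \<open>The obstacle is uniformity in \<open>l\<close>. Both the separation argument and the
  proof that the zero is unique produce a vector \<open>l\<close> only after the block radius
  \<open>K\<close> has been fixed, and nothing limits how large or small \<open>l\<close> is. A
  comparison of \<open>\<phi> l\<close> with \<open>ln (Z K l) / a K\<close> for one
  \<open>l\<close> at a time would not do. The estimates are therefore kept homogeneous: replacing a
  box by its blocks changes the Betti vector by a deterministically bounded amount, so the exponent
  changes by at most \<open>norm l\<close> times that bound, and a single \<open>K\<close> gives the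
  error \<open>norm l * \<epsilon>\<close> for all \<open>l\<close> at once. In the separation
  argument this error is absorbed by the radius of the ball, in the uniqueness proof by the linear
  term of the expansion.

  The gaps cost a fraction of the volume that does not vanish for fixed \<open>K\<close>; hence
  \<open>K\<close> is always chosen first and \<open>N\<close> tends to infinity afterwards.
  Geometry and large deviations meet only in the assumptions of the locale
  \<open>nearly_additive\<close>, where the vectors have finite range and all moments exist.\<close>

context vector_space
begin

text \<open>The chains form an infinite-dimensional space, and \<open>dim\<close> is the junk value
  0 for a subspace with an infinite basis. A finite \<open>T\<close> whose span contains
  \<open>V\<close> makes the dimension meaningful, which is why such a set accompanies the dimension
  estimates below.\<close>

lemma finite_basis_exists:
  assumes "V \<subseteq> span T" "finite T"
  obtains B where "B \<subseteq> V" "independent B" "V \<subseteq> span B" "card B = dim V" "finite B"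
proof -
  obtain B where B: "B \<subseteq> V" "independent B" "V \<subseteq> span B" "card B = dim V"
    by (rule basis_exists)
  moreover have "finite B"
    using independent_span_bound[OF assms(2) B(2)] B(1) assms(1) by blast
  ultimately show thesis using that by blast
qed

lemma dim_le_dim_add_card:
  assumes "V \<subseteq> span T" "finite T" "W \<subseteq> span (V \<union> S)" "finite S"
  shows "dim W \<le> dim V + card S"
proof -
  obtain B where B: "B \<subseteq> V" "V \<subseteq> span B" "card B = dim V" "finite B"
    using finite_basis_exists[OF assms(1,2)] by metis
  have "V \<union> S \<subseteq> span (B \<union> S)"
    using B(2) span_mono[of B "B \<union> S"] span_superset[of "B \<union> S"] by blast
  then have "W \<subseteq> span (B \<union> S)"
    using assms(3) by (meson order_trans span_minimal subspace_span)
  then have "dim W \<le> card (B \<union> S)"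
    using B(4) assms(4) by (intro dim_le_card) auto
  also have "\<dots> \<le> card B + card S" by (rule card_Un_le)
  finally show ?thesis using B(3) by simp
qed

lemma dim_mono_finite:
  assumes "V \<subseteq> span T" "finite T" "W \<subseteq> V"
  shows "dim W \<le> dim V"
  using dim_le_dim_add_card[OF assms(1,2), of W "{}"] assms(3) span_superset[of V] by auto

text \<open>A basis of \<open>V\<close> and a basis of \<open>W\<close> together form a basis of the
  sum: if a basis vector is expressed through the others, the part coming from the opposite space
  lies in \<open>V \<inter> W\<close> and vanishes.\<close>

lemma dim_direct_sum:
  assumes V: "subspace V" "V \<subseteq> span S" "finite S" and W: "subspace W" "W \<subseteq> span T" "finite T"
    and VW: "V \<inter> W \<subseteq> {0}"
  shows "dim {v + w | v w. v \<in> V \<and> w \<in> W} = dim V + dim W"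
proof -
  obtain A where A: "A \<subseteq> V" "independent A" "V \<subseteq> span A" "card A = dim V" "finite A"
    using finite_basis_exists[OF V(2,3)] by metis
  obtain B where B: "B \<subseteq> W" "independent B" "W \<subseteq> span B" "card B = dim W" "finite B"
    using finite_basis_exists[OF W(2,3)] by metis
  have sA: "span A \<subseteq> V" and sB: "span B \<subseteq> W"
    using A(1) B(1) V(1) W(1) by (auto intro: span_minimal[THEN subsetD])
  have nz: "0 \<notin> A" "0 \<notin> B" using A(2) B(2) dependent_zero by auto
  have disj: "A \<inter> B = {}" using A(1) B(1) VW nz by blast
  have "independent (A \<union> B)"
    unfolding dependent_def
  proof clarify
    fix a assume a: "a \<in> A \<union> B" "a \<in> span (A \<union> B - {a})"
    have "a \<in> A \<and> a \<in> span (A - {a}) \<or> a \<in> B \<and> a \<in> span (B - {a})"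
    proof (cases "a \<in> A")
      case True
      then have "A \<union> B - {a} = (A - {a}) \<union> B" using disj by auto
      then have "a \<in> {x + y | x y. x \<in> span (A - {a}) \<and> y \<in> span B}"
        using a(2) span_Un[of "A - {a}" B] by simp
      then obtain v w where vw: "a = v + w" "v \<in> span (A - {a})" "w \<in> span B"
        by blast
      have "v \<in> V" using vw(2) sA span_mono[of "A - {a}" A] by blast
      then have "w \<in> V" using vw(1) True A(1) V(1) subspace_diff[of V a v] by auto
      then have "w = 0" using vw(3) sB VW by blast
      then have "a = v" using vw(1) by simp
      then show ?thesis using vw(2) True by simp
    next
      case False
      then have "A \<union> B - {a} = A \<union> (B - {a})" by auto
      then have "a \<in> {x + y | x y. x \<in> span A \<and> y \<in> span (B - {a})}"
        using a(2) span_Un[of A "B - {a}"] by simp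
      then obtain v w where vw: "a = v + w" "v \<in> span A" "w \<in> span (B - {a})"
        by blast
      have "w \<in> W" using vw(3) sB span_mono[of "B - {a}" B] by blast
      then have "v \<in> W" using vw(1) False a(1) B(1) W(1) subspace_diff[of W a w] by auto
      then have "v = 0" using vw(2) sA VW by blast
      then have "a = w" using vw(1) by simp
      then show ?thesis using vw(3) False a(1) by auto
    qed
    then show False
      using A(2) B(2) unfolding dependent_def by blast
  qed
  moreover have "{v + w | v w. v \<in> V \<and> w \<in> W} = span (A \<union> B)"
    unfolding span_Un using sA sB A(3) B(3) by blast
  ultimately show ?thesis
    using dim_span_eq_card_independent[of "A \<union> B"] card_Un_disjoint[OF A(5) B(5) disj] A(4) B(4)
    by simp
qed

end

section \<open>Cubical chains\<close>

interpretation chain: vector_space "chain_scale :: real \<Rightarrow> 'd chain \<Rightarrow> 'd chain"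
  by (rule vector_space_chain_scale)

text \<open>Vanishing at a cube is one linear condition. If some \<open>e\<close> in the subspace
  violates it, subtracting a multiple of \<open>e\<close> makes any other element satisfy it, so one
  additional vector per cube of \<open>E\<close> is enough.\<close>

lemma subspace_codim_le_card:
  fixes W :: "'d chain set"
  assumes "finite E" "chain.subspace W"
  shows "\<exists>S. finite S \<and> card S \<le> card E \<and> W \<subseteq> chain.span ((W \<inter> {c. \<forall>Q\<in>E. c Q = 0}) \<union> S)"
  using assms(1)
proof induction
  case empty
  then show ?case using chain.span_superset[of W] by (intro exI[of _ "{}"]) auto
next
  case (insert Q E)
  then obtain S where S: "finite S" "card S \<le> card E"
    "W \<subseteq> chain.span ((W \<inter> {c. \<forall>Q\<in>E. c Q = 0}) \<union> S)" by blast
  let ?V = "W \<inter> {c. \<forall>Q\<in>E. c Q = 0}" and ?V' = "W \<inter> {c. \<forall>Q'\<in>insert Q E. c Q' = 0}"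
  show ?case
  proof (cases "\<forall>c\<in>?V. c Q = 0")
    case True
    then have "?V' = ?V" by auto
    then show ?thesis using S insert.hyps by (intro exI[of _ S]) auto
  next
    case False
    then obtain e where e: "e \<in> ?V" "e Q \<noteq> 0" by auto
    have "?V \<subseteq> chain.span (?V' \<union> insert e S)"
    proof
      fix c assume c: "c \<in> ?V"
      let ?r = "c Q / e Q"
      have "c - chain_scale ?r e \<in> ?V'"
      proof -
        have "c - chain_scale ?r e \<in> W"
          using c e chain.subspace_diff[OF assms(2)] chain.subspace_scale[OF assms(2)] by auto
        then show ?thesis using c e by (auto simp: chain_scale_def)
      qed
      then have "c - chain_scale ?r e \<in> chain.span (?V' \<union> insert e S)"
        by (intro chain.span_base) auto
      moreover have "chain_scale ?r e \<in> chain.span (?V' \<union> insert e S)"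
        by (intro chain.span_scale chain.span_base) auto
      ultimately show "c \<in> chain.span (?V' \<union> insert e S)"
        using chain.span_add by fastforce
    qed
    moreover have "S \<subseteq> chain.span (?V' \<union> insert e S)"
      by (auto intro: chain.span_base)
    ultimately have "chain.span (?V \<union> S) \<subseteq> chain.span (?V' \<union> insert e S)"
      by (intro chain.span_minimal) auto
    then have "W \<subseteq> chain.span (?V' \<union> insert e S)" using S(3) by blast
    moreover have "card (insert e S) \<le> card (insert Q E)"
      using S(1,2) insert.hyps by (simp add: card_insert_if)
    ultimately show ?thesis using S(1) by (intro exI[of _ "insert e S"]) auto
  qed
qed

section \<open>The boundary operator; cycles and boundaries as subspaces\<close>

text \<open>\<open>bd c\<close> sums over the support of \<open>c\<close>, which varies with
  \<open>c\<close>. Linearity becomes visible only over a common finite index set.\<close>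

lemma bd_sum_superset:
  assumes "finite S" "{Q. c Q \<noteq> 0} \<subseteq> S"
  shows "bd c P = (\<Sum>Q\<in>S. c Q * bd_cube Q P)"
  unfolding bd_def using assms by (intro sum.mono_neutral_left) auto

lemma bd_zero: "bd 0 = 0"
  by (simp add: bd_def fun_eq_iff)

lemma bd_add:
  assumes "finite {Q. c Q \<noteq> 0}" "finite {Q. e Q \<noteq> 0}"
  shows "bd (c + e) = bd c + bd e"
proof
  fix P
  let ?S = "{Q. c Q \<noteq> 0} \<union> {Q. e Q \<noteq> 0}"
  have "bd (c + e) P = (\<Sum>Q\<in>?S. (c + e) Q * bd_cube Q P)"
    using assms by (intro bd_sum_superset) auto
  moreover have "bd c P = (\<Sum>Q\<in>?S. c Q * bd_cube Q P)" "bd e P = (\<Sum>Q\<in>?S. e Q * bd_cube Q P)"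
    using assms by (intro bd_sum_superset; auto)+
  ultimately show "bd (c + e) P = (bd c + bd e) P"
    by (simp add: sum.distrib[symmetric] algebra_simps)
qed

lemma bd_scale: "bd (chain_scale r c) = chain_scale r (bd c)"
proof (cases "r = 0")
  case True
  then show ?thesis by (simp add: bd_def chain_scale_def fun_eq_iff)
next
  case False
  then show ?thesis
    by (simp add: bd_def chain_scale_def fun_eq_iff sum_distrib_left mult.assoc)
qed

lemma subspace_chains: "chain.subspace (chains K q)"
proof (rule chain.subspaceI)
  fix c e assume "c \<in> chains K q" "e \<in> chains K q"
  moreover have "{Q. (c + e) Q \<noteq> 0} \<subseteq> {Q. c Q \<noteq> 0} \<union> {Q. e Q \<noteq> 0}" by auto
  ultimately show "c + e \<in> chains K q"
    unfolding chains_def by (auto dest: finite_subset)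
next
  fix r c assume "c \<in> chains K q"
  moreover have "{Q. chain_scale r c Q \<noteq> 0} \<subseteq> {Q. c Q \<noteq> 0}" by (auto simp: chain_scale_def)
  ultimately show "chain_scale r c \<in> chains K q"
    unfolding chains_def by (auto dest: finite_subset simp: chain_scale_def)
qed (auto simp: chains_def)

lemma finite_support_chains: "c \<in> chains K q \<Longrightarrow> finite {Q. c Q \<noteq> 0}"
  by (simp add: chains_def)

lemma subspace_cycles: "chain.subspace (cycles K q)"
proof (rule chain.subspaceI)
  fix c e assume "c \<in> cycles K q" "e \<in> cycles K q"
  then show "c + e \<in> cycles K q"
    using chain.subspace_add[OF subspace_chains] bd_add[of c e] finite_support_chains[of c K q]
      finite_support_chains[of e K q] unfolding cycles_def by auto
next
  fix r c assume "c \<in> cycles K q"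
  then show "chain_scale r c \<in> cycles K q"
    using chain.subspace_scale[OF subspace_chains] 
    unfolding cycles_def by (auto simp: bd_scale)
qed (use chain.subspace_0[OF subspace_chains] in \<open>auto simp: cycles_def bd_zero\<close>)

lemma subspace_boundaries: "chain.subspace (boundaries K q)"
proof (rule chain.subspaceI)
  show "0 \<in> boundaries K q"
    unfolding boundaries_def using chain.subspace_0[OF subspace_chains] bd_zero by (metis imageI)
next
  fix x y assume "x \<in> boundaries K q" "y \<in> boundaries K q"
  then obtain c e where "c \<in> chains K (Suc q)" "e \<in> chains K (Suc q)" "x = bd c" "y = bd e"
    unfolding boundaries_def by auto
  then show "x + y \<in> boundaries K q"
    using bd_add[of c e] chain.subspace_add[OF subspace_chains] finite_support_chains
    unfolding boundaries_def by (metis imageI)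
next
  fix r x assume "x \<in> boundaries K q"
  then obtain c where "c \<in> chains K (Suc q)" "x = bd c"
    unfolding boundaries_def by auto
  then show "chain_scale r x \<in> boundaries K q"
    using bd_scale[of r c] chain.subspace_scale[OF subspace_chains]
    unfolding boundaries_def by (metis imageI)
qed

lemma chains_mono: "K \<subseteq> K' \<Longrightarrow> chains K q \<subseteq> chains K' q"
  unfolding chains_def by auto

lemma cycles_mono: "K \<subseteq> K' \<Longrightarrow> cycles K q \<subseteq> cycles K' q"
  unfolding cycles_def using chains_mono by blast

lemma boundaries_mono: "K \<subseteq> K' \<Longrightarrow> boundaries K q \<subseteq> boundaries K' q"
  unfolding boundaries_def using chains_mono by blast

definition restrict_chain :: "'d cube set \<Rightarrow> 'd chain \<Rightarrow> 'd chain" where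
  "restrict_chain A c = (\<lambda>Q. if Q \<in> A then c Q else 0)"

lemma restrict_chain_in_chains:
  "c \<in> chains K q \<Longrightarrow> restrict_chain A c \<in> chains (K \<inter> A) q"
  unfolding chains_def restrict_chain_def
  by (auto elim: rev_finite_subset split: if_splits)

text \<open>The formula for \<open>bd\<close> does not refer to the complex, so a cycle of
  \<open>K'\<close> that vanishes on \<open>E\<close> is already a cycle of
  \<open>K\<close>.\<close>

lemma cycles_codim:
  assumes "finite E" "K' \<subseteq> K \<union> E"
  shows "\<exists>S. finite S \<and> card S \<le> card E \<and> cycles K' q \<subseteq> chain.span (cycles K q \<union> S)"
proof -
  obtain S where S: "finite S" "card S \<le> card E"
    "cycles K' q \<subseteq> chain.span ((cycles K' q \<inter> {c. \<forall>Q\<in>E. c Q = 0}) \<union> S)"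
    using subspace_codim_le_card[OF assms(1) subspace_cycles[of K' q]] by (elim exE conjE)
  have "cycles K' q \<inter> {c. \<forall>Q\<in>E. c Q = 0} \<subseteq> cycles K q"
    using assms(2) unfolding cycles_def chains_def by auto
  then have "chain.span ((cycles K' q \<inter> {c. \<forall>Q\<in>E. c Q = 0}) \<union> S) \<subseteq> chain.span (cycles K q \<union> S)"
    by (intro chain.span_mono) auto
  with S show ?thesis by blast
qed

text \<open>Here the extra vectors are explicit: cutting \<open>E\<close> out of a chain changes its
  boundary by a combination of the boundaries of the single cubes of \<open>E\<close>.\<close>

lemma boundaries_codim:
  assumes "finite E" "K' \<subseteq> K \<union> E"
  shows "\<exists>S. finite S \<and> card S \<le> card E \<and> boundaries K' q \<subseteq> chain.span (boundaries K q \<union> S)"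
proof (intro exI conjI)
  show "finite (bd_cube ` E)" "card (bd_cube ` E) \<le> card E"
    using assms(1) by (auto intro: card_image_le)
  show "boundaries K' q \<subseteq> chain.span (boundaries K q \<union> bd_cube ` E)"
  proof
    fix x assume "x \<in> boundaries K' q"
    then obtain c where c: "c \<in> chains K' (Suc q)" "x = bd c" unfolding boundaries_def by auto
    let ?a = "restrict_chain (- E) c"
    have a: "?a \<in> chains K (Suc q)"
      using restrict_chain_in_chains[OF c(1), of "- E"] chains_mono[of "K' \<inter> - E" K] assms(2) by blast
    have "x = bd ?a + (\<Sum>Q\<in>E. chain_scale (c Q) (bd_cube Q))"
    proof
      fix P
      let ?S = "{Q. c Q \<noteq> 0} \<union> E"
      have fin: "finite ?S" using finite_support_chains[OF c(1)] assms(1) by simp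
      have "x P = (\<Sum>Q\<in>?S. c Q * bd_cube Q P)" unfolding c(2) using fin by (intro bd_sum_superset) auto
      also have "\<dots> = (\<Sum>Q\<in>?S. ?a Q * bd_cube Q P) + (\<Sum>Q\<in>?S. (if Q \<in> E then c Q * bd_cube Q P else 0))"
        by (subst sum.distrib[symmetric]) (auto simp: restrict_chain_def intro: sum.cong)
      also have "(\<Sum>Q\<in>?S. ?a Q * bd_cube Q P) = bd ?a P"
        using fin by (intro bd_sum_superset[symmetric]) (auto simp: restrict_chain_def)
      also have "(\<Sum>Q\<in>?S. (if Q \<in> E then c Q * bd_cube Q P else 0)) = (\<Sum>Q\<in>E. c Q * bd_cube Q P)"
        using fin by (subst sum.inter_restrict[symmetric]) (auto intro: sum.cong)
      also have "\<dots> = (\<Sum>Q\<in>E. chain_scale (c Q) (bd_cube Q)) P"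
        unfolding chain_scale_def using assms(1) by (induction E rule: finite_induct) auto
      finally show "x P = (bd ?a + (\<Sum>Q\<in>E. chain_scale (c Q) (bd_cube Q))) P" by simp
    qed
    moreover have "bd ?a \<in> chain.span (boundaries K q \<union> bd_cube ` E)"
      using a by (intro chain.span_base) (auto simp: boundaries_def)
    moreover have "(\<Sum>Q\<in>E. chain_scale (c Q) (bd_cube Q)) \<in> chain.span (boundaries K q \<union> bd_cube ` E)"
      by (intro chain.span_sum chain.span_scale chain.span_base) auto
    ultimately show "x \<in> chain.span (boundaries K q \<union> bd_cube ` E)"
      by (simp only: chain.span_add)
  qed
qed

section \<open>The rank of the map on homology induced by an inclusion\<close>

definition cycle_boundary_sum :: "'d::{finite,linorder} cube set \<Rightarrow> 'd cube set \<Rightarrow> nat \<Rightarrow> 'd chain set" where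
  "cycle_boundary_sum A B q = {a + b | a b. a \<in> cycles A q \<and> b \<in> boundaries B q}"

text \<open>For complexes \<open>A \<subseteq> B\<close> this is the rank of the map from the
  homology of \<open>A\<close> to that of \<open>B\<close>. Phrasing it for two sets of cubes
  instead of a filtration allows them to be cut down to arbitrary regions.\<close>

definition rank_incl :: "'d::{finite,linorder} cube set \<Rightarrow> 'd cube set \<Rightarrow> nat \<Rightarrow> nat" where
  "rank_incl A B q = vdim (cycle_boundary_sum A B q) - vdim (boundaries B q)"

lemma pbetti_eq_rank_incl: "pbetti X q s t = rank_incl (X s) (X t) q"
  by (simp add: pbetti_def rank_incl_def cycle_boundary_sum_def)

lemma subspace_cycle_boundary_sum: "chain.subspace (cycle_boundary_sum A B q)"
  unfolding cycle_boundary_sum_def by (intro chain.subspace_sums subspace_cycles subspace_boundaries)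

lemma cycle_boundary_sum_eq_span:
  "cycle_boundary_sum A B q = chain.span (cycles A q \<union> boundaries B q)"
  unfolding cycle_boundary_sum_def chain.span_Un
  by (simp add: subspace_cycles subspace_boundaries chain.span_eq_iff[THEN iffD2])

lemma boundaries_subset_cycle_boundary_sum: "boundaries B q \<subseteq> cycle_boundary_sum A B q"
  unfolding cycle_boundary_sum_eq_span using chain.span_superset by blast

lemma cycles_subset_cycle_boundary_sum: "cycles A q \<subseteq> cycle_boundary_sum A B q"
  unfolding cycle_boundary_sum_eq_span using chain.span_superset by blast

lemma chains_empty: "chains {} q = {0}"
  by (auto simp: chains_def fun_eq_iff)

lemma boundaries_empty: "boundaries {} q = {0}"
  by (simp add: boundaries_def chains_empty bd_zero)

lemma cycles_empty: "cycles {} q = {0}"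
  by (auto simp: cycles_def chains_empty bd_zero)

lemma boundaries_finite_dim:
  assumes "finite B"
  obtains T where "finite T" "boundaries B q \<subseteq> chain.span T"
proof -
  obtain S where "finite S" "boundaries B q \<subseteq> chain.span (boundaries {} q \<union> S)"
    using boundaries_codim[OF assms, of B "{}" q] by auto
  then show thesis using that[of "{0} \<union> S"] by (simp add: boundaries_empty)
qed

lemma cycles_finite_dim:
  assumes "finite A"
  obtains T where "finite T" "cycles A q \<subseteq> chain.span T"
proof -
  obtain S where "finite S" "cycles A q \<subseteq> chain.span (cycles {} q \<union> S)"
    using cycles_codim[OF assms, of A "{}" q] by auto
  then show thesis using that[of "{0} \<union> S"] by (simp add: cycles_empty)
qed

lemma cycle_boundary_sum_finite_dim:
  assumes "finite A" "finite B"
  obtains T where "finite T" "cycle_boundary_sum A B q \<subseteq> chain.span T"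
proof -
  obtain S where S: "finite S" "cycles A q \<subseteq> chain.span S" by (rule cycles_finite_dim[OF assms(1)])
  obtain T where T: "finite T" "boundaries B q \<subseteq> chain.span T"
    by (rule boundaries_finite_dim[OF assms(2)])
  from S T have "cycle_boundary_sum A B q \<subseteq> chain.span (S \<union> T)"
    unfolding cycle_boundary_sum_def chain.span_Un by blast
  with S T show thesis using that[of "S \<union> T"] by simp
qed

text \<open>The difference in \<open>rank_incl\<close> is one of natural numbers; this inequality
  shows that it is not truncated.\<close>

lemma vdim_boundaries_le:
  assumes "finite A" "finite B"
  shows "vdim (boundaries B q) \<le> vdim (cycle_boundary_sum A B q)"
proof -
  obtain T where "finite T" "cycle_boundary_sum A B q \<subseteq> chain.span T"
    by (rule cycle_boundary_sum_finite_dim[OF assms])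
  then show ?thesis unfolding vdim_def
    by (intro chain.dim_mono_finite boundaries_subset_cycle_boundary_sum)
qed

text \<open>Adding a cube raises each of the two dimensions whose difference is the rank
 by at most one per set to which it is added.\<close>

lemma rank_incl_diff_le:
  assumes E: "finite E" and fin: "finite A" "finite B"
    and sub: "A \<subseteq> A'" "B \<subseteq> B'" and ext: "A' \<subseteq> A \<union> E" "B' \<subseteq> B \<union> E"
  shows "\<bar>real (rank_incl A' B' q) - real (rank_incl A B q)\<bar> \<le> 2 * real (card E)"
proof -
  have fin': "finite A'" "finite B'" using E fin ext by (meson finite_UnI finite_subset)+
  obtain S where S: "finite S" "card S \<le> card E" "cycles A' q \<subseteq> chain.span (cycles A q \<union> S)"
    using cycles_codim[OF E ext(1), of q] by (elim exE conjE)
  obtain T where T: "finite T" "card T \<le> card E" "boundaries B' q \<subseteq> chain.span (boundaries B q \<union> T)"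
    using boundaries_codim[OF E ext(2), of q] by (elim exE conjE)
  obtain Tb where Tb: "finite Tb" "boundaries B q \<subseteq> chain.span Tb"
    by (rule boundaries_finite_dim[OF fin(2)])
  obtain Tb' where Tb': "finite Tb'" "boundaries B' q \<subseteq> chain.span Tb'"
    by (rule boundaries_finite_dim[OF fin'(2)])
  obtain Ts where Ts: "finite Ts" "cycle_boundary_sum A B q \<subseteq> chain.span Ts"
    by (rule cycle_boundary_sum_finite_dim[OF fin])
  obtain Ts' where Ts': "finite Ts'" "cycle_boundary_sum A' B' q \<subseteq> chain.span Ts'"
    by (rule cycle_boundary_sum_finite_dim[OF fin'])
  have bT: "vdim (boundaries B' q) \<le> vdim (boundaries B q) + card T"
    unfolding vdim_def by (rule chain.dim_le_dim_add_card[OF Tb(2,1) T(3,1)])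
  have bm: "vdim (boundaries B q) \<le> vdim (boundaries B' q)"
    unfolding vdim_def by (rule chain.dim_mono_finite[OF Tb'(2,1) boundaries_mono[OF sub(2)]])
  have m: "cycle_boundary_sum A B q \<subseteq> cycle_boundary_sum A' B' q"
    unfolding cycle_boundary_sum_def using cycles_mono[OF sub(1)] boundaries_mono[OF sub(2)] by blast
  have sm: "vdim (cycle_boundary_sum A B q) \<le> vdim (cycle_boundary_sum A' B' q)"
    unfolding vdim_def by (rule chain.dim_mono_finite[OF Ts'(2,1) m])
  let ?V = "cycle_boundary_sum A B q"
  have "cycles A q \<union> S \<subseteq> ?V \<union> (S \<union> T)"
    using cycles_subset_cycle_boundary_sum[of A q B] by auto
  from order_trans[OF S(3) chain.span_mono[OF this]]
  have "cycles A' q \<subseteq> chain.span (?V \<union> (S \<union> T))" .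
  moreover have "boundaries B q \<union> T \<subseteq> ?V \<union> (S \<union> T)"
    using boundaries_subset_cycle_boundary_sum[of B q A] by auto
  from order_trans[OF T(3) chain.span_mono[OF this]]
  have "boundaries B' q \<subseteq> chain.span (?V \<union> (S \<union> T))" .
  ultimately have "cycle_boundary_sum A' B' q \<subseteq> chain.span (?V \<union> (S \<union> T))"
    unfolding cycle_boundary_sum_eq_span[of A' B'] by (intro chain.span_minimal) auto
  then have sT: "vdim (cycle_boundary_sum A' B' q) \<le> vdim ?V + card (S \<union> T)"
    unfolding vdim_def using S(1) T(1) by (intro chain.dim_le_dim_add_card[OF Ts(2,1)]) auto
  have "card (S \<union> T) \<le> card S + card T" by (rule card_Un_le)
  with sT S(2) have sT: "vdim (cycle_boundary_sum A' B' q) \<le> vdim ?V + card E + card T" by simp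
  show ?thesis
    unfolding rank_incl_def
    using bT bm sm sT T(2) vdim_boundaries_le[OF fin, of q] vdim_boundaries_le[OF fin', of q] by linarith
qed

lemma rank_incl_empty: "rank_incl {} {} q = 0"
  by (simp add: rank_incl_def cycle_boundary_sum_def boundaries_empty cycles_empty)

lemma rank_incl_le:
  assumes "finite E" "A \<subseteq> E" "B \<subseteq> E"
  shows "rank_incl A B q \<le> 2 * card E"
  using rank_incl_diff_le[OF assms(1), of "{}" "{}" A B q] assms by (simp add: rank_incl_empty)

section \<open>Additivity over disjoint complexes\<close>

lemma bd_cube_nonzero_is_face:
  assumes "bd_cube Q P \<noteq> 0" shows "is_face P Q"
proof -
  obtain j where "snd (Q j)" "P = Q(j := (fst (Q j) + 1, False)) \<or> P = Q(j := (fst (Q j), False))"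
    using assms unfolding bd_cube_def by (auto elim!: sum.not_neutral_contains_not_neutral split: if_splits)
  then show ?thesis unfolding is_face_def by (auto split: if_splits)
qed

lemma bd_support:
  assumes "cubical_complex K" "c \<in> chains K q" "bd c P \<noteq> 0" shows "P \<in> K"
proof -
  obtain Q where "c Q \<noteq> 0" "bd_cube Q P \<noteq> 0"
    using assms(3) unfolding bd_def by (auto elim!: sum.not_neutral_contains_not_neutral)
  then show ?thesis
    using assms(1,2) bd_cube_nonzero_is_face[of Q P] unfolding cubical_complex_def chains_def by auto
qed

text \<open>Closure under faces keeps the boundary of a chain of \<open>B\<close> inside
  \<open>B\<close>. Disjoint complexes therefore yield subspaces with disjoint supports, which meet
  only in 0.\<close>

lemma cycle_boundary_sum_support:
  assumes "cubical_complex B" "A \<subseteq> B" "x \<in> cycle_boundary_sum A B q" "x P \<noteq> 0"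
  shows "P \<in> B"
proof (rule ccontr)
  assume P: "P \<notin> B"
  obtain a b where ab: "x = a + bd b" "a \<in> cycles A q" "b \<in> chains B (Suc q)"
    using assms(3) unfolding cycle_boundary_sum_def boundaries_def by auto
  have "a P = 0" using ab(2) assms(2) P unfolding cycles_def chains_def by auto
  moreover have "bd b P = 0" using bd_support[OF assms(1) ab(3)] P by auto
  ultimately show False using assms(4) ab(1) by simp
qed

lemma restrict_chain_split:
  assumes "c \<in> chains (K \<union> K') q" "K \<inter> K' = {}"
  shows "c = restrict_chain K c + restrict_chain K' c"
    "restrict_chain K c \<in> chains K q" "restrict_chain K' c \<in> chains K' q"
proof -
  show "c = restrict_chain K c + restrict_chain K' c"
    using assms unfolding chains_def restrict_chain_def by (auto simp: fun_eq_iff)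
  have "(K \<union> K') \<inter> K = K" "(K \<union> K') \<inter> K' = K'" by auto
  then show "restrict_chain K c \<in> chains K q" "restrict_chain K' c \<in> chains K' q"
    using restrict_chain_in_chains[OF assms(1), of K] restrict_chain_in_chains[OF assms(1), of K']
    by simp_all
qed

text \<open>The boundaries of the two restrictions of a cycle cancel each other, but they are
  supported on disjoint complexes, so each of them is zero.\<close>

lemma cycles_Un_disjoint:
  assumes "cubical_complex K" "cubical_complex K'" "K \<inter> K' = {}"
  shows "cycles (K \<union> K') q = {v + w | v w. v \<in> cycles K q \<and> w \<in> cycles K' q}"
proof (intro set_eqI iffI)
  fix c assume "c \<in> cycles (K \<union> K') q"
  then have c: "c \<in> chains (K \<union> K') q" "bd c = 0" unfolding cycles_def by auto
  note s = restrict_chain_split[OF c(1) assms(3)]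
  let ?v = "restrict_chain K c" and ?w = "restrict_chain K' c"
  have "bd c = bd ?v + bd ?w"
    by (subst s(1)) (rule bd_add; rule finite_support_chains; rule s)
  then have sum0: "bd ?v P + bd ?w P = 0" for P
    using c(2) by (metis plus_fun_apply zero_fun_apply)
  have "bd ?v P = 0 \<and> bd ?w P = 0" for P
    using sum0[of P] bd_support[OF assms(1) s(2), of P] bd_support[OF assms(2) s(3), of P] assms(3)
    by (cases "P \<in> K") auto
  then have "?v \<in> cycles K q" "?w \<in> cycles K' q"
    using s(2,3) unfolding cycles_def by (auto simp: fun_eq_iff)
  with s(1) show "c \<in> {v + w | v w. v \<in> cycles K q \<and> w \<in> cycles K' q}" by blast
next
  fix c assume "c \<in> {v + w | v w. v \<in> cycles K q \<and> w \<in> cycles K' q}"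
  then obtain v w where "c = v + w" "v \<in> cycles (K \<union> K') q" "w \<in> cycles (K \<union> K') q"
    using cycles_mono[of K "K \<union> K'" q] cycles_mono[of K' "K \<union> K'" q] by auto
  then show "c \<in> cycles (K \<union> K') q" using chain.subspace_add[OF subspace_cycles] by simp
qed

lemma boundaries_Un_disjoint:
  assumes "K \<inter> K' = {}"
  shows "boundaries (K \<union> K') q = {v + w | v w. v \<in> boundaries K q \<and> w \<in> boundaries K' q}"
proof (intro set_eqI iffI)
  fix x assume "x \<in> boundaries (K \<union> K') q"
  then obtain c where c: "c \<in> chains (K \<union> K') (Suc q)" "x = bd c" unfolding boundaries_def by auto
  note s = restrict_chain_split[OF c(1) assms]
  have "bd c = bd (restrict_chain K c) + bd (restrict_chain K' c)"
    by (subst s(1)) (rule bd_add; rule finite_support_chains; rule s)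
  with s(2,3) c(2) show "x \<in> {v + w | v w. v \<in> boundaries K q \<and> w \<in> boundaries K' q}"
    unfolding boundaries_def by blast
next
  fix c assume "c \<in> {v + w | v w. v \<in> boundaries K q \<and> w \<in> boundaries K' q}"
  then obtain v w where "c = v + w" "v \<in> boundaries (K \<union> K') q" "w \<in> boundaries (K \<union> K') q"
    using boundaries_mono[of K "K \<union> K'" q] boundaries_mono[of K' "K \<union> K'" q] by auto
  then show "c \<in> boundaries (K \<union> K') q" using chain.subspace_add[OF subspace_boundaries] by simp
qed

text \<open>Numerator and denominator both split as direct sums, because the parts belonging to
  \<open>B\<close> and to \<open>B'\<close> have disjoint supports.\<close>

lemma rank_incl_Un_disjoint:
  assumes fin: "finite B" "finite B'" and sub: "A \<subseteq> B" "A' \<subseteq> B'"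
    and cc: "cubical_complex A" "cubical_complex A'" "cubical_complex B" "cubical_complex B'"
    and disj: "B \<inter> B' = {}"
  shows "rank_incl (A \<union> A') (B \<union> B') q = rank_incl A B q + rank_incl A' B' q"
proof -
  have finA: "finite A" "finite A'" using fin sub finite_subset by auto
  have disjA: "A \<inter> A' = {}" using sub disj by auto
  let ?V = "cycle_boundary_sum A B q" and ?W = "cycle_boundary_sum A' B' q"
  have VW: "?V \<inter> ?W \<subseteq> {0}"
  proof
    fix x assume x: "x \<in> ?V \<inter> ?W"
    have "x P = 0" for P
      using x cycle_boundary_sum_support[OF cc(3) sub(1), of x q P]
        cycle_boundary_sum_support[OF cc(4) sub(2), of x q P] disj by auto
    then show "x \<in> {0}" by (auto simp: fun_eq_iff)
  qed
  have "cycle_boundary_sum (A \<union> A') (B \<union> B') q = {v + w | v w. v \<in> ?V \<and> w \<in> ?W}"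
    (is "?L = ?R")
  proof (intro set_eqI iffI)
    fix x assume "x \<in> ?L"
    then obtain a a' b b' where x: "x = (a + a') + (b + b')" "a \<in> cycles A q" "a' \<in> cycles A' q"
      "b \<in> boundaries B q" "b' \<in> boundaries B' q"
      unfolding cycle_boundary_sum_def cycles_Un_disjoint[OF cc(1,2) disjA]
        boundaries_Un_disjoint[OF disj] by blast
    then have "a + b \<in> ?V" "a' + b' \<in> ?W"
      unfolding cycle_boundary_sum_def by blast+
    moreover have "x = (a + b) + (a' + b')" using x(1) by (simp add: algebra_simps)
    ultimately show "x \<in> ?R" by blast
  next
    fix x assume "x \<in> ?R"
    then obtain a a' b b' where x: "x = (a + b) + (a' + b')" "a \<in> cycles A q" "a' \<in> cycles A' q"
      "b \<in> boundaries B q" "b' \<in> boundaries B' q"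
      unfolding cycle_boundary_sum_def by blast
    then have "a + a' \<in> cycles (A \<union> A') q" "b + b' \<in> boundaries (B \<union> B') q"
      unfolding cycles_Un_disjoint[OF cc(1,2) disjA] boundaries_Un_disjoint[OF disj]
      by blast+
    moreover have "x = (a + a') + (b + b')" using x(1) by (simp add: algebra_simps)
    ultimately
    show "x \<in> ?L" unfolding cycle_boundary_sum_def by blast
  qed
  moreover obtain S where S: "finite S" "?V \<subseteq> chain.span S"
    by (rule cycle_boundary_sum_finite_dim[OF finA(1) fin(1)])
  moreover obtain T where T: "finite T" "?W \<subseteq> chain.span T"
    by (rule cycle_boundary_sum_finite_dim[OF finA(2) fin(2)])
  ultimately have d1: "vdim (cycle_boundary_sum (A \<union> A') (B \<union> B') q) = vdim ?V + vdim ?W"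
    unfolding vdim_def
    using chain.dim_direct_sum[OF subspace_cycle_boundary_sum S(2,1) subspace_cycle_boundary_sum T(2,1) VW]
    by simp
  have sB: "boundaries B q \<subseteq> chain.span S" "boundaries B' q \<subseteq> chain.span T"
    using S(2) T(2) boundaries_subset_cycle_boundary_sum[of B q A]
      boundaries_subset_cycle_boundary_sum[of B' q A'] by auto
  have "boundaries B q \<inter> boundaries B' q \<subseteq> {0}"
    using VW boundaries_subset_cycle_boundary_sum[of B q A]
      boundaries_subset_cycle_boundary_sum[of B' q A'] by auto
  then have d2: "vdim (boundaries (B \<union> B') q) = vdim (boundaries B q) + vdim (boundaries B' q)"
    unfolding vdim_def boundaries_Un_disjoint[OF disj]
    by (intro chain.dim_direct_sum[OF subspace_boundaries sB(1) S(1) subspace_boundaries sB(2) T(1)])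
  show ?thesis
    unfolding rank_incl_def d1 d2
    using vdim_boundaries_le[OF finA(1) fin(1), of q] vdim_boundaries_le[OF finA(2) fin(2), of q] by simp
qed

lemma cubical_complex_UN: "(\<And>j. j \<in> J \<Longrightarrow> cubical_complex (K j)) \<Longrightarrow> cubical_complex (\<Union>j\<in>J. K j)"
  unfolding cubical_complex_def by blast

lemma rank_incl_UN_disjoint:
  assumes "finite J" "\<And>j. j \<in> J \<Longrightarrow> finite (B j)" "\<And>j. j \<in> J \<Longrightarrow> A j \<subseteq> B j"
    "\<And>j. j \<in> J \<Longrightarrow> cubical_complex (A j)" "\<And>j. j \<in> J \<Longrightarrow> cubical_complex (B j)"
    "\<And>i j. i \<in> J \<Longrightarrow> j \<in> J \<Longrightarrow> i \<noteq> j \<Longrightarrow> B i \<inter> B j = {}"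
  shows "rank_incl (\<Union>j\<in>J. A j) (\<Union>j\<in>J. B j) q = (\<Sum>j\<in>J. rank_incl (A j) (B j) q)"
  using assms
proof (induction J rule: finite_induct)
  case empty
  then show ?case by (simp add: rank_incl_empty)
next
  case (insert i J)
  have "rank_incl (A i \<union> (\<Union>j\<in>J. A j)) (B i \<union> (\<Union>j\<in>J. B j)) q
      = rank_incl (A i) (B i) q + rank_incl (\<Union>j\<in>J. A j) (\<Union>j\<in>J. B j) q"
  proof (rule rank_incl_Un_disjoint)
    show "(\<Union>j\<in>J. A j) \<subseteq> (\<Union>j\<in>J. B j)" using insert.prems(2) by (intro UN_mono) auto
    have "B i \<inter> B j = {}" if "j \<in> J" for j
      using insert.hyps insert.prems(5)[of i j] that by auto
    then show "B i \<inter> (\<Union>j\<in>J. B j) = {}" by auto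
  qed (use insert in \<open>auto intro!: cubical_complex_UN\<close>)
  moreover have "rank_incl (\<Union>j\<in>J. A j) (\<Union>j\<in>J. B j) q = (\<Sum>j\<in>J. rank_incl (A j) (B j) q)"
    by (rule insert.IH) (use insert.prems in auto)
  ultimately show ?case using insert.hyps by simp
qed

section \<open>Translation invariance of the rank\<close>

lemma shift_cube_inverse: "shift_cube (\<lambda>i. - z i) (shift_cube z Q) = Q"
  "shift_cube z (shift_cube (\<lambda>i. - z i) Q) = Q"
  by (auto simp: shift_cube_def fun_eq_iff)

lemma inj_shift_cube: "inj (shift_cube z)"
  by (metis injI shift_cube_inverse(1))

lemma cube_dim_shift_cube: "cube_dim (shift_cube z Q) = cube_dim Q"
  by (simp add: cube_dim_def shift_cube_def)

text \<open>The sign of a face depends only on which directions are nondegenerate, and a translation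
  keeps these.\<close>

lemma bd_cube_shift_cube: "bd_cube (shift_cube z Q) (shift_cube z P) = bd_cube Q P"
proof -
  have "(shift_cube z P = (shift_cube z Q)(j := (fst (shift_cube z Q j) + k, False)))
      \<longleftrightarrow> P = Q(j := (fst (Q j) + k, False))" for j k
  proof -
    have "(shift_cube z Q)(j := (fst (shift_cube z Q j) + k, False))
        = shift_cube z (Q(j := (fst (Q j) + k, False)))"
      by (auto simp: shift_cube_def)
    then show ?thesis using inj_shift_cube by (auto dest: injD)
  qed
  from this[of _ 1] this[of _ 0] show ?thesis
    unfolding bd_cube_def by (simp add: shift_cube_def)
qed

text \<open>The push-forward of a chain: the argument is translated back, so that the support moves
  by \<open>z\<close>.\<close>

definition shift_chain :: "('d \<Rightarrow> int) \<Rightarrow> 'd chain \<Rightarrow> 'd chain" where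
  "shift_chain z c = (\<lambda>Q. c (shift_cube (\<lambda>i. - z i) Q))"

lemma shift_chain_inverse: "shift_chain z (shift_chain (\<lambda>i. - z i) c) = c"
  by (auto simp: shift_chain_def shift_cube_inverse)

lemma linear_shift_chain:
  "Vector_Spaces.linear chain_scale chain_scale (shift_chain z :: 'd chain \<Rightarrow> 'd chain)"
  by unfold_locales (auto simp: shift_chain_def chain_scale_def fun_eq_iff algebra_simps)

lemma support_shift_chain: "{Q. shift_chain z c Q \<noteq> 0} = shift_cube z ` {Q. c Q \<noteq> 0}"
proof (intro set_eqI iffI)
  fix Q assume "Q \<in> {Q. shift_chain z c Q \<noteq> 0}"
  then show "Q \<in> shift_cube z ` {Q. c Q \<noteq> 0}"
    by (intro image_eqI[of _ _ "shift_cube (\<lambda>i. - z i) Q"]) (auto simp: shift_chain_def shift_cube_inverse)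
qed (auto simp: shift_chain_def shift_cube_inverse)

lemma bd_shift_chain: "bd (shift_chain z c) = shift_chain z (bd c)"
proof
  fix P
  obtain P' where P: "P = shift_cube z P'" by (metis shift_cube_inverse(2))
  have "bd (shift_chain z c) P = (\<Sum>Q\<in>{Q. c Q \<noteq> 0}. c Q * bd_cube (shift_cube z Q) P)"
    unfolding bd_def support_shift_chain
    by (subst sum.reindex) (auto simp: shift_chain_def shift_cube_inverse intro: inj_on_subset[OF inj_shift_cube])
  then show "bd (shift_chain z c) P = shift_chain z (bd c) P"
    by (simp add: P bd_cube_shift_cube shift_chain_def shift_cube_inverse bd_def)
qed

lemma shift_chain_in_chains: "c \<in> chains K q \<Longrightarrow> shift_chain z c \<in> chains (shift_cube z ` K) q"
proof -
  assume c: "c \<in> chains K q"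
  have "finite {Q. shift_chain z c Q \<noteq> 0}"
    unfolding support_shift_chain using c by (simp add: chains_def)
  moreover have "Q \<in> shift_cube z ` K \<and> cube_dim Q = q" if "shift_chain z c Q \<noteq> 0" for Q
  proof -
    have "Q \<in> shift_cube z ` {Q. c Q \<noteq> 0}" using that support_shift_chain[of z c] by blast
    then show ?thesis using c by (auto simp: chains_def cube_dim_shift_cube)
  qed
  ultimately show ?thesis by (simp add: chains_def)
qed

lemma shift_chain_in_cycles: "c \<in> cycles K q \<Longrightarrow> shift_chain z c \<in> cycles (shift_cube z ` K) q"
  using shift_chain_in_chains[of c K q z] bd_shift_chain[of z c]
  unfolding cycles_def by (simp add: shift_chain_def fun_eq_iff)

lemma shift_chain_in_boundaries:
  "x \<in> boundaries K q \<Longrightarrow> shift_chain z x \<in> boundaries (shift_cube z ` K) q"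
  unfolding boundaries_def by (auto simp: bd_shift_chain[symmetric] intro!: imageI shift_chain_in_chains)

lemma shift_chain_in_cycle_boundary_sum:
  assumes "x \<in> cycle_boundary_sum A B q"
  shows "shift_chain z x \<in> cycle_boundary_sum (shift_cube z ` A) (shift_cube z ` B) q"
proof -
  obtain a b where "x = a + b" "a \<in> cycles A q" "b \<in> boundaries B q"
    using assms unfolding cycle_boundary_sum_def by auto
  moreover have "shift_chain z (a + b) = shift_chain z a + shift_chain z b"
    by (auto simp: shift_chain_def)
  ultimately show ?thesis
    unfolding cycle_boundary_sum_def using shift_chain_in_cycles shift_chain_in_boundaries by blast
qed

lemma vdim_shift_chain_le:
  assumes "finite T" "V \<subseteq> chain.span T"
  shows "vdim (shift_chain z ` V) \<le> vdim V"
proof -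
  interpret L: Vector_Spaces.linear chain_scale chain_scale "shift_chain z" by (rule linear_shift_chain)
  obtain B where B: "V \<subseteq> chain.span B" "card B = chain.dim V" "finite B"
    by (rule chain.finite_basis_exists[OF assms(2,1)])
  have "shift_chain z ` V \<subseteq> chain.span (shift_chain z ` B)"
    using B(1) L.span_image[of B] by (simp add: image_mono)
  then have "vdim (shift_chain z ` V) \<le> card (shift_chain z ` B)"
    unfolding vdim_def using B(3) by (intro chain.dim_le_card) auto
  also have "\<dots> \<le> card B" using B(3) by (rule card_image_le)
  finally show ?thesis using B(2) by (simp add: vdim_def)
qed

lemma vdim_shift_cube_le:
  assumes fin: "finite A" "finite B"
  shows "vdim (cycle_boundary_sum (shift_cube z ` A) (shift_cube z ` B) q)
      \<le> vdim (cycle_boundary_sum A B q)"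
    and "vdim (boundaries (shift_cube z ` B) q) \<le> vdim (boundaries B q)"
proof -
  obtain S where S: "finite S" "cycle_boundary_sum A B q \<subseteq> chain.span S"
    by (rule cycle_boundary_sum_finite_dim[OF fin])
  obtain T where T: "finite T" "boundaries B q \<subseteq> chain.span T"
    by (rule boundaries_finite_dim[OF fin(2)])
  have sh: "shift_cube (\<lambda>i. - z i) ` shift_cube z ` K = K" for K
    by (auto simp: image_image shift_cube_inverse)
  have "x \<in> shift_chain z ` cycle_boundary_sum A B q"
    if "x \<in> cycle_boundary_sum (shift_cube z ` A) (shift_cube z ` B) q" for x
    using shift_chain_in_cycle_boundary_sum[OF that, of "\<lambda>i. - z i"] unfolding sh
    by (intro image_eqI[where x = "shift_chain (\<lambda>i. - z i) x"]) (simp_all add: shift_chain_inverse)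
  then have "cycle_boundary_sum (shift_cube z ` A) (shift_cube z ` B) q
      = shift_chain z ` cycle_boundary_sum A B q"
    using shift_chain_in_cycle_boundary_sum by blast
  then show "vdim (cycle_boundary_sum (shift_cube z ` A) (shift_cube z ` B) q)
      \<le> vdim (cycle_boundary_sum A B q)"
    using vdim_shift_chain_le[OF S] by simp
  have "x \<in> shift_chain z ` boundaries B q"
    if "x \<in> boundaries (shift_cube z ` B) q" for x
    using shift_chain_in_boundaries[OF that, of "\<lambda>i. - z i"] unfolding sh
    by (intro image_eqI[where x = "shift_chain (\<lambda>i. - z i) x"]) (simp_all add: shift_chain_inverse)
  then have "boundaries (shift_cube z ` B) q = shift_chain z ` boundaries B q"
    using shift_chain_in_boundaries by blast
  then show "vdim (boundaries (shift_cube z ` B) q) \<le> vdim (boundaries B q)"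
    using vdim_shift_chain_le[OF T] by simp
qed

text \<open>Translation by \<open>z\<close> does not increase either dimension, and translation by
  \<open>- z\<close> gives the reverse inequalities.\<close>

lemma rank_incl_shift:
  assumes "finite A" "finite B"
  shows "rank_incl (shift_cube z ` A) (shift_cube z ` B) q = rank_incl A B q"
proof -
  let ?m = "\<lambda>i. - z i"
  have inv: "shift_cube ?m ` shift_cube z ` K = K" for K
    by (auto simp: image_image shift_cube_inverse)
  have fin: "finite (shift_cube z ` A)" "finite (shift_cube z ` B)" using assms by auto
  have "vdim (cycle_boundary_sum (shift_cube z ` A) (shift_cube z ` B) q) = vdim (cycle_boundary_sum A B q)"
    using vdim_shift_cube_le(1)[OF assms, of z q] vdim_shift_cube_le(1)[OF fin, of ?m q]
    unfolding inv by simp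
  moreover have "vdim (boundaries (shift_cube z ` B) q) = vdim (boundaries B q)"
    using vdim_shift_cube_le(2)[OF assms, of z q] vdim_shift_cube_le(2)[OF fin, of ?m q]
    unfolding inv by simp
  ultimately show ?thesis by (simp add: rank_incl_def)
qed

section \<open>Boxes and blocks\<close>

definition cbox_at :: "('d::finite \<Rightarrow> int) \<Rightarrow> nat \<Rightarrow> (real ^ 'd) set" where
  "cbox_at z n = {x. \<forall>i. real_of_int (z i) - real n \<le> x $ i \<and> x $ i \<le> real_of_int (z i) + real n}"

definition box_cubes :: "('d::finite \<Rightarrow> int) \<Rightarrow> nat \<Rightarrow> 'd cube set" where
  "box_cubes z n = {Q. cube_set Q \<subseteq> cbox_at z n}"

text \<open>The factors allowed in one coordinate: \<open>2 * n + 1\<close> points and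
  \<open>2 * n\<close> unit intervals. A box of cubes is a product of such sets, which is the origin
  of the count \<open>4 * n + 1\<close> per direction.\<close>

definition box_intervals :: "int \<Rightarrow> nat \<Rightarrow> (int \<times> bool) set" where
  "box_intervals a n = {a - int n..a + int n} \<times> {False} \<union> {a - int n..<a + int n} \<times> {True}"

lemma box_intervals_iff:
  "p \<in> box_intervals a n \<longleftrightarrow>
    a - int n \<le> fst p \<and> fst p + (if snd p then 1 else 0) \<le> a + int n"
  by (cases p) (auto simp: box_intervals_def)

lemma card_box_intervals: "card (box_intervals a n) = 4 * n + 1"
  unfolding box_intervals_def by (subst card_Un_disjoint) (auto simp: card_cartesian_product)

lemma finite_box_intervals: "finite (box_intervals a n)"
  by (simp add: box_intervals_def)

lemma box_cubes_iff: "Q \<in> box_cubes z n \<longleftrightarrow> (\<forall>i. Q i \<in> box_intervals (z i) n)"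
proof
  assume Q: "Q \<in> box_cubes z n"
  \<comment> \<open>The two extreme corners of the cube lie in the box exactly when the cube does,
    and they reduce the inclusion to one pair of inequalities per coordinate.\<close>
  let ?lo = "(\<chi> i. real_of_int (fst (Q i)))"
    and ?hi = "(\<chi> i. real_of_int (fst (Q i)) + (if snd (Q i) then 1 else 0))"
  have "?lo \<in> cube_set Q" "?hi \<in> cube_set Q" unfolding cube_set_def by auto
  then have "?lo \<in> cbox_at z n" "?hi \<in> cbox_at z n" using Q unfolding box_cubes_def by auto
  then have lo: "real_of_int (z i) - real n \<le> real_of_int (fst (Q i))"
    and hi: "real_of_int (fst (Q i)) + (if snd (Q i) then 1 else 0) \<le> real_of_int (z i) + real n" for i
    unfolding cbox_at_def by auto
  have "z i - int n \<le> fst (Q i) \<and> fst (Q i) + (if snd (Q i) then 1 else 0) \<le> z i + int n" for i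
    using lo[of i] hi[of i] by (auto split: if_splits)
  then show "\<forall>i. Q i \<in> box_intervals (z i) n" by (simp add: box_intervals_iff)
next
  assume Q: "\<forall>i. Q i \<in> box_intervals (z i) n"
  have "real_of_int (z i) - real n \<le> real_of_int (fst (Q i))"
    "real_of_int (fst (Q i)) + (if snd (Q i) then 1 else 0) \<le> real_of_int (z i) + real n" for i
    using Q[rule_format, of i] unfolding box_intervals_iff by (auto split: if_splits)
  note lohi = this
  have "cube_set Q \<subseteq> cbox_at z n"
  proof
    fix x assume "x \<in> cube_set Q"
    then have x: "real_of_int (fst (Q i)) \<le> x $ i"
      "x $ i \<le> real_of_int (fst (Q i)) + (if snd (Q i) then 1 else 0)" for i
      unfolding cube_set_def by blast+
    show "x \<in> cbox_at z n"
      unfolding cbox_at_def using order_trans[OF lohi(1) x(1)] order_trans[OF x(2) lohi(2)] by blast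
  qed
  then show "Q \<in> box_cubes z n"
    by (simp add: box_cubes_def)
qed

lemma box_cubes_eq_PiE: "box_cubes z n = PiE UNIV (\<lambda>i. box_intervals (z i) n)"
  by (auto simp: box_cubes_iff PiE_def Pi_def)

lemma finite_box_cubes: "finite (box_cubes z n)"
  unfolding box_cubes_eq_PiE by (intro finite_PiE finite_box_intervals) auto

lemma card_box_cubes: "card (box_cubes (z :: 'd::finite \<Rightarrow> int) n) = (4 * n + 1) ^ CARD('d)"
  unfolding box_cubes_eq_PiE by (subst card_PiE) (auto simp: card_box_intervals)

lemma shift_cube_box_cubes: "shift_cube z ` box_cubes (\<lambda>_. 0) n = box_cubes z n"
proof (intro set_eqI iffI)
  fix Q assume "Q \<in> box_cubes z n"
  then have "shift_cube (\<lambda>i. - z i) Q \<in> box_cubes (\<lambda>_. 0) n"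
    unfolding box_cubes_iff box_intervals_iff shift_cube_def by (smt (verit) fst_conv snd_conv)
  then show "Q \<in> shift_cube z ` box_cubes (\<lambda>_. 0) n"
    by (intro image_eqI[where x = "shift_cube (\<lambda>i. - z i) Q"]) (auto simp: shift_cube_inverse)
next
  fix Q assume "Q \<in> shift_cube z ` box_cubes (\<lambda>_. 0) n"
  then obtain Q' where Q: "Q = shift_cube z Q'" "Q' \<in> box_cubes (\<lambda>_. 0) n" by blast
  show "Q \<in> box_cubes z n"
    using Q(2) unfolding Q(1) box_cubes_iff box_intervals_iff shift_cube_def
    by (smt (verit) fst_conv snd_conv)
qed

lemma cubical_complex_box_cubes: "cubical_complex (box_cubes z n)"
  unfolding cubical_complex_def
proof clarify
  fix Q P assume Q: "Q \<in> box_cubes z n" and P: "is_face P Q"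
  have "P i \<in> box_intervals (z i) n" for i
    using Q P unfolding box_cubes_iff is_face_def box_intervals_iff
    by (auto split: if_splits dest!: spec[of _ i])
  then show "P \<in> box_cubes z n" by (simp add: box_cubes_iff)
qed

lemma cubical_complex_Int: "cubical_complex K \<Longrightarrow> cubical_complex K' \<Longrightarrow> cubical_complex (K \<inter> K')"
  unfolding cubical_complex_def by blast

lemma Lambda_eq_cbox_at: "Lambda n = cbox_at (\<lambda>_. 0) n"
  by (simp add: Lambda_def cbox_at_def)

lemma restrict_box_eq: "restrict_box n X t = X t \<inter> box_cubes (\<lambda>_. 0) n"
  by (auto simp: restrict_box_def box_cubes_def Lambda_eq_cbox_at)

lemma cbox_at_nonempty: "cbox_at z n \<noteq> {}"
proof -
  have "(\<chi> i. real_of_int (z i)) \<in> cbox_at z n" by (simp add: cbox_at_def)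
  then show ?thesis by blast
qed

lemma dist_cbox_at_ge:
  assumes "x \<in> cbox_at z n" "y \<in> cbox_at w n" "\<bar>z i - w i\<bar> \<ge> 2 * int n + int r"
  shows "real r \<le> dist x y"
proof -
  have "real r \<le> \<bar>x $ i - y $ i\<bar>"
  proof -
    have "real_of_int \<bar>z i - w i\<bar> \<ge> real_of_int (2 * int n + int r)"
      using assms(3) by (simp only: of_int_le_iff)
    moreover have "real_of_int (z i) - real n \<le> x $ i \<and> x $ i \<le> real_of_int (z i) + real n"
      "real_of_int (w i) - real n \<le> y $ i \<and> y $ i \<le> real_of_int (w i) + real n"
      using assms(1,2) unfolding cbox_at_def by auto
    ultimately show ?thesis by (auto simp: abs_if split: if_splits)
  qed
  also have "\<dots> \<le> dist x y" using dist_vec_nth_le[of x i y] by (simp add: dist_real_def)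
  finally show ?thesis .
qed

lemma box_cubes_disjoint:
  assumes "\<bar>z i - w i\<bar> > 2 * int n"
  shows "box_cubes z n \<inter> box_cubes w n = {}"
proof -
  have "False" if "Q \<in> box_cubes z n" "Q \<in> box_cubes w n" for Q
    using that assms unfolding box_cubes_iff box_intervals_iff
    by (auto split: if_splits dest!: spec[of _ i])
  then show ?thesis by auto
qed

section \<open>The grid of separated blocks\<close>

text \<open>Blocks of width \<open>2 * K\<close> repeat with period \<open>2 * K + R + 1\<close>.
  The gap is \<open>R + 1\<close> because \<open>R_dependent\<close> asks for a distance strictly
  larger than \<open>R\<close>; it is positive even for \<open>R = 0\<close>, so neighbouring blocks
  share no cube.\<close>

definition block_number :: "nat \<Rightarrow> nat \<Rightarrow> nat \<Rightarrow> nat" where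
  "block_number R N K = 2 * N div (2 * K + R + 1)"

definition block_index :: "nat \<Rightarrow> ('d::finite \<Rightarrow> int) set" where
  "block_index m = PiE UNIV (\<lambda>_. {0..<int m})"

text \<open>The block of index 0 starts at the lower end \<open>- N\<close> of the box. Since
  \<open>block_number\<close> counts full periods in \<open>2 * N\<close>, the last block also stays
  inside.\<close>

definition block_centre :: "nat \<Rightarrow> nat \<Rightarrow> nat \<Rightarrow> ('d \<Rightarrow> int) \<Rightarrow> 'd \<Rightarrow> int" where
  "block_centre R N K j = (\<lambda>i. int K - int N + j i * int (2 * K + R + 1))"

lemma finite_block_index: "finite (block_index m)"
  unfolding block_index_def by (intro finite_PiE) auto

lemma card_block_index: "card (block_index m :: ('d::finite \<Rightarrow> int) set) = m ^ CARD('d)"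
  unfolding block_index_def by (subst card_PiE) auto

lemma block_centre_separated:
  assumes "j \<noteq> k"
  obtains i where "\<bar>block_centre R N K j i - block_centre R N K k i\<bar> \<ge> 2 * int K + int (Suc R)"
proof -
  obtain i where i: "j i \<noteq> k i" using assms by auto
  have "block_centre R N K j i - block_centre R N K k i = (j i - k i) * int (2 * K + R + 1)"
    by (simp add: block_centre_def algebra_simps)
  then have "\<bar>block_centre R N K j i - block_centre R N K k i\<bar> = \<bar>j i - k i\<bar> * int (2 * K + R + 1)"
    by (simp add: abs_mult)
  moreover have "1 * int (2 * K + R + 1) \<le> \<bar>j i - k i\<bar> * int (2 * K + R + 1)"
    using i by (intro mult_right_mono) auto
  ultimately have "\<bar>block_centre R N K j i - block_centre R N K k i\<bar> \<ge> int (2 * K + R + 1)"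
    by (simp only: mult_1_left)
  then have "\<bar>block_centre R N K j i - block_centre R N K k i\<bar> \<ge> 2 * int K + int (Suc R)" by simp
  then show thesis by (rule that)
qed

lemma block_subset:
  assumes "j \<in> block_index (block_number R N K)"
  shows "box_cubes (block_centre R N K j) K \<subseteq> box_cubes (\<lambda>_. 0) N"
proof
  fix Q assume Q: "Q \<in> box_cubes (block_centre R N K j) K"
  let ?s = "2 * K + R + 1"
  have "Q i \<in> box_intervals 0 N" for i
  proof -
    have "j i \<in> {0..<int (block_number R N K)}"
      using assms unfolding block_index_def by (auto simp: PiE_def Pi_def)
    then have j: "0 \<le> j i" "j i + 1 \<le> int (block_number R N K)" by auto
    have "(j i + 1) * int ?s \<le> int (block_number R N K) * int ?s"
      using j(2) by (intro mult_right_mono) auto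
    also have "\<dots> = int (block_number R N K * ?s)" by (simp only: of_nat_mult)
    also have "\<dots> \<le> int (2 * N)"
      unfolding block_number_def by (subst of_nat_le_iff) (rule div_times_less_eq_dividend)
    finally have "j i * int ?s + int ?s \<le> 2 * int N" by (simp add: algebra_simps)
    moreover have "0 \<le> j i * int ?s" using j(1) by simp
    moreover have "Q i \<in> box_intervals (int K - int N + j i * int ?s) K"
      using Q unfolding box_cubes_iff block_centre_def by auto
    ultimately show ?thesis unfolding box_intervals_iff by (auto split: if_splits)
  qed
  then show "Q \<in> box_cubes (\<lambda>_. 0) N" by (simp add: box_cubes_iff)
qed

section \<open>Vectors of persistent Betti numbers\<close>

definition betti_vec ::
    "(real \<Rightarrow> 'd::{finite,linorder} cube set) \<Rightarrow> nat \<Rightarrow> ('h \<Rightarrow> real \<times> real) \<Rightarrow> 'd cube set \<Rightarrow> real ^ 'h::finite" where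
  "betti_vec Y q P C = (\<chi> i. real (rank_incl (Y (fst (P i)) \<inter> C) (Y (snd (P i)) \<inter> C) q))"

lemma betti_vec_restrict_box:
  "betti_vec Y q P (box_cubes (\<lambda>_. 0) n) $ i = real (pbetti (restrict_box n Y) q (fst (P i)) (snd (P i)))"
  by (simp add: betti_vec_def pbetti_eq_rank_incl restrict_box_eq)

lemma betti_vec_range:
  assumes "finite C"
  shows "betti_vec Y q P C \<in> {v. \<forall>i. v $ i \<in> real ` {0..2 * card C}}"
  using rank_incl_le[OF assms, of "Y (fst (P i)) \<inter> C" "Y (snd (P i)) \<inter> C" q for i]
  by (auto simp: betti_vec_def)

text \<open>Deleting the cubes of \<open>C\<close> outside all \<open>D j\<close> leaves a disjoint
  union, over which ranks add. Each component changes by at most 2 per deleted cube; bounding the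
  Euclidean norm by the sum of the components brings in the factor \<open>CARD('h)\<close>.\<close>

lemma betti_vec_nearly_additive:
  fixes P :: "'h::finite \<Rightarrow> real \<times> real"
  assumes filt: "cubical_filtration Y" and P: "\<And>i. 0 \<le> fst (P i) \<and> fst (P i) \<le> snd (P i)"
    and J: "finite J" and C: "finite C" and D: "\<And>j. j \<in> J \<Longrightarrow> D j \<subseteq> C"
    and cc: "\<And>j. j \<in> J \<Longrightarrow> cubical_complex (D j)"
    and disj: "\<And>j k. j \<in> J \<Longrightarrow> k \<in> J \<Longrightarrow> j \<noteq> k \<Longrightarrow> D j \<inter> D k = {}"
  shows "norm (betti_vec Y q P C - (\<Sum>j\<in>J. betti_vec Y q P (D j)))
      \<le> 2 * real CARD('h) * (real (card C) - (\<Sum>j\<in>J. real (card (D j))))"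
proof -
  let ?E = "C - (\<Union>j\<in>J. D j)"
  have finD: "finite (D j)" if "j \<in> J" for j using D[OF that] C finite_subset by auto
  have cardE: "real (card ?E) = real (card C) - (\<Sum>j\<in>J. real (card (D j)))"
  proof -
    have sub: "(\<Union>j\<in>J. D j) \<subseteq> C" using D by auto
    have "card ?E = card C - card (\<Union>j\<in>J. D j)"
      using sub C by (intro card_Diff_subset) (auto intro: finite_subset)
    moreover have "card (\<Union>j\<in>J. D j) \<le> card C" using sub C by (intro card_mono)
    moreover have "card (\<Union>j\<in>J. D j) = (\<Sum>j\<in>J. card (D j))"
      using J finD disj by (intro card_UN_disjoint) auto
    ultimately show ?thesis by simp
  qed
  have comp: "\<bar>(betti_vec Y q P C - (\<Sum>j\<in>J. betti_vec Y q P (D j))) $ i\<bar> \<le> 2 * real (card ?E)" for i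
  proof -
    let ?s = "fst (P i)" and ?t = "snd (P i)"
    have Y: "cubical_complex (Y ?s)" "cubical_complex (Y ?t)" "Y ?s \<subseteq> Y ?t"
      using filt P[of i] unfolding cubical_filtration_def by auto
    have "rank_incl (\<Union>j\<in>J. Y ?s \<inter> D j) (\<Union>j\<in>J. Y ?t \<inter> D j) q
        = (\<Sum>j\<in>J. rank_incl (Y ?s \<inter> D j) (Y ?t \<inter> D j) q)"
    proof (rule rank_incl_UN_disjoint)
      show "(Y ?t \<inter> D j) \<inter> (Y ?t \<inter> D k) = {}" if "j \<in> J" "k \<in> J" "j \<noteq> k" for j k
        using disj[OF that] by auto
    qed (use J finD Y cc in \<open>auto intro: cubical_complex_Int\<close>)
    moreover have "\<bar>real (rank_incl (Y ?s \<inter> C) (Y ?t \<inter> C) q)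
        - real (rank_incl (\<Union>j\<in>J. Y ?s \<inter> D j) (\<Union>j\<in>J. Y ?t \<inter> D j) q)\<bar> \<le> 2 * real (card ?E)"
      by (rule rank_incl_diff_le) (use C J D finD in auto)
    ultimately show ?thesis by (simp add: betti_vec_def)
  qed
  have "norm (betti_vec Y q P C - (\<Sum>j\<in>J. betti_vec Y q P (D j)))
      \<le> (\<Sum>i\<in>UNIV. \<bar>(betti_vec Y q P C - (\<Sum>j\<in>J. betti_vec Y q P (D j))) $ i\<bar>)"
    by (rule norm_le_l1_cart)
  also have "\<dots> \<le> (\<Sum>i\<in>(UNIV::'h set). 2 * real (card ?E))" by (intro sum_mono comp)
  also have "\<dots> = 2 * real CARD('h) * (real (card C) - (\<Sum>j\<in>J. real (card (D j))))"
    using cardE by simp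
  finally show ?thesis .
qed

section \<open>Stationarity and independence of the block vectors\<close>

locale random_filtration = prob_space M
  for M :: "'w measure" and X :: "'w \<Rightarrow> real \<Rightarrow> 'd::{finite,linorder} cube set"
    and R q :: nat and P :: "'h::finite \<Rightarrow> real \<times> real" +
  assumes rcf: "random_cubical_filtration M X" and stat: "stationary M X"
    and Rdep: "R_dependent M X R" and P_ok: "\<And>i. 0 \<le> fst (P i) \<and> fst (P i) \<le> snd (P i)"
begin

definition time_set :: "real set" where
  "time_set = range (\<lambda>i. fst (P i)) \<union> range (\<lambda>i. snd (P i))"

definition window :: "nat \<Rightarrow> ('d cube \<times> real) set" where
  "window n = box_cubes (\<lambda>_. 0) n \<times> time_set"

text \<open>The finite configuration seen in the box around \<open>z\<close>, with positions
  recorded relative to \<open>z\<close>. Its distribution does not depend on \<open>z\<close>, and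
  questions of measurability and stationarity reduce to finitely many indicator events.\<close>

definition pattern :: "('d \<Rightarrow> int) \<Rightarrow> nat \<Rightarrow> 'w \<Rightarrow> ('d cube \<times> real) set" where
  "pattern z n \<omega> = {p \<in> window n. shift_cube z (fst p) \<in> X \<omega> (snd p)}"

definition pattern_betti :: "('d cube \<times> real) set \<Rightarrow> real ^ 'h" where
  "pattern_betti A = (\<chi> i. real (rank_incl {Q. (Q, fst (P i)) \<in> A} {Q. (Q, snd (P i)) \<in> A} q))"

definition block_betti :: "('d \<Rightarrow> int) \<Rightarrow> nat \<Rightarrow> 'w \<Rightarrow> real ^ 'h" where
  "block_betti z n \<omega> = betti_vec (X \<omega>) q P (box_cubes z n)"

lemma finite_time_set: "finite time_set" by (simp add: time_set_def)

lemma time_set_nonneg: "t \<in> time_set \<Longrightarrow> 0 \<le> t"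
  unfolding time_set_def using P_ok order_trans[OF conjunct1[OF P_ok] conjunct2[OF P_ok]] by auto

lemma finite_window: "finite (window n)"
  unfolding window_def by (intro finite_cartesian_product finite_box_cubes finite_time_set)

lemma pattern_subset: "pattern z n \<omega> \<in> Pow (window n)"
  by (auto simp: pattern_def)

text \<open>By translation invariance of the rank, the vector of a block is the same function of its
  pattern for every centre \<open>z\<close>; equal distribution of the patterns thus passes to the
  vectors.\<close>

lemma block_betti_eq_pattern_betti: "block_betti z n \<omega> = pattern_betti (pattern z n \<omega>)"
proof -
  have "rank_incl (X \<omega> s \<inter> box_cubes z n) (X \<omega> t \<inter> box_cubes z n) q =
      rank_incl {Q. (Q, s) \<in> pattern z n \<omega>} {Q. (Q, t) \<in> pattern z n \<omega>} q"
    if "s \<in> time_set" "t \<in> time_set" for s t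
  proof -
    have eq: "X \<omega> s \<inter> box_cubes z n = shift_cube z ` {Q. (Q, s) \<in> pattern z n \<omega>}"
      if "s \<in> time_set" for s
      unfolding pattern_def window_def shift_cube_box_cubes[of z n, symmetric] using that by auto
    have fin: "finite {Q. (Q, s) \<in> pattern z n \<omega>}" for s
      by (rule finite_subset[OF _ finite_box_cubes[of "\<lambda>_. 0" n]]) (auto simp: pattern_def window_def)
    show ?thesis unfolding eq[OF that(1)] eq[OF that(2)] by (rule rank_incl_shift[OF fin fin])
  qed
  then show ?thesis
    by (simp add: block_betti_def betti_vec_def pattern_betti_def time_set_def)
qed

lemma restr_sigma_subset: "restr_sigma M X S \<subseteq> sets M"
proof -
  have "{{\<omega> \<in> space M. Q \<in> X \<omega> t} | Q t. Q \<in> S \<and> 0 \<le> t} \<subseteq> sets M"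
    using rcf unfolding random_cubical_filtration_def by auto
  then show ?thesis unfolding restr_sigma_def by (rule sets.sigma_sets_subset)
qed

lemma sigma_algebra_restr_sigma: "sigma_algebra (space M) (restr_sigma M X S)"
  unfolding restr_sigma_def by (rule sigma_algebra_sigma_sets) auto

lemma pattern_event:
  "{\<omega> \<in> space M. pattern z n \<omega> = A} \<in> restr_sigma M X (box_cubes z n)"
proof (cases "A \<subseteq> window n")
  case False
  then have empty: "{\<omega> \<in> space M. pattern z n \<omega> = A} = {}" by (auto simp: pattern_def)
  interpret S: sigma_algebra "space M" "restr_sigma M X (box_cubes z n)" by (rule sigma_algebra_restr_sigma)
  show ?thesis unfolding empty by simp
next
  case True
  interpret S: sigma_algebra "space M" "restr_sigma M X (box_cubes z n)" by (rule sigma_algebra_restr_sigma)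
  let ?W = "window n"
  have "{\<omega> \<in> space M. pattern z n \<omega> = A} =
      {\<omega> \<in> space M. \<forall>p\<in>?W. (shift_cube z (fst p) \<in> X \<omega> (snd p)) = (p \<in> A)}"
    using True unfolding pattern_def by auto
  also have "\<dots> \<in> restr_sigma M X (box_cubes z n)"
  proof (rule S.sets_Collect_finite_All[OF _ finite_window])
    fix p assume p: "p \<in> ?W"
    have "shift_cube z (fst p) \<in> box_cubes z n" "0 \<le> snd p"
      using p time_set_nonneg shift_cube_box_cubes[of z n] unfolding window_def by auto
    then have "{\<omega> \<in> space M. shift_cube z (fst p) \<in> X \<omega> (snd p)} \<in> restr_sigma M X (box_cubes z n)"
      unfolding restr_sigma_def by (intro sigma_sets.Basic) blast
    then show "{\<omega> \<in> space M. (shift_cube z (fst p) \<in> X \<omega> (snd p)) = (p \<in> A)} \<in> restr_sigma M X (box_cubes z n)"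
      by (cases "p \<in> A") (auto intro: S.sets_Collect_neg)
  qed
  finally show ?thesis .
qed

lemma prob_pattern: "prob {\<omega> \<in> space M. pattern z n \<omega> = A} = prob {\<omega> \<in> space M. pattern (\<lambda>_. 0) n \<omega> = A}"
proof (cases "A \<subseteq> window n")
  case False
  then have "{\<omega> \<in> space M. pattern z n \<omega> = A} = {}" for z by (auto simp: pattern_def)
  then show ?thesis by (simp only:)
next
  case True
  let ?W = "window n"
  obtain ps where ps: "set ps = ?W" using finite_list[OF finite_window] by metis
  have ev: "{\<omega> \<in> space M. pattern z n \<omega> = A} =
      {\<omega> \<in> space M. map (\<lambda>(Q, t). shift_cube z Q \<in> X \<omega> t) ps = map (\<lambda>p. p \<in> A) ps}" for z
    using True ps unfolding pattern_def map_eq_conv case_prod_beta by auto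
  have nonneg: "\<forall>p\<in>set ps. 0 \<le> snd p" using ps time_set_nonneg by (auto simp: window_def)
  note stat_ps = stat[unfolded stationary_def, THEN spec, THEN spec, THEN spec, THEN mp, OF nonneg]
  \<comment> \<open>Stationarity compares a shifted configuration with the unshifted one. It is used
    twice, for \<open>z\<close> and for the zero shift that occurs in
    \<open>pattern (\<lambda>_. 0)\<close>.\<close>
  show ?thesis
    unfolding ev by (rule trans[OF stat_ps[symmetric] stat_ps])
qed

lemma pattern_sum:
  "f (block_betti z n \<omega>) = (\<Sum>A\<in>Pow (window n).
      f (pattern_betti A) * indicator {\<omega> \<in> space M. pattern z n \<omega> = A} \<omega>)" (is "_ = (\<Sum>A\<in>?W. _)")
  if "\<omega> \<in> space M" for f :: "real ^ 'h \<Rightarrow> real"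
proof -
  have fin: "finite ?W" using finite_window by simp
  have "(\<Sum>A\<in>?W. f (pattern_betti A) * indicator {\<omega> \<in> space M. pattern z n \<omega> = A} \<omega>) =
      (\<Sum>A\<in>?W. if A = pattern z n \<omega> then f (pattern_betti A) else 0)"
    using that by (intro sum.cong) (auto simp: indicator_def)
  also have "\<dots> = f (block_betti z n \<omega>)"
    using pattern_subset[of z n \<omega>] fin by (simp add: block_betti_eq_pattern_betti)
  finally show ?thesis by simp
qed

lemma pattern_event_sets: "{\<omega> \<in> space M. pattern z n \<omega> = A} \<in> sets M"
  using pattern_event restr_sigma_subset by blast

lemma integral_block_betti:
  fixes f :: "real ^ 'h \<Rightarrow> real"
  shows "expectation (\<lambda>\<omega>. f (block_betti z n \<omega>)) = expectation (\<lambda>\<omega>. f (block_betti (\<lambda>_. 0) n \<omega>))"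
    and "integrable M (\<lambda>\<omega>. f (block_betti z n \<omega>))"
proof -
  let ?W = "Pow (window n)"
  have int: "integrable M (\<lambda>\<omega>. f (pattern_betti A) * indicator {\<omega> \<in> space M. pattern z n \<omega> = A} \<omega>)" for z A
    using pattern_event_sets by (intro integrable_mult_right integrable_real_indicator) (auto simp: emeasure_eq_measure)
  have "expectation (\<lambda>\<omega>. f (block_betti z n \<omega>)) =
      (\<Sum>A\<in>?W. f (pattern_betti A) * prob {\<omega> \<in> space M. pattern z n \<omega> = A})" for z
  proof -
    have "expectation (\<lambda>\<omega>. f (block_betti z n \<omega>)) = expectation (\<lambda>\<omega>. \<Sum>A\<in>?W.
      f (pattern_betti A) * indicator {\<omega> \<in> space M. pattern z n \<omega> = A} \<omega>)"
      by (intro Bochner_Integration.integral_cong refl pattern_sum)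
    also have "\<dots> = (\<Sum>A\<in>?W. expectation (\<lambda>\<omega>. f (pattern_betti A) * indicator {\<omega> \<in> space M. pattern z n \<omega> = A} \<omega>))"
      by (intro Bochner_Integration.integral_sum int)
    also have "\<dots> = (\<Sum>A\<in>?W. f (pattern_betti A) * prob {\<omega> \<in> space M. pattern z n \<omega> = A})"
      using pattern_event_sets by (intro sum.cong refl) simp
    finally show ?thesis .
  qed
  then show "expectation (\<lambda>\<omega>. f (block_betti z n \<omega>)) = expectation (\<lambda>\<omega>. f (block_betti (\<lambda>_. 0) n \<omega>))"
    using prob_pattern[of z n] by simp
  have "integrable M (\<lambda>\<omega>. \<Sum>A\<in>?W. f (pattern_betti A) * indicator {\<omega> \<in> space M. pattern z n \<omega> = A} \<omega>)"
    by (intro Bochner_Integration.integrable_sum int)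
  then show "integrable M (\<lambda>\<omega>. f (block_betti z n \<omega>))"
    by (subst Bochner_Integration.integrable_cong[OF refl pattern_sum]) auto
qed

text \<open>Only finitely many patterns occur, so the preimage of an arbitrary set is a finite union
  of pattern events. This is why \<open>count_space UNIV\<close> can serve as target space, and the
  event lies in the sigma-algebra of the block, as independence requires.\<close>

lemma block_betti_event:
  "block_betti z n -` B \<inter> space M \<in> restr_sigma M X (box_cubes z n)"
proof -
  interpret S: sigma_algebra "space M" "restr_sigma M X (box_cubes z n)" by (rule sigma_algebra_restr_sigma)
  let ?W = "Pow (window n)"
  have "block_betti z n -` B \<inter> space M =
      (\<Union>A\<in>{A \<in> ?W. pattern_betti A \<in> B}. {\<omega> \<in> space M. pattern z n \<omega> = A})"
    using pattern_subset[of z n] by (auto simp: block_betti_eq_pattern_betti)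
  also have "\<dots> \<in> restr_sigma M X (box_cubes z n)"
    using finite_window[of n] pattern_event by (intro S.finite_UN finite_Collect_conjI disjI1) auto
  finally show ?thesis .
qed

lemma block_betti_measurable: "block_betti z n \<in> M \<rightarrow>\<^sub>M count_space UNIV"
  using block_betti_event[THEN subsetD[OF restr_sigma_subset]] by (auto simp: measurable_def)

section \<open>Independence of separated blocks\<close>

text \<open>\<open>R_dependent\<close> speaks of two regions only. Mutual independence follows by
  induction: one box is separated from the union of the others, and the intersection of the events
  of the others belongs to the sigma-algebra of that union.\<close>

lemma indep_sets_separated_boxes:
  assumes sep: "\<And>j k. j \<in> J \<Longrightarrow> k \<in> J \<Longrightarrow> j \<noteq> k \<Longrightarrow> \<exists>i. \<bar>c j i - c k i\<bar> \<ge> 2 * int n + int (Suc R)"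
  shows "indep_sets (\<lambda>j. restr_sigma M X (box_cubes (c j) n)) J"
proof (rule indep_setsI)
  show "restr_sigma M X (box_cubes (c j) n) \<subseteq> events" for j by (rule restr_sigma_subset)
next
  fix A I assume I: "I \<noteq> {}" "I \<subseteq> J" "finite I"
    and A: "\<forall>j\<in>I. A j \<in> restr_sigma M X (box_cubes (c j) n)"
  show "prob (\<Inter>j\<in>I. A j) = (\<Prod>j\<in>I. prob (A j))"
    using I(3,1,2) A
  proof (induction I rule: finite_ne_induct)
    case (singleton x)
    then show ?case by simp
  next
    case (insert i I)
    let ?U = "\<Union>j\<in>I. cbox_at (c j) n"
    have sd: "real (Suc R) \<le> setdist (cbox_at (c i) n) ?U"
    proof (rule le_setdistI)
      show "?U \<noteq> {}" using insert.hyps(2) cbox_at_nonempty by fastforce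
      fix x y assume x: "x \<in> cbox_at (c i) n" and "y \<in> ?U"
      then obtain j where j: "j \<in> I" "y \<in> cbox_at (c j) n" by blast
      have "i \<noteq> j" using insert.hyps j by auto
      then obtain k where "\<bar>c i k - c j k\<bar> \<ge> 2 * int n + int (Suc R)"
        using sep[of i j] insert.prems j(1) by auto
      then show "real (Suc R) \<le> dist x y" by (rule dist_cbox_at_ge[OF x j(2)])
    qed (rule cbox_at_nonempty)
    then have "setdist (cbox_at (c i) n) ?U > real R" by simp
    then have ind: "indep_set (restr_sigma M X {Q. cube_set Q \<subseteq> cbox_at (c i) n})
        (restr_sigma M X {Q. cube_set Q \<subseteq> ?U})"
      using Rdep unfolding R_dependent_def by blast
    interpret S: sigma_algebra "space M" "restr_sigma M X {Q. cube_set Q \<subseteq> ?U}" by (rule sigma_algebra_restr_sigma)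
    have "A j \<in> restr_sigma M X {Q. cube_set Q \<subseteq> ?U}" if j: "j \<in> I" for j
    proof -
      have "A j \<in> restr_sigma M X (box_cubes (c j) n)" using insert.prems j by auto
      moreover have "restr_sigma M X (box_cubes (c j) n) \<subseteq> restr_sigma M X {Q. cube_set Q \<subseteq> ?U}"
        unfolding restr_sigma_def box_cubes_def using j by (intro sigma_sets_mono') blast
      ultimately show ?thesis by blast
    qed
    then have "(\<Inter>j\<in>I. A j) \<in> restr_sigma M X {Q. cube_set Q \<subseteq> ?U}"
      using insert.hyps by (intro S.finite_INT) auto
    moreover have "A i \<in> restr_sigma M X {Q. cube_set Q \<subseteq> cbox_at (c i) n}"
      using insert.prems by (simp add: box_cubes_def)
    ultimately have "prob (A i \<inter> (\<Inter>j\<in>I. A j)) = prob (A i) * prob (\<Inter>j\<in>I. A j)"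
      using indep_setD[OF ind] by blast
    then show ?case using insert by simp
  qed
qed

text \<open>The functions may vary with the block: the moment generating function uses the same
  exponential throughout, the mean a single non-constant factor, and the lower bound indicators of
  different prescribed values.\<close>

lemma expectation_prod_block_betti:
  fixes f :: "'j \<Rightarrow> real ^ 'h \<Rightarrow> real"
  assumes sep: "\<And>j k. j \<in> J \<Longrightarrow> k \<in> J \<Longrightarrow> j \<noteq> k \<Longrightarrow> \<exists>i. \<bar>c j i - c k i\<bar> \<ge> 2 * int n + int (Suc R)"
    and J: "finite J"
  shows "expectation (\<lambda>\<omega>. \<Prod>j\<in>J. f j (block_betti (c j) n \<omega>))
      = (\<Prod>j\<in>J. expectation (\<lambda>\<omega>. f j (block_betti (\<lambda>_. 0) n \<omega>)))"
proof -
  have "indep_vars (\<lambda>_. count_space UNIV) (\<lambda>j. block_betti (c j) n) J"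
    unfolding indep_vars_def2
  proof (intro conjI ballI block_betti_measurable)
    show "indep_sets (\<lambda>j. {block_betti (c j) n -` A \<inter> space M |A. A \<in> sets (count_space UNIV)}) J"
      by (rule indep_sets_mono_sets[OF indep_sets_separated_boxes[OF sep]])
        (auto intro: block_betti_event)
  qed
  then have "indep_vars (\<lambda>_. borel) (\<lambda>j \<omega>. f j (block_betti (c j) n \<omega>)) J"
    by (rule indep_vars_compose2) auto
  then have "expectation (\<lambda>\<omega>. \<Prod>j\<in>J. f j (block_betti (c j) n \<omega>))
      = (\<Prod>j\<in>J. expectation (\<lambda>\<omega>. f j (block_betti (c j) n \<omega>)))"
    by (intro indep_vars_lebesgue_integral J integral_block_betti(2))
  also have "\<dots> = (\<Prod>j\<in>J. expectation (\<lambda>\<omega>. f j (block_betti (\<lambda>_. 0) n \<omega>)))"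
    by (intro prod.cong refl integral_block_betti(1))
  finally show ?thesis .
qed

end

section \<open>Large deviations of nearly additive vectors\<close>

lemma (in prob_space) integrable_finite_range:
  fixes f :: "'b \<Rightarrow> real"
  assumes "Y \<in> M \<rightarrow>\<^sub>M count_space UNIV" "finite S" "\<And>\<omega>. \<omega> \<in> space M \<Longrightarrow> Y \<omega> \<in> S"
  shows "integrable M (\<lambda>\<omega>. f (Y \<omega>))"
proof (rule integrable_const_bound)
  show "(\<lambda>\<omega>. f (Y \<omega>)) \<in> borel_measurable M"
    using assms(1) by (rule measurable_compose) auto
  show "AE \<omega> in M. norm (f (Y \<omega>)) \<le> (\<Sum>s\<in>S. norm (f s))"
    using assms by (intro AE_I2 member_le_sum) auto
qed

section \<open>A bound for the exponential and the rounding of frequencies\<close>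

lemma exp_le_one_plus_square:
  fixes y :: real
  assumes "\<bar>y\<bar> \<le> 1" shows "exp y \<le> 1 + y + y\<^sup>2"
proof (cases "0 \<le> y")
  case True
  then show ?thesis using assms exp_bound[of y] by simp
next
  case False
  define x where "x = - y"
  have x: "0 \<le> x" "x \<le> 1" "y = - x" using assms False by (auto simp: x_def)
  \<comment> \<open>The product equals \<open>1 + x ^ 3\<close>.\<close>
  have "1 \<le> (1 - x + x\<^sup>2) * (1 + x)"
    using x by (simp add: power2_eq_square algebra_simps)
  also have "\<dots> \<le> (1 - x + x\<^sup>2) * exp x"
    using x exp_ge_add_one_self[of x] by (intro mult_left_mono) auto
  finally have "exp (- x) \<le> 1 - x + x\<^sup>2"
    by (simp add: exp_minus field_simps)
  then show ?thesis using x by simp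
qed

text \<open>Each value in turn claims \<open>k v\<close> of the free positions; the last one takes
  all that remain, so that every position receives a value in \<open>S\<close>.\<close>

lemma ex_assignment_with_counts:
  fixes k :: "'v \<Rightarrow> nat"
  assumes "finite S" "S \<noteq> {}"
  shows "finite T \<Longrightarrow> sum k S \<le> card T \<Longrightarrow>
    \<exists>g. (\<forall>j\<in>T. g j \<in> S) \<and> (\<forall>v\<in>S. k v \<le> card {j \<in> T. g j = v})"
  using assms
proof (induction S arbitrary: T rule: finite_ne_induct)
  case (singleton v)
  then show ?case by (intro exI[of _ "\<lambda>_. v"]) auto
next
  case (insert v S)
  then have "k v \<le> card T" by simp
  then obtain T' where T': "T' \<subseteq> T" "card T' = k v" "finite T'"
    by (rule obtain_subset_with_card_n)
  have "card (T - T') = card T - k v" using T' by (simp add: card_Diff_subset)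
  then have "sum k S \<le> card (T - T')" using insert.prems insert.hyps by simp
  then obtain g where g: "\<forall>j\<in>T - T'. g j \<in> S" "\<forall>w\<in>S. k w \<le> card {j \<in> T - T'. g j = w}"
    using insert.IH[of "T - T'"] insert.prems by auto
  define g' where "g' j = (if j \<in> T' then v else g j)" for j
  have "k w \<le> card {j \<in> T. g' j = w}" if "w \<in> insert v S" for w
  proof (cases "w = v")
    case True
    have "card T' \<le> card {j \<in> T. g' j = w}"
      using T' True insert.prems by (intro card_mono) (auto simp: g'_def)
    then show ?thesis using T' True by simp
  next
    case False
    then have "k w \<le> card {j \<in> T - T'. g j = w}" using that g by auto
    also have "\<dots> \<le> card {j \<in> T. g' j = w}"
      using insert.prems by (intro card_mono) (auto simp: g'_def)
    finally show ?thesis .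
  qed
  moreover have "\<forall>j\<in>T. g' j \<in> insert v S" using g by (auto simp: g'_def)
  ultimately show ?case by (intro exI[of _ g']) auto
qed

text \<open>Rounding down leaves each count at most 1 below its share. As the counts add up to
  \<open>n\<close>, a value can exceed its share only by what the others fall short of
  theirs.\<close>

lemma ex_assignment_with_frequencies:
  fixes \<theta> :: "'v \<Rightarrow> real"
  assumes S: "finite S" and \<theta>: "\<And>v. v \<in> S \<Longrightarrow> 0 \<le> \<theta> v" "sum \<theta> S = 1"
  shows "\<exists>g. (\<forall>j<n. g j \<in> S) \<and>
    (\<forall>v\<in>S. \<bar>real (card {j \<in> {..<n}. g j = v}) - \<theta> v * real n\<bar> \<le> real (card S))"
proof -
  define k where "k v = nat \<lfloor>\<theta> v * real n\<rfloor>" for v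
  have k: "real (k v) \<le> \<theta> v * real n" "\<theta> v * real n - 1 \<le> real (k v)" if "v \<in> S" for v
    using \<theta>(1)[OF that] by (auto simp: k_def)
  have "real (sum k S) \<le> (\<Sum>v\<in>S. \<theta> v * real n)"
    unfolding of_nat_sum by (intro sum_mono k)
  then have "real (sum k S) \<le> real n" using \<theta>(2) by (simp add: sum_distrib_right[symmetric])
  then have le: "sum k S \<le> card {..<n}" unfolding of_nat_le_iff by simp
  have "S \<noteq> {}" using \<theta>(2) by auto
  then obtain g where g: "\<forall>j<n. g j \<in> S" "\<forall>v\<in>S. k v \<le> card {j \<in> {..<n}. g j = v}"
    using ex_assignment_with_counts[OF S _ finite_lessThan le] by auto
  let ?c = "\<lambda>v. real (card {j \<in> {..<n}. g j = v})"
  have lower: "\<theta> v * real n - 1 \<le> ?c v" if "v \<in> S" for v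
    using k(2)[OF that] g(2) that by force
  have tot: "(\<Sum>v\<in>S. ?c v) = real n"
  proof -
    have "(\<Sum>v\<in>S. card {j \<in> {..<n}. g j = v}) = card {..<n}"
      using sum.group[of "{..<n}" S g "\<lambda>_. 1 :: nat"] g(1) S by auto
    then show ?thesis unfolding of_nat_sum[symmetric] by simp
  qed
  have upper: "?c v \<le> \<theta> v * real n + real (card S)" if v: "v \<in> S" for v
  proof -
    have "(\<Sum>w\<in>S - {v}. \<theta> w * real n - 1) \<le> (\<Sum>w\<in>S - {v}. ?c w)"
      by (intro sum_mono lower) auto
    moreover have "(\<Sum>w\<in>S - {v}. ?c w) = real n - ?c v"
      using tot sum.remove[OF S v, of ?c] by simp
    moreover have "(\<Sum>w\<in>S - {v}. \<theta> w * real n - 1) = (1 - \<theta> v) * real n - real (card (S - {v}))"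
      using \<theta>(2) sum.remove[OF S v, of \<theta>] by (simp add: sum_subtractf sum_distrib_right[symmetric])
    moreover have "real (card (S - {v})) \<le> real (card S)" using S by (simp add: card_Diff1_le)
    ultimately show ?thesis by (simp add: algebra_simps)
  qed
  have "1 \<le> real (card S)" using S \<open>S \<noteq> {}\<close> by (simp add: Suc_leI card_gt_0_iff)
  then have "\<bar>?c v - \<theta> v * real n\<bar> \<le> real (card S)" if "v \<in> S" for v
    using lower[OF that] upper[OF that] by linarith
  with g(1) show ?thesis by blast
qed

text \<open>The index \<open>n\<close> stands for the radius of a box and \<open>a n\<close> for its
  volume; \<open>L N K\<close> blocks of radius \<open>K\<close> fit into the box of radius
  \<open>N\<close>, with error \<open>e N K\<close>, and \<open>V n\<close> contains the possible
  values. Independence and equal distribution of the blocks enter jointly through the product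
  formula in \<open>blocks\<close>. In \<open>scale\<close> the radius \<open>K\<close> precedes
  \<open>N\<close>.\<close>

locale nearly_additive = prob_space M
  for M :: "'w measure" +
  fixes \<beta> :: "nat \<Rightarrow> 'w \<Rightarrow> real ^ 'h::finite" and a :: "nat \<Rightarrow> real"
    and L :: "nat \<Rightarrow> nat \<Rightarrow> nat" and e :: "nat \<Rightarrow> nat \<Rightarrow> real"
    and V :: "nat \<Rightarrow> (real ^ 'h) set" and C :: real
  assumes meas: "\<And>n. \<beta> n \<in> M \<rightarrow>\<^sub>M count_space UNIV"
    and finite_V: "\<And>n. finite (V n)"
    and range: "\<And>n \<omega>. \<omega> \<in> space M \<Longrightarrow> \<beta> n \<omega> \<in> V n"
    and bound: "\<And>n v. n > 0 \<Longrightarrow> v \<in> V n \<Longrightarrow> norm v \<le> C * a n"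
    and a_pos: "\<And>n. n > 0 \<Longrightarrow> a n > 0"
    and a_top: "filterlim a at_top sequentially"
    and L_le: "\<And>N K. N > 0 \<Longrightarrow> K > 0 \<Longrightarrow> real (L N K) * a K \<le> a N"
    and entropy: "(\<lambda>n. ln (real (card (V n))) / a n) \<longlonglongrightarrow> 0"
    and scale: "\<And>\<epsilon>. \<epsilon> > 0 \<Longrightarrow> \<forall>\<^sub>F K in sequentially. \<forall>\<^sub>F N in sequentially.
        e N K \<le> \<epsilon> * a N \<and> (1 - \<epsilon>) * a N \<le> real (L N K) * a K"
    and blocks: "\<And>N K. N > 0 \<Longrightarrow> K > 0 \<Longrightarrow> \<exists>b :: nat \<Rightarrow> 'w \<Rightarrow> real ^ 'h.
        (\<forall>\<omega>\<in>space M. norm (\<beta> N \<omega> - (\<Sum>j<L N K. b j \<omega>)) \<le> e N K) \<and>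
        (\<forall>j. b j \<in> M \<rightarrow>\<^sub>M count_space UNIV) \<and> (\<forall>j. \<forall>\<omega>\<in>space M. b j \<omega> \<in> V K) \<and>
        (\<forall>f :: nat \<Rightarrow> real ^ 'h \<Rightarrow> real. expectation (\<lambda>\<omega>. \<Prod>j<L N K. f j (b j \<omega>))
           = (\<Prod>j<L N K. expectation (\<lambda>\<omega>. f j (\<beta> K \<omega>))))"
begin

lemma integrable_\<beta>: "integrable M (\<lambda>\<omega>. f (\<beta> n \<omega>))" for f :: "_ \<Rightarrow> real"
  by (rule integrable_finite_range[OF meas finite_V range])

lemma event_\<beta>: "{\<omega> \<in> space M. \<beta> n \<omega> \<in> B} \<in> sets M"
  using measurable_sets[OF meas, of B n] by (simp add: vimage_def Int_def conj_commute)

lemma norm_\<beta>: "n > 0 \<Longrightarrow> \<omega> \<in> space M \<Longrightarrow> norm (\<beta> n \<omega>) \<le> C * a n"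
  using bound range by blast

lemma C_nonneg: "0 \<le> C"
proof -
  obtain \<omega> where "\<omega> \<in> space M" using not_empty by blast
  then have "0 \<le> C * a 1" using norm_\<beta>[of 1 \<omega>] norm_ge_zero order_trans by (metis less_numeral_extra(1))
  then show ?thesis using a_pos[of 1] by (simp add: zero_le_mult_iff)
qed

section \<open>Limits of nearly additive sequences of numbers\<close>

text \<open>The factor \<open>c\<close> carries all dependence on the particular sequence; error and
  growth are otherwise common. It will be \<open>norm l\<close> for the sequences attached to a
  vector \<open>l\<close>.\<close>

definition nearly_add :: "(nat \<Rightarrow> real) \<Rightarrow> real \<Rightarrow> bool" where
  "nearly_add A c \<longleftrightarrow> 0 \<le> c \<and> (\<forall>N>0. \<forall>K>0. \<bar>A N - real (L N K) * A K\<bar> \<le> c * e N K) \<and>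
     (\<forall>n>0. \<bar>A n\<bar> \<le> c * (C * a n))"

text \<open>Let \<open>r\<close> be the fraction of the volume covered by blocks. Then
  \<open>A N / a N\<close> differs from \<open>r * (A K / a K)\<close> by at most
  \<open>c * \<epsilon>\<close>, and replacing \<open>r\<close> by 1 costs at most
  \<open>\<epsilon> * (c * C)\<close>.\<close>

lemma nearly_add_close:
  assumes A: "nearly_add A c" and K: "K > 0" and \<epsilon>: "0 \<le> \<epsilon>"
    and N: "N > 0" "e N K \<le> \<epsilon> * a N" "(1 - \<epsilon>) * a N \<le> real (L N K) * a K"
  shows "\<bar>A N / a N - A K / a K\<bar> \<le> c * (\<epsilon> * (1 + C))"
proof -
  have aN: "a N > 0" and aK: "a K > 0" using a_pos N K by auto
  let ?r = "real (L N K) * a K / a N"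
  have r: "?r \<le> 1" "1 - \<epsilon> \<le> ?r"
    using L_le[OF N(1) K] N(3) aN by (auto simp: field_simps)
  have "A N / a N - A K / a K = (A N - real (L N K) * A K) / a N - (1 - ?r) * (A K / a K)"
    using aN aK by (simp add: field_simps)
  also have "\<bar>\<dots>\<bar> \<le> \<bar>A N - real (L N K) * A K\<bar> / a N + (1 - ?r) * \<bar>A K / a K\<bar>"
    using abs_triangle_ineq4[of "(A N - real (L N K) * A K) / a N" "(1 - ?r) * (A K / a K)"] r aN
    by (simp add: abs_mult)
  also have "\<dots> \<le> c * \<epsilon> + \<epsilon> * (c * C)"
  proof (rule add_mono)
    have "\<bar>A N - real (L N K) * A K\<bar> \<le> c * e N K" using A N(1) K unfolding nearly_add_def by blast
    also have "\<dots> \<le> c * (\<epsilon> * a N)" using A N(2) unfolding nearly_add_def by (intro mult_left_mono) auto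
    finally show "\<bar>A N - real (L N K) * A K\<bar> / a N \<le> c * \<epsilon>" using aN by (simp add: field_simps)
    have "\<bar>A K\<bar> \<le> c * (C * a K)" using A K unfolding nearly_add_def by blast
    then have "\<bar>A K / a K\<bar> \<le> c * C" using aK by (simp add: field_simps)
    then show "(1 - ?r) * \<bar>A K / a K\<bar> \<le> \<epsilon> * (c * C)" using r \<epsilon> by (intro mult_mono) auto
  qed
  finally show ?thesis by (simp add: algebra_simps)
qed

text \<open>The quantifiers over \<open>A\<close> and \<open>c\<close> stand behind the one over
  \<open>K\<close>: the same block radius serves all sequences.\<close>

lemma nearly_add_eventually_close:
  assumes "\<epsilon> > 0"
  shows "\<forall>\<^sub>F K in sequentially. \<forall>A c. nearly_add A c \<longrightarrow>
    (\<forall>\<^sub>F N in sequentially. \<bar>A N / a N - A K / a K\<bar> \<le> c * \<epsilon>)"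
proof -
  define \<delta> where "\<delta> = \<epsilon> / (1 + C)"
  have \<delta>: "\<delta> > 0" "\<delta> * (1 + C) = \<epsilon>" using assms C_nonneg by (auto simp: \<delta>_def)
  show ?thesis
    using scale[OF \<delta>(1)] eventually_gt_at_top[of 0]
  proof eventually_elim
    case (elim K)
    show ?case
    proof (intro allI impI)
      fix A c assume A: "nearly_add A c"
      show "\<forall>\<^sub>F N in sequentially. \<bar>A N / a N - A K / a K\<bar> \<le> c * \<epsilon>"
        using elim(1) eventually_gt_at_top[of 0]
      proof eventually_elim
        case (elim N)
        then show ?case
          using nearly_add_close[OF A \<open>0 < K\<close>, of \<delta> N] \<delta> by auto
      qed
    qed
  qed
qed

text \<open>For all large \<open>N\<close> the quotients are close to the one at a fixed
  \<open>K\<close>. Additivity up to a two-sided error thus gives a Cauchy sequence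
  directly.\<close>

lemma nearly_add_convergent:
  assumes A: "nearly_add A c"
  shows "convergent (\<lambda>n. A n / a n)"
proof -
  have c: "0 \<le> c" using A by (simp add: nearly_add_def)
  have "Cauchy (\<lambda>n. A n / a n)"
  proof (rule CauchyI)
    fix \<epsilon> :: real assume \<epsilon>: "\<epsilon> > 0"
    define \<delta> where "\<delta> = \<epsilon> / (4 * (c + 1))"
    have \<delta>: "\<delta> > 0" "c * \<delta> < \<epsilon> / 2"
      using \<epsilon> c by (auto simp: \<delta>_def field_simps intro: add_pos_nonneg)
    obtain K where "\<forall>\<^sub>F N in sequentially. \<bar>A N / a N - A K / a K\<bar> \<le> c * \<delta>"
      using eventually_happens[OF nearly_add_eventually_close[OF \<delta>(1)]] A by auto
    then obtain N0 where N0: "\<bar>A N / a N - A K / a K\<bar> \<le> c * \<delta>" if "N \<ge> N0" for N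
      unfolding eventually_sequentially by auto
    have "norm (A m / a m - A n / a n) < \<epsilon>" if "m \<ge> N0" "n \<ge> N0" for m n
      using N0[OF that(1)] N0[OF that(2)] \<delta>(2) unfolding real_norm_def by linarith
    then show "\<exists>N0. \<forall>m\<ge>N0. \<forall>n\<ge>N0. norm (A m / a m - A n / a n) < \<epsilon>" by blast
  qed
  then show ?thesis by (simp add: Cauchy_convergent_iff)
qed

lemma nearly_add_limit_close:
  assumes "\<epsilon> > 0"
  shows "\<forall>\<^sub>F K in sequentially. \<forall>A c x. nearly_add A c \<longrightarrow> (\<lambda>n. A n / a n) \<longlonglongrightarrow> x \<longrightarrow>
    \<bar>x - A K / a K\<bar> \<le> c * \<epsilon>"
  using nearly_add_eventually_close[OF assms]
proof eventually_elim
  case (elim K)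
  show ?case
  proof (intro allI impI)
    fix A c x assume A: "nearly_add A c" and x: "(\<lambda>n. A n / a n) \<longlonglongrightarrow> x"
    have "(\<lambda>n. \<bar>A n / a n - A K / a K\<bar>) \<longlonglongrightarrow> \<bar>x - A K / a K\<bar>" by (intro tendsto_intros x)
    then show "\<bar>x - A K / a K\<bar> \<le> c * \<epsilon>"
      using elim A by (intro tendsto_upperbound[where F = sequentially]) auto
  qed
qed

section \<open>Moment generating functions and means\<close>

definition Z :: "nat \<Rightarrow> real ^ 'h \<Rightarrow> real" where
  "Z n l = expectation (\<lambda>\<omega>. exp (l \<bullet> \<beta> n \<omega>))"

definition mean :: "nat \<Rightarrow> real ^ 'h" where
  "mean n = (\<chi> i. expectation (\<lambda>\<omega>. \<beta> n \<omega> $ i))"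

lemma inner_mean: "l \<bullet> mean n = expectation (\<lambda>\<omega>. l \<bullet> \<beta> n \<omega>)"
proof -
  have "expectation (\<lambda>\<omega>. l \<bullet> \<beta> n \<omega>) = (\<Sum>i\<in>UNIV. expectation (\<lambda>\<omega>. l $ i * \<beta> n \<omega> $ i))"
    unfolding inner_vec_def inner_real_def
    by (rule Bochner_Integration.integral_sum) (rule integrable_\<beta>[of "\<lambda>v. l $ i * v $ i" for i])
  then show ?thesis by (simp add: inner_vec_def mean_def)
qed

lemma Z_bounds:
  assumes "n > 0" shows "exp (- (norm l * (C * a n))) \<le> Z n l" "Z n l \<le> exp (norm l * (C * a n))"
proof -
  have b: "\<bar>l \<bullet> \<beta> n \<omega>\<bar> \<le> norm l * (C * a n)" if "\<omega> \<in> space M" for \<omega>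
    using Cauchy_Schwarz_ineq2[of l "\<beta> n \<omega>"] mult_left_mono[OF norm_\<beta>[OF assms that], of "norm l"] by auto
  have b': "- (norm l * (C * a n)) \<le> l \<bullet> \<beta> n \<omega>" if "\<omega> \<in> space M" for \<omega>
    using b[OF that] by linarith
  have "expectation (\<lambda>_. exp (- (norm l * (C * a n)))) \<le> Z n l"
    unfolding Z_def using b' by (intro integral_mono integrable_\<beta>[of "\<lambda>v. exp (l \<bullet> v)"]) auto
  then show "exp (- (norm l * (C * a n))) \<le> Z n l" by (simp add: prob_space)
  have "Z n l \<le> expectation (\<lambda>_. exp (norm l * (C * a n)))"
    unfolding Z_def using b by (intro integral_mono integrable_\<beta>[of "\<lambda>v. exp (l \<bullet> v)"]) (auto simp: abs_le_iff)
  then show "Z n l \<le> exp (norm l * (C * a n))" by (simp add: prob_space)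
qed

lemma Z_pos: "n > 0 \<Longrightarrow> Z n l > 0"
  using Z_bounds(1)[of n l] exp_gt_zero less_le_trans by blast

text \<open>Passing from \<open>\<beta> N\<close> to the sum of the blocks changes the exponent by
  at most \<open>norm l * e N K\<close>, and for the sum the expectation factorises into
  \<open>Z K l ^ L N K\<close>.\<close>

lemma nearly_add_ln_Z: "nearly_add (\<lambda>n. ln (Z n l)) (norm l)"
  unfolding nearly_add_def
proof (intro conjI allI impI)
  fix n :: nat assume n: "n > 0"
  show "\<bar>ln (Z n l)\<bar> \<le> norm l * (C * a n)"
    using Z_bounds[OF n, of l] Z_pos[OF n, of l] ln_ge_iff[of "Z n l" "- (norm l * (C * a n))"]
      ln_mono[of "Z n l" "exp (norm l * (C * a n))"] by (simp add: abs_le_iff)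
next
  fix N K :: nat assume NK: "N > 0" "K > 0"
  obtain b :: "nat \<Rightarrow> 'w \<Rightarrow> real ^ 'h" where
    b: "\<And>\<omega>. \<omega> \<in> space M \<Longrightarrow> norm (\<beta> N \<omega> - (\<Sum>j<L N K. b j \<omega>)) \<le> e N K"
      "\<And>j. b j \<in> M \<rightarrow>\<^sub>M count_space UNIV" "\<And>j \<omega>. \<omega> \<in> space M \<Longrightarrow> b j \<omega> \<in> V K"
      "\<And>f :: nat \<Rightarrow> real ^ 'h \<Rightarrow> real. expectation (\<lambda>\<omega>. \<Prod>j<L N K. f j (b j \<omega>))
           = (\<Prod>j<L N K. expectation (\<lambda>\<omega>. f j (\<beta> K \<omega>)))"
    using blocks[OF NK] by blast
  let ?s = "\<lambda>\<omega>. \<Sum>j<L N K. b j \<omega>" and ?d = "norm l * e N K"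
  have diff: "\<bar>l \<bullet> \<beta> N \<omega> - l \<bullet> ?s \<omega>\<bar> \<le> ?d" if "\<omega> \<in> space M" for \<omega>
    using Cauchy_Schwarz_ineq2[of l "\<beta> N \<omega> - ?s \<omega>"] mult_left_mono[OF b(1)[OF that], of "norm l"]
    by (simp add: inner_diff_right)
  have prod: "exp (l \<bullet> ?s \<omega>) = (\<Prod>j<L N K. exp (l \<bullet> b j \<omega>))" for \<omega>
    by (simp add: inner_sum_right exp_sum)
  have ZK: "expectation (\<lambda>\<omega>. exp (l \<bullet> ?s \<omega>)) = Z K l ^ L N K"
    unfolding prod using b(4)[of "\<lambda>_ v. exp (l \<bullet> v)"] by (simp add: Z_def)
  have int: "integrable M (\<lambda>\<omega>. exp (l \<bullet> ?s \<omega>))"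
  proof (rule integrable_const_bound)
    show "(\<lambda>\<omega>. exp (l \<bullet> ?s \<omega>)) \<in> borel_measurable M"
      unfolding prod by (intro borel_measurable_prod measurable_compose[OF b(2)]) auto
    show "AE \<omega> in M. norm (exp (l \<bullet> ?s \<omega>)) \<le> exp (norm l * (C * a N) + ?d)"
    proof (rule AE_I2)
      fix \<omega> assume \<omega>: "\<omega> \<in> space M"
      have "l \<bullet> \<beta> N \<omega> \<le> norm l * (C * a N)"
        using norm_cauchy_schwarz[of l "\<beta> N \<omega>"] mult_left_mono[OF norm_\<beta>[OF NK(1) \<omega>], of "norm l"] by auto
      then show "norm (exp (l \<bullet> ?s \<omega>)) \<le> exp (norm l * (C * a N) + ?d)"
        using diff[OF \<omega>] by (simp add: abs_le_iff)
    qed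
  qed
  have "Z N l \<le> expectation (\<lambda>\<omega>. exp ?d * exp (l \<bullet> ?s \<omega>))"
    unfolding Z_def
  proof (intro integral_mono integrable_\<beta>[of "\<lambda>v. exp (l \<bullet> v)"] integrable_mult_right int)
    fix \<omega> assume "\<omega> \<in> space M"
    then show "exp (l \<bullet> \<beta> N \<omega>) \<le> exp ?d * exp (l \<bullet> ?s \<omega>)"
      using diff[of \<omega>] by (simp add: exp_add[symmetric] abs_le_iff)
  qed
  then have up: "Z N l \<le> exp ?d * Z K l ^ L N K" using ZK by simp
  have "expectation (\<lambda>\<omega>. exp (- ?d) * exp (l \<bullet> ?s \<omega>)) \<le> Z N l"
    unfolding Z_def
  proof (intro integral_mono integrable_\<beta>[of "\<lambda>v. exp (l \<bullet> v)"] integrable_mult_right int)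
    fix \<omega> assume "\<omega> \<in> space M"
    then show "exp (- ?d) * exp (l \<bullet> ?s \<omega>) \<le> exp (l \<bullet> \<beta> N \<omega>)"
      using diff[of \<omega>] by (simp add: exp_add[symmetric] abs_le_iff)
  qed
  then have lo: "exp (- ?d) * Z K l ^ L N K \<le> Z N l" using ZK by simp
  have p: "Z K l ^ L N K > 0" "Z N l > 0" using Z_pos NK by auto
  have "ln (Z N l) \<le> ln (exp ?d * Z K l ^ L N K)" using up p by simp
  moreover have "ln (exp (- ?d) * Z K l ^ L N K) \<le> ln (Z N l)" using lo p by simp
  ultimately show "\<bar>ln (Z N l) - real (L N K) * ln (Z K l)\<bar> \<le> norm l * e N K"
    using Z_pos[OF NK(2), of l] by (simp add: ln_mult_pos ln_realpow abs_le_iff)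
qed auto

lemma nearly_add_mean: "nearly_add (\<lambda>n. l \<bullet> mean n) (norm l)"
  unfolding nearly_add_def
proof (intro conjI allI impI)
  fix n :: nat assume n: "n > 0"
  have "\<bar>l \<bullet> \<beta> n \<omega>\<bar> \<le> norm l * (C * a n)" if "\<omega> \<in> space M" for \<omega>
    using Cauchy_Schwarz_ineq2[of l "\<beta> n \<omega>"] mult_left_mono[OF norm_\<beta>[OF n that], of "norm l"] by auto
  then have b: "l \<bullet> \<beta> n \<omega> \<le> norm l * (C * a n)" "- (norm l * (C * a n)) \<le> l \<bullet> \<beta> n \<omega>"
    if "\<omega> \<in> space M" for \<omega> using that by (fastforce simp: abs_le_iff)+
  have "expectation (\<lambda>\<omega>. l \<bullet> \<beta> n \<omega>) \<le> expectation (\<lambda>_. norm l * (C * a n))"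
    using b by (intro integral_mono integrable_\<beta>[of "\<lambda>v. l \<bullet> v"]) auto
  moreover have "expectation (\<lambda>_. - (norm l * (C * a n))) \<le> expectation (\<lambda>\<omega>. l \<bullet> \<beta> n \<omega>)"
    using b by (intro integral_mono integrable_\<beta>[of "\<lambda>v. l \<bullet> v"]) auto
  ultimately show "\<bar>l \<bullet> mean n\<bar> \<le> norm l * (C * a n)"
    by (simp add: inner_mean prob_space abs_le_iff)
next
  fix N K :: nat assume NK: "N > 0" "K > 0"
  obtain b :: "nat \<Rightarrow> 'w \<Rightarrow> real ^ 'h" where
    b: "\<And>\<omega>. \<omega> \<in> space M \<Longrightarrow> norm (\<beta> N \<omega> - (\<Sum>j<L N K. b j \<omega>)) \<le> e N K"
      "\<And>j. b j \<in> M \<rightarrow>\<^sub>M count_space UNIV" "\<And>j \<omega>. \<omega> \<in> space M \<Longrightarrow> b j \<omega> \<in> V K"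
      "\<And>f :: nat \<Rightarrow> real ^ 'h \<Rightarrow> real. expectation (\<lambda>\<omega>. \<Prod>j<L N K. f j (b j \<omega>))
           = (\<Prod>j<L N K. expectation (\<lambda>\<omega>. f j (\<beta> K \<omega>)))"
    using blocks[OF NK] by blast
  have int: "integrable M (\<lambda>\<omega>. l \<bullet> b j \<omega>)" for j
    by (rule integrable_finite_range[OF b(2) finite_V b(3)])
  have single: "expectation (\<lambda>\<omega>. l \<bullet> b j \<omega>) = l \<bullet> mean K" if j: "j < L N K" for j
  proof -
    \<comment> \<open>The product formula also yields the marginals: all factors except the one at
      \<open>j\<close> are set to 1.\<close>
    have "expectation (\<lambda>\<omega>. l \<bullet> b j \<omega>) =
        expectation (\<lambda>\<omega>. \<Prod>i<L N K. (if i = j then l \<bullet> b i \<omega> else 1))"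
      using j by simp
    also have "\<dots> = (\<Prod>i<L N K. expectation (\<lambda>\<omega>. if i = j then l \<bullet> \<beta> K \<omega> else 1))"
      using b(4)[of "\<lambda>i v. if i = j then l \<bullet> v else 1"] .
    also have "\<dots> = (\<Prod>i<L N K. if i = j then expectation (\<lambda>\<omega>. l \<bullet> \<beta> K \<omega>) else 1)"
      by (intro prod.cong) (auto simp: prob_space)
    also have "\<dots> = l \<bullet> mean K" using j by (simp add: inner_mean)
    finally show ?thesis .
  qed
  let ?s = "\<lambda>\<omega>. \<Sum>j<L N K. b j \<omega>" and ?d = "norm l * e N K"
  have ints: "integrable M (\<lambda>\<omega>. l \<bullet> ?s \<omega>)"
    unfolding inner_sum_right by (intro Bochner_Integration.integrable_sum int)
  have Es: "expectation (\<lambda>\<omega>. l \<bullet> ?s \<omega>) = real (L N K) * (l \<bullet> mean K)"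
    unfolding inner_sum_right by (subst Bochner_Integration.integral_sum) (auto simp: int single)
  have "\<bar>l \<bullet> \<beta> N \<omega> - l \<bullet> ?s \<omega>\<bar> \<le> ?d" if "\<omega> \<in> space M" for \<omega>
    using Cauchy_Schwarz_ineq2[of l "\<beta> N \<omega> - ?s \<omega>"] mult_left_mono[OF b(1)[OF that], of "norm l"]
    by (simp add: inner_diff_right)
  then have d: "l \<bullet> \<beta> N \<omega> - l \<bullet> ?s \<omega> \<le> ?d" "- ?d \<le> l \<bullet> \<beta> N \<omega> - l \<bullet> ?s \<omega>" if "\<omega> \<in> space M" for \<omega>
    using that by (fastforce simp: abs_le_iff)+
  have intd: "integrable M (\<lambda>\<omega>. l \<bullet> \<beta> N \<omega> - l \<bullet> ?s \<omega>)"
    by (intro Bochner_Integration.integrable_diff integrable_\<beta>[of "\<lambda>v. l \<bullet> v"] ints)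
  have Ed: "expectation (\<lambda>\<omega>. l \<bullet> \<beta> N \<omega> - l \<bullet> ?s \<omega>) = l \<bullet> mean N - real (L N K) * (l \<bullet> mean K)"
    by (subst Bochner_Integration.integral_diff) (auto simp: integrable_\<beta>[of "\<lambda>v. l \<bullet> v"] ints Es inner_mean)
  have "expectation (\<lambda>\<omega>. l \<bullet> \<beta> N \<omega> - l \<bullet> ?s \<omega>) \<le> expectation (\<lambda>_. ?d)"
    using d by (intro integral_mono intd) auto
  moreover have "expectation (\<lambda>_. - ?d) \<le> expectation (\<lambda>\<omega>. l \<bullet> \<beta> N \<omega> - l \<bullet> ?s \<omega>)"
    using d by (intro integral_mono intd) auto
  ultimately show "\<bar>l \<bullet> mean N - real (L N K) * (l \<bullet> mean K)\<bar> \<le> norm l * e N K"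
    unfolding Ed by (simp add: prob_space abs_le_iff)
qed auto

definition \<phi> :: "real ^ 'h \<Rightarrow> real" where
  "\<phi> l = lim (\<lambda>n. ln (Z n l) / a n)"

definition bhat :: "real ^ 'h" where
  "bhat = (\<chi> i. lim (\<lambda>n. mean n $ i / a n))"

lemma \<phi>_limit: "(\<lambda>n. ln (Z n l) / a n) \<longlonglongrightarrow> \<phi> l"
  unfolding \<phi>_def using nearly_add_convergent[OF nearly_add_ln_Z] by (simp add: convergent_LIMSEQ_iff)

lemma bhat_limit_nth: "(\<lambda>n. mean n $ i / a n) \<longlonglongrightarrow> bhat $ i"
proof -
  have "convergent (\<lambda>n. mean n $ i / a n)"
    using nearly_add_convergent[OF nearly_add_mean[of "axis i 1"]] by (simp add: inner_axis')
  then show ?thesis by (simp add: bhat_def convergent_LIMSEQ_iff)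
qed

lemma bhat_limit: "(\<lambda>n. l \<bullet> mean n / a n) \<longlonglongrightarrow> l \<bullet> bhat"
proof -
  have "(\<lambda>n. \<Sum>i\<in>UNIV. l $ i * (mean n $ i / a n)) \<longlonglongrightarrow> (\<Sum>i\<in>UNIV. l $ i * bhat $ i)"
    by (intro tendsto_sum tendsto_mult tendsto_const bhat_limit_nth)
  then show ?thesis by (simp add: inner_vec_def sum_divide_distrib)
qed

lemma abs_\<phi>_le: "\<bar>\<phi> l\<bar> \<le> norm l * C"
proof (rule tendsto_upperbound[where F = sequentially])
  show "(\<lambda>n. \<bar>ln (Z n l) / a n\<bar>) \<longlonglongrightarrow> \<bar>\<phi> l\<bar>" by (intro tendsto_rabs \<phi>_limit)
  show "\<forall>\<^sub>F n in sequentially. \<bar>ln (Z n l) / a n\<bar> \<le> norm l * C"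
    using eventually_gt_at_top[of 0]
  proof eventually_elim
    case (elim n)
    have "\<bar>ln (Z n l)\<bar> \<le> norm l * (C * a n)"
      using nearly_add_ln_Z[of l] elim unfolding nearly_add_def by blast
    then show ?case using a_pos[OF elim] by (simp add: field_simps)
  qed
qed simp

lemma \<phi>_zero: "\<phi> 0 = 0"
  using abs_\<phi>_le[of 0] by simp

section \<open>The Fenchel-Legendre transform as a good convex rate function\<close>

lemma fenchel_le_iff: "fenchel_legendre \<phi> x \<le> ereal c \<longleftrightarrow> (\<forall>l. l \<bullet> x - \<phi> l \<le> c)"
  by (simp add: fenchel_legendre_def SUP_le_iff)

lemma fenchel_nonneg: "0 \<le> fenchel_legendre \<phi> x"
proof -
  have "ereal (0 \<bullet> x - \<phi> 0) \<le> fenchel_legendre \<phi> x"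
    unfolding fenchel_legendre_def by (rule SUP_upper) simp
  then show ?thesis by (simp add: \<phi>_zero zero_ereal_def[symmetric])
qed

lemma closed_sublevel: "closed {x. fenchel_legendre \<phi> x \<le> ereal \<alpha>}"
proof -
  have "{x. fenchel_legendre \<phi> x \<le> ereal \<alpha>} = (\<Inter>l. {x. l \<bullet> x - \<phi> l \<le> \<alpha>})"
    by (auto simp: fenchel_le_iff)
  also have "closed \<dots>" by (intro closed_INT ballI closed_Collect_le continuous_intros)
  finally show ?thesis .
qed

text \<open>Since \<open>\<phi>\<close> grows at most like \<open>C * norm l\<close>, the transform
  is infinite outside \<open>cball 0 C\<close>: along the ray \<open>l = t *\<^sub>R x\<close> the
  expression under the supremum is at least \<open>t * d\<close> with \<open>d > 0\<close>.\<close>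

lemma sublevel_subset: "{x. fenchel_legendre \<phi> x \<le> ereal \<alpha>} \<subseteq> cball 0 C"
proof
  fix x assume "x \<in> {x. fenchel_legendre \<phi> x \<le> ereal \<alpha>}"
  then have x: "l \<bullet> x - \<phi> l \<le> \<alpha>" for l by (simp add: fenchel_le_iff)
  show "x \<in> cball 0 C"
  proof (rule ccontr)
    assume "x \<notin> cball 0 C"
    then have nx: "norm x > C" by simp
    then have nx0: "norm x > 0" using C_nonneg by linarith
    define d where "d = norm x * (norm x - C)"
    have d: "d > 0" unfolding d_def using nx nx0 by simp
    have le: "t * d \<le> \<alpha>" if "t > 0" for t
    proof -
      have "\<phi> (t *\<^sub>R x) \<le> t * norm x * C" using abs_\<phi>_le[of "t *\<^sub>R x"] that by simp
      moreover have "(t *\<^sub>R x) \<bullet> x = t * (norm x * norm x)"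
        by (simp add: dot_square_norm power2_eq_square)
      ultimately have "t * (norm x * norm x) - t * norm x * C \<le> \<alpha>" using x[of "t *\<^sub>R x"] by linarith
      then show ?thesis by (simp add: d_def algebra_simps)
    qed
    have "(\<bar>\<alpha>\<bar> + 1) / d * d \<le> \<alpha>" using d by (intro le) auto
    then show False using d by simp
  qed
qed

lemma rate_function_fenchel: "rate_function (fenchel_legendre \<phi>)"
  unfolding rate_function_def using fenchel_nonneg closed_sublevel by blast

lemma good_rate_function_fenchel: "good_rate_function (fenchel_legendre \<phi>)"
  unfolding good_rate_function_def
proof (intro conjI allI rate_function_fenchel)
  fix \<alpha> :: real
  have "cball 0 C \<inter> {x. fenchel_legendre \<phi> x \<le> ereal \<alpha>} = {x. fenchel_legendre \<phi> x \<le> ereal \<alpha>}"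
    using sublevel_subset by blast
  then show "compact {x. fenchel_legendre \<phi> x \<le> ereal \<alpha>}"
    using compact_Int_closed[OF compact_cball closed_sublevel] by metis
qed

lemma convex_fenchel: "convex_ereal_fun (fenchel_legendre \<phi>)"
  unfolding convex_ereal_fun_def
proof (intro allI impI)
  fix x y :: "real ^ 'h" and u :: real assume u: "0 \<le> u" "u \<le> 1"
  have le: "ereal (l \<bullet> x - \<phi> l) \<le> fenchel_legendre \<phi> x" for l x
    unfolding fenchel_legendre_def by (rule SUP_upper) simp
  show "fenchel_legendre \<phi> (u *\<^sub>R x + (1 - u) *\<^sub>R y)
      \<le> ereal u * fenchel_legendre \<phi> x + ereal (1 - u) * fenchel_legendre \<phi> y"
    unfolding fenchel_legendre_def[of \<phi> "u *\<^sub>R x + (1 - u) *\<^sub>R y"]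
  proof (rule SUP_least)
    fix l
    have "l \<bullet> (u *\<^sub>R x + (1 - u) *\<^sub>R y) - \<phi> l = u * (l \<bullet> x - \<phi> l) + (1 - u) * (l \<bullet> y - \<phi> l)"
      by (simp add: algebra_simps)
    then have "ereal (l \<bullet> (u *\<^sub>R x + (1 - u) *\<^sub>R y) - \<phi> l)
        = ereal u * ereal (l \<bullet> x - \<phi> l) + ereal (1 - u) * ereal (l \<bullet> y - \<phi> l)" by simp
    also have "\<dots> \<le> ereal u * fenchel_legendre \<phi> x + ereal (1 - u) * fenchel_legendre \<phi> y"
      using u by (intro add_mono ereal_mult_left_mono le) auto
    finally show "ereal (l \<bullet> (u *\<^sub>R x + (1 - u) *\<^sub>R y) - \<phi> l)
      \<le> ereal u * fenchel_legendre \<phi> x + ereal (1 - u) * fenchel_legendre \<phi> y" .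
  qed
qed

section \<open>The unique zero of the rate function\<close>

text \<open>Jensen's inequality for \<open>exp\<close>, obtained by integrating the tangent at
  \<open>l \<bullet> mean n\<close>.\<close>

lemma inner_mean_le_ln_Z:
  assumes "n > 0" shows "l \<bullet> mean n \<le> ln (Z n l)"
proof -
  let ?m = "l \<bullet> mean n"
  have "expectation (\<lambda>\<omega>. exp ?m * (1 + (l \<bullet> \<beta> n \<omega> - ?m))) \<le> Z n l"
    unfolding Z_def
  proof (intro integral_mono)
    show "integrable M (\<lambda>\<omega>. exp ?m * (1 + (l \<bullet> \<beta> n \<omega> - ?m)))"
      by (rule integrable_\<beta>[of "\<lambda>v. exp ?m * (1 + (l \<bullet> v - ?m))"])
    show "integrable M (\<lambda>\<omega>. exp (l \<bullet> \<beta> n \<omega>))" by (rule integrable_\<beta>[of "\<lambda>v. exp (l \<bullet> v)"])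
    fix \<omega>
    have "exp ?m * (1 + (l \<bullet> \<beta> n \<omega> - ?m)) \<le> exp ?m * exp (l \<bullet> \<beta> n \<omega> - ?m)"
      by (intro mult_left_mono exp_ge_add_one_self) auto
    then show "exp ?m * (1 + (l \<bullet> \<beta> n \<omega> - ?m)) \<le> exp (l \<bullet> \<beta> n \<omega>)" by (simp add: exp_diff)
  qed
  moreover have "expectation (\<lambda>\<omega>. exp ?m * (1 + (l \<bullet> \<beta> n \<omega> - ?m))) = exp ?m"
    using integrable_\<beta>[of "\<lambda>v. l \<bullet> v" n] by (simp add: inner_mean prob_space)
  ultimately show ?thesis using Z_pos[OF assms, of l] by (simp add: ln_ge_iff)
qed

lemma fenchel_bhat: "fenchel_legendre \<phi> bhat = 0"
proof -
  have "l \<bullet> bhat \<le> \<phi> l" for l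
  proof (rule tendsto_le[OF _ \<phi>_limit bhat_limit])
    show "\<forall>\<^sub>F n in sequentially. l \<bullet> mean n / a n \<le> ln (Z n l) / a n"
      using eventually_gt_at_top[of 0]
      by eventually_elim (intro divide_right_mono inner_mean_le_ln_Z less_imp_le[OF a_pos])
  qed simp
  then have "fenchel_legendre \<phi> bhat \<le> ereal 0" by (simp add: fenchel_le_iff)
  then show ?thesis using fenchel_nonneg[of bhat] by (simp add: zero_ereal_def[symmetric])
qed

text \<open>The second moment is bounded crudely by the square of the largest possible value. The
  bound degrades with \<open>K\<close>, but it is applied at a fixed \<open>K\<close> with
  \<open>t\<close> small.\<close>

lemma Z_quadratic_bound:
  assumes K: "K > 0" and t: "\<bar>t\<bar> * (norm w * (C * a K)) \<le> 1"
  shows "ln (Z K (t *\<^sub>R w)) \<le> t * (w \<bullet> mean K) + t\<^sup>2 * (norm w * (C * a K))\<^sup>2"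
proof -
  let ?B = "norm w * (C * a K)"
  have "Z K (t *\<^sub>R w) \<le> expectation (\<lambda>\<omega>. 1 + t * (w \<bullet> \<beta> K \<omega>) + t\<^sup>2 * ?B\<^sup>2)"
    unfolding Z_def
  proof (intro integral_mono)
    show "integrable M (\<lambda>\<omega>. exp ((t *\<^sub>R w) \<bullet> \<beta> K \<omega>))" by (rule integrable_\<beta>[of "\<lambda>v. exp ((t *\<^sub>R w) \<bullet> v)"])
    show "integrable M (\<lambda>\<omega>. 1 + t * (w \<bullet> \<beta> K \<omega>) + t\<^sup>2 * ?B\<^sup>2)"
      by (rule integrable_\<beta>[of "\<lambda>v. 1 + t * (w \<bullet> v) + t\<^sup>2 * ?B\<^sup>2"])
    fix \<omega> assume \<omega>: "\<omega> \<in> space M"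
    let ?y = "t * (w \<bullet> \<beta> K \<omega>)"
    have "\<bar>w \<bullet> \<beta> K \<omega>\<bar> \<le> ?B"
      using Cauchy_Schwarz_ineq2[of w "\<beta> K \<omega>"] mult_left_mono[OF norm_\<beta>[OF K \<omega>], of "norm w"] by auto
    then have y: "\<bar>?y\<bar> \<le> \<bar>t\<bar> * ?B" by (simp add: abs_mult mult_left_mono)
    then have "?y\<^sup>2 \<le> (\<bar>t\<bar> * ?B)\<^sup>2" by (metis abs_ge_zero power2_abs power_mono)
    then have "?y\<^sup>2 \<le> t\<^sup>2 * ?B\<^sup>2" by (simp add: power_mult_distrib)
    moreover have "exp ?y \<le> 1 + ?y + ?y\<^sup>2" using y t by (intro exp_le_one_plus_square) auto
    ultimately show "exp ((t *\<^sub>R w) \<bullet> \<beta> K \<omega>) \<le> 1 + t * (w \<bullet> \<beta> K \<omega>) + t\<^sup>2 * ?B\<^sup>2" by simp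
  qed
  also have "\<dots> = 1 + t * (w \<bullet> mean K) + t\<^sup>2 * ?B\<^sup>2"
    using integrable_\<beta>[of "\<lambda>v. w \<bullet> v" K] by (simp add: inner_mean prob_space)
  finally have "Z K (t *\<^sub>R w) - 1 \<le> t * (w \<bullet> mean K) + t\<^sup>2 * ?B\<^sup>2" by simp
  then show ?thesis using ln_le_minus_one[OF Z_pos[OF K, of "t *\<^sub>R w"]] by linarith
qed

text \<open>The test vectors are \<open>l = t *\<^sub>R w\<close> with \<open>w = x - bhat\<close>.
  With \<open>K\<close> fixed, the errors of \<open>\<phi>\<close> and of the mean are proportional
  to \<open>t\<close>, like the gain \<open>t * (norm w)\<^sup>2\<close>, while the quadratic term
  is of higher order in \<open>t\<close>.\<close>

lemma fenchel_pos:
  assumes "x \<noteq> bhat" shows "fenchel_legendre \<phi> x \<noteq> 0"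
proof
  assume "fenchel_legendre \<phi> x = 0"
  then have "fenchel_legendre \<phi> x \<le> ereal 0" by simp
  then have x: "l \<bullet> x - \<phi> l \<le> 0" for l by (simp only: fenchel_le_iff)
  define w where "w = x - bhat"
  have w: "norm w > 0" using assms by (simp add: w_def)
  \<comment> \<open>The two approximation errors then use one eighth of the gain each; together with
    one half for the quadratic term, a quarter of the gain is left.\<close>
  define \<epsilon> where "\<epsilon> = norm w / 8"
  have \<epsilon>: "\<epsilon> > 0" using w by (simp add: \<epsilon>_def)
  obtain K where K: "K > 0"
    "\<forall>A c x. nearly_add A c \<longrightarrow> (\<lambda>n. A n / a n) \<longlonglongrightarrow> x \<longrightarrow> \<bar>x - A K / a K\<bar> \<le> c * \<epsilon>"
    using eventually_happens[OF eventually_conj[OF eventually_gt_at_top[of 0] nearly_add_limit_close[OF \<epsilon>]]]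
    by auto
  have aK: "a K > 0" by (rule a_pos[OF K(1)])
  have c1: "\<bar>\<phi> l - ln (Z K l) / a K\<bar> \<le> norm l * \<epsilon>" for l
    using K(2) nearly_add_ln_Z \<phi>_limit by blast
  have c2: "\<bar>w \<bullet> bhat - w \<bullet> mean K / a K\<bar> \<le> norm w * \<epsilon>"
    using K(2) nearly_add_mean bhat_limit by blast
  define B where "B = norm w * (C * a K)"
  have B: "B \<ge> 0" using C_nonneg aK by (simp add: B_def)
  \<comment> \<open>The first bound puts the exponent into the range of the quadratic estimate, the
    second makes the quadratic term at most half the gain. The summands 1 keep the denominators
    positive when \<open>B = 0\<close>.\<close>
  define t where "t = min (1 / (B + 1)) ((norm w)\<^sup>2 * a K / (2 * (B\<^sup>2 + 1)))"
  have t: "t > 0" using B w aK by (auto simp: t_def intro!: divide_pos_pos mult_pos_pos add_nonneg_pos)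
  have tB: "t * B \<le> 1"
  proof -
    have "t * B \<le> 1 / (B + 1) * B" using B by (intro mult_right_mono) (auto simp: t_def)
    also have "\<dots> \<le> 1" using B by (simp add: field_simps)
    finally show ?thesis .
  qed
  have tB2: "t * B\<^sup>2 / a K \<le> (norm w)\<^sup>2 / 2"
  proof -
    have "t * B\<^sup>2 \<le> (norm w)\<^sup>2 * a K / (2 * (B\<^sup>2 + 1)) * B\<^sup>2"
      by (intro mult_right_mono) (auto simp: t_def)
    also have "\<dots> = ((norm w)\<^sup>2 * a K / 2) * (B\<^sup>2 / (B\<^sup>2 + 1))" by (simp add: field_simps)
    also have "\<dots> \<le> ((norm w)\<^sup>2 * a K / 2) * 1"
      using aK by (intro mult_left_mono) (auto simp: divide_le_eq add_nonneg_pos)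
    finally show ?thesis using aK by (simp add: field_simps)
  qed
  have "ln (Z K (t *\<^sub>R w)) \<le> t * (w \<bullet> mean K) + t\<^sup>2 * B\<^sup>2"
    using Z_quadratic_bound[OF K(1), of t w] t tB unfolding B_def by simp
  then have "ln (Z K (t *\<^sub>R w)) / a K \<le> (t * (w \<bullet> mean K) + t\<^sup>2 * B\<^sup>2) / a K"
    using aK by (intro divide_right_mono) auto
  also have "\<dots> = t * (w \<bullet> mean K / a K) + t * (t * B\<^sup>2 / a K)"
    by (simp add: add_divide_distrib power2_eq_square)
  also have "\<dots> \<le> t * (w \<bullet> bhat + norm w * \<epsilon>) + t * ((norm w)\<^sup>2 / 2)"
    using c2 tB2 t by (intro add_mono mult_left_mono) auto
  finally have "\<phi> (t *\<^sub>R w) \<le> t * (w \<bullet> bhat + norm w * \<epsilon>) + t * ((norm w)\<^sup>2 / 2) + t * (norm w * \<epsilon>)"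
    using c1[of "t *\<^sub>R w"] t by simp
  also have "\<dots> = t * (w \<bullet> bhat + (norm w)\<^sup>2 * (3 / 4))"
    by (simp add: \<epsilon>_def power2_eq_square algebra_simps)
  finally have "\<phi> (t *\<^sub>R w) \<le> t * (w \<bullet> bhat + (norm w)\<^sup>2 * (3 / 4))" .
  moreover have "w \<bullet> x = w \<bullet> bhat + (norm w)\<^sup>2"
    by (simp add: w_def inner_diff_right power2_norm_eq_inner)
  then have "(t *\<^sub>R w) \<bullet> x = t * (w \<bullet> bhat + (norm w)\<^sup>2)" by simp
  ultimately have "t * ((norm w)\<^sup>2 * (1 / 4)) \<le> 0" using x[of "t *\<^sub>R w"] by (simp add: algebra_simps)
  moreover have "t * ((norm w)\<^sup>2 * (1 / 4)) > 0" using t w by simp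
  ultimately show False by simp
qed

lemma fenchel_eq_zero_iff: "fenchel_legendre \<phi> x = 0 \<longleftrightarrow> x = bhat"
  using fenchel_pos fenchel_bhat by blast

section \<open>The large deviation upper bound\<close>

definition S :: "nat \<Rightarrow> 'w \<Rightarrow> real ^ 'h" where
  "S n \<omega> = (1 / a n) *\<^sub>R \<beta> n \<omega>"

lemma event_S: "{\<omega> \<in> space M. S n \<omega> \<in> B} \<in> sets M"
  using event_\<beta>[of n "{v. (1 / a n) *\<^sub>R v \<in> B}"] by (simp add: S_def)

lemma norm_S: "n > 0 \<Longrightarrow> \<omega> \<in> space M \<Longrightarrow> norm (S n \<omega>) \<le> C"
  using norm_\<beta>[of n \<omega>] a_pos[of n] by (simp add: S_def field_simps)

text \<open>The exponential Chebyshev inequality.\<close>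

lemma prob_halfspace_le:
  assumes "n > 0"
  shows "prob {\<omega> \<in> space M. l \<bullet> S n \<omega> > r} \<le> exp (- (a n * r)) * Z n l"
proof -
  let ?E = "{\<omega> \<in> space M. l \<bullet> S n \<omega> > r}"
  have E: "?E \<in> sets M" using event_S[of n "{v. l \<bullet> v > r}"] by simp
  have a: "a n > 0" by (rule a_pos[OF assms])
  have "prob ?E = expectation (indicator ?E)" using E by simp
  also have "\<dots> \<le> expectation (\<lambda>\<omega>. exp (- (a n * r)) * exp (l \<bullet> \<beta> n \<omega>))"
  proof (intro integral_mono)
    show "integrable M (indicator ?E :: _ \<Rightarrow> real)" using E by (simp add: emeasure_eq_measure)
    show "integrable M (\<lambda>\<omega>. exp (- (a n * r)) * exp (l \<bullet> \<beta> n \<omega>))"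
      by (rule integrable_\<beta>[of "\<lambda>v. exp (- (a n * r)) * exp (l \<bullet> v)"])
    fix \<omega> assume "\<omega> \<in> space M"
    have "1 \<le> exp (- (a n * r)) * exp (l \<bullet> \<beta> n \<omega>)" if "l \<bullet> S n \<omega> > r"
    proof -
      have "a n * r \<le> l \<bullet> \<beta> n \<omega>" using that a by (simp add: S_def field_simps)
      then show ?thesis by (simp add: exp_add[symmetric])
    qed
    then show "indicator ?E \<omega> \<le> exp (- (a n * r)) * exp (l \<bullet> \<beta> n \<omega>)"
      by (auto simp: indicator_def)
  qed
  also have "\<dots> = exp (- (a n * r)) * Z n l" by (simp add: Z_def)
  finally show ?thesis .
qed

text \<open>All values of \<open>S n\<close> with \<open>n > 0\<close> lie in
  \<open>cball 0 C\<close>, so a closed set may be replaced by its compact part and no separate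
  exponential tightness is required. Each point of that part has a vector \<open>l\<close>
  witnessing that the transform exceeds \<open>\<alpha>\<close>.\<close>

lemma upper_bound:
  assumes F: "closed F" and \<alpha>: "\<And>x. x \<in> F \<Longrightarrow> ereal \<alpha> < fenchel_legendre \<phi> x" and \<epsilon>: "\<epsilon> > 0"
  shows "\<forall>\<^sub>F n in sequentially. prob {\<omega> \<in> space M. S n \<omega> \<in> F} \<le> exp (- (a n * (\<alpha> - \<epsilon>)))"
proof -
  let ?U = "\<lambda>l. {y. l \<bullet> y > \<alpha> + \<phi> l}"
  have "compact (cball 0 C \<inter> F)" by (intro compact_Int_closed compact_cball F)
  moreover have "open (?U l)" for l by (intro open_Collect_less continuous_intros)
  moreover have "cball 0 C \<inter> F \<subseteq> (\<Union>l\<in>UNIV. ?U l)"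
  proof
    fix x assume "x \<in> cball 0 C \<inter> F"
    then have "\<not> fenchel_legendre \<phi> x \<le> ereal \<alpha>" using \<alpha> by (simp add: not_le)
    then obtain l where "l \<bullet> x - \<phi> l > \<alpha>" unfolding fenchel_le_iff by (auto simp: not_le)
    then have "x \<in> ?U l" by simp
    then show "x \<in> (\<Union>l\<in>UNIV. ?U l)" by blast
  qed
  ultimately obtain T where T: "finite T" "cball 0 C \<inter> F \<subseteq> (\<Union>l\<in>T. ?U l)"
    by (meson compactE_image)
  have ev1: "\<forall>\<^sub>F n in sequentially. \<forall>l\<in>T. ln (Z n l) / a n < \<phi> l + \<epsilon> / 2"
    using T(1) \<epsilon> by (intro eventually_ball_finite ballI order_tendstoD(2)[OF \<phi>_limit]) auto
  \<comment> \<open>From here on the number of half-spaces is at most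
    \<open>exp (a n * (\<epsilon> / 2))\<close>; the other half of \<open>\<epsilon>\<close> pays
    for the convergence to \<open>\<phi>\<close>.\<close>
  have ev2: "\<forall>\<^sub>F n in sequentially. a n \<ge> 2 * real (card T) / \<epsilon>"
    using a_top by (simp add: filterlim_at_top)
  show ?thesis
    using ev1 ev2 eventually_gt_at_top[of 0]
  proof eventually_elim
    case (elim n)
    have a: "a n > 0" by (rule a_pos[OF elim(3)])
    have "prob {\<omega> \<in> space M. S n \<omega> \<in> F} \<le> prob (\<Union>l\<in>T. {\<omega> \<in> space M. l \<bullet> S n \<omega> > \<alpha> + \<phi> l})"
    proof (rule finite_measure_mono)
      show "{\<omega> \<in> space M. S n \<omega> \<in> F} \<subseteq> (\<Union>l\<in>T. {\<omega> \<in> space M. l \<bullet> S n \<omega> > \<alpha> + \<phi> l})"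
        using T(2) norm_S[OF elim(3)] by fastforce
      show "(\<Union>l\<in>T. {\<omega> \<in> space M. l \<bullet> S n \<omega> > \<alpha> + \<phi> l}) \<in> events"
        using T(1) event_S[of n "?U l" for l] by (intro sets.finite_UN) auto
    qed
    also have "\<dots> \<le> (\<Sum>l\<in>T. prob {\<omega> \<in> space M. l \<bullet> S n \<omega> > \<alpha> + \<phi> l})"
      using T(1) event_S[of n "?U l" for l] by (intro finite_measure_subadditive_finite) auto
    also have "\<dots> \<le> (\<Sum>l\<in>T. exp (- (a n * (\<alpha> - \<epsilon> / 2))))"
    proof (rule sum_mono)
      fix l assume "l \<in> T"
      then have "ln (Z n l) \<le> a n * (\<phi> l + \<epsilon> / 2)" using elim(1) a by (auto simp: field_simps less_imp_le)
      then have Zl: "Z n l \<le> exp (a n * (\<phi> l + \<epsilon> / 2))"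
        using Z_pos[OF elim(3), of l] by (metis exp_le_cancel_iff exp_ln)
      have "prob {\<omega> \<in> space M. l \<bullet> S n \<omega> > \<alpha> + \<phi> l} \<le> exp (- (a n * (\<alpha> + \<phi> l))) * Z n l"
        by (rule prob_halfspace_le[OF elim(3)])
      also have "\<dots> \<le> exp (- (a n * (\<alpha> + \<phi> l))) * exp (a n * (\<phi> l + \<epsilon> / 2))"
        using Zl by (intro mult_left_mono) auto
      also have "\<dots> = exp (- (a n * (\<alpha> - \<epsilon> / 2)))"
        by (simp add: exp_add[symmetric] algebra_simps)
      finally show "prob {\<omega> \<in> space M. l \<bullet> S n \<omega> > \<alpha> + \<phi> l} \<le> exp (- (a n * (\<alpha> - \<epsilon> / 2)))" .
    qed
    also have "\<dots> = real (card T) * exp (- (a n * (\<alpha> - \<epsilon> / 2)))" by simp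
    also have "\<dots> \<le> exp (a n * (\<epsilon> / 2)) * exp (- (a n * (\<alpha> - \<epsilon> / 2)))"
    proof (rule mult_right_mono)
      have "real (card T) \<le> a n * (\<epsilon> / 2)" using elim(2) \<epsilon> by (simp add: field_simps)
      also have "\<dots> \<le> exp (a n * (\<epsilon> / 2))" using exp_ge_add_one_self[of "a n * (\<epsilon> / 2)"] by linarith
      finally show "real (card T) \<le> exp (a n * (\<epsilon> / 2))" .
    qed simp
    also have "\<dots> = exp (- (a n * (\<alpha> - \<epsilon>)))" by (simp add: exp_add[symmetric] algebra_simps)
    finally show ?case .
  qed
qed

section \<open>The large deviation lower bound\<close>

text \<open>Values of probability 0 are excluded because \<open>logp\<close> would assign them the
  junk value \<open>ln 0\<close>.\<close>

definition charged :: "nat \<Rightarrow> (real ^ 'h) set" where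
  "charged K = {v \<in> V K. prob {\<omega> \<in> space M. \<beta> K \<omega> = v} > 0}"

definition logp :: "nat \<Rightarrow> real ^ 'h \<Rightarrow> real" where
  "logp K v = ln (prob {\<omega> \<in> space M. \<beta> K \<omega> = v}) / a K"

lemma finite_charged: "finite (charged K)"
  unfolding charged_def using finite_V by simp

lemma expectation_\<beta>_sum:
  fixes f :: "real ^ 'h \<Rightarrow> real"
  shows "expectation (\<lambda>\<omega>. f (\<beta> K \<omega>)) = (\<Sum>v\<in>charged K. f v * prob {\<omega> \<in> space M. \<beta> K \<omega> = v})"
proof -
  let ?E = "\<lambda>v. {\<omega> \<in> space M. \<beta> K \<omega> = v}"
  have E: "?E v \<in> sets M" for v using event_\<beta>[of K "{v}"] by simp
  have "expectation (\<lambda>\<omega>. f (\<beta> K \<omega>)) = expectation (\<lambda>\<omega>. \<Sum>v\<in>V K. f v * indicator (?E v) \<omega>)"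
  proof (intro Bochner_Integration.integral_cong refl)
    fix \<omega> assume \<omega>: "\<omega> \<in> space M"
    have "(\<Sum>v\<in>V K. f v * indicator (?E v) \<omega>) = (\<Sum>v\<in>V K. if v = \<beta> K \<omega> then f v else 0)"
      using \<omega> by (intro sum.cong) (auto simp: indicator_def)
    then show "f (\<beta> K \<omega>) = (\<Sum>v\<in>V K. f v * indicator (?E v) \<omega>)"
      using range[OF \<omega>] finite_V by simp
  qed
  also have "\<dots> = (\<Sum>v\<in>V K. expectation (\<lambda>\<omega>. f v * indicator (?E v) \<omega>))"
    using E by (intro Bochner_Integration.integral_sum integrable_mult_right integrable_real_indicator)
      (auto simp: emeasure_eq_measure)
  also have "\<dots> = (\<Sum>v\<in>V K. f v * prob (?E v))"
    using E by simp
  also have "\<dots> = (\<Sum>v\<in>charged K. f v * prob (?E v))"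
    using finite_V by (intro sum.mono_neutral_right) (auto simp: charged_def zero_less_measure_iff)
  finally show ?thesis .
qed

lemma charged_nonempty: "charged K \<noteq> {}"
  using expectation_\<beta>_sum[of "\<lambda>_. 1" K] by (auto simp: prob_space)

lemma exp_logp:
  assumes "K > 0" "v \<in> charged K"
  shows "exp (a K * logp K v) = prob {\<omega> \<in> space M. \<beta> K \<omega> = v}"
  using assms a_pos[of K] by (simp add: logp_def charged_def)

lemma logp_nonpos: "K > 0 \<Longrightarrow> v \<in> charged K \<Longrightarrow> logp K v \<le> 0"
  using a_pos[of K] by (auto simp: logp_def charged_def divide_nonpos_pos)

text \<open>The number of values of \<open>\<beta> K\<close> is subexponential in \<open>a K\<close>, so that the sum defining
 \<open>Z K\<close> is governed by its largest term.\<close>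

lemma ln_Z_le_max:
  assumes K: "K > 0" and B: "\<And>v. v \<in> charged K \<Longrightarrow> l \<bullet> v / a K + logp K v \<le> B"
  shows "ln (Z K l) / a K \<le> ln (real (card (V K))) / a K + B"
proof -
  have a: "a K > 0" by (rule a_pos[OF K])
  have cV: "card (V K) > 0"
    using charged_nonempty[of K] finite_V by (auto simp: charged_def card_gt_0_iff)
  have "Z K l = (\<Sum>v\<in>charged K. exp (l \<bullet> v) * exp (a K * logp K v))"
    unfolding Z_def expectation_\<beta>_sum[of "\<lambda>v. exp (l \<bullet> v)"] using K by (intro sum.cong) (auto simp: exp_logp)
  also have "\<dots> \<le> (\<Sum>v\<in>charged K. exp (a K * B))"
  proof (rule sum_mono)
    fix v assume "v \<in> charged K"
    from mult_left_mono[OF B[OF this], of "a K"] a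
    have "l \<bullet> v + a K * logp K v \<le> a K * B" by (simp add: algebra_simps)
    then show "exp (l \<bullet> v) * exp (a K * logp K v) \<le> exp (a K * B)" by (simp add: exp_add[symmetric])
  qed
  also have "\<dots> = real (card (charged K)) * exp (a K * B)" by simp
  also have "\<dots> \<le> real (card (V K)) * exp (a K * B)"
    using finite_V by (intro mult_right_mono) (auto simp: charged_def intro: card_mono)
  finally have "ln (Z K l) \<le> ln (real (card (V K)) * exp (a K * B))"
    using Z_pos[OF K, of l] cV by simp
  also have "\<dots> = ln (real (card (V K))) + a K * B" using cV by (simp add: ln_mult_pos)
  finally show ?thesis using a by (simp add: field_simps)
qed

text \<open>If the two convex sets were disjoint, a hyperplane with normal
  \<open>(l0, \<mu>)\<close> would separate them. It would bound every term of the sum defining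
  \<open>Z K\<close>, and thereby make \<open>\<phi>\<close> too small at a multiple of
  \<open>l0\<close> to be compatible with \<open>x0\<close>.\<close>

lemma ex_mixture_near:
  assumes x0: "\<And>l. l \<bullet> x0 - \<phi> l \<le> c" and \<epsilon>: "\<epsilon> > 0" and K: "K > 0"
    and close: "\<And>l. \<bar>\<phi> l - ln (Z K l) / a K\<bar> \<le> norm l * (\<epsilon> / 2)"
    and ent: "ln (real (card (V K))) / a K \<le> \<epsilon> / 2"
  shows "\<exists>\<theta>. (\<forall>v\<in>charged K. 0 \<le> \<theta> v) \<and> sum \<theta> (charged K) = 1 \<and>
    norm ((\<Sum>v\<in>charged K. \<theta> v *\<^sub>R ((1 / a K) *\<^sub>R v)) - x0) \<le> \<epsilon> \<and>
    (\<Sum>v\<in>charged K. \<theta> v * (- logp K v)) \<le> c + \<epsilon>"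
proof -
  have a: "a K > 0" by (rule a_pos[OF K])
  define pt where "pt v = ((1 / a K) *\<^sub>R v, - logp K v)" for v
  have inj: "inj_on pt (charged K)" using a by (auto simp: inj_on_def pt_def)
  \<comment> \<open>A bound on the largest term bounds \<open>\<phi> l\<close>: one error pays for
    the number of values, the other, proportional to \<open>norm l\<close>, for replacing the limit
    by the quotient at \<open>K\<close>.\<close>
  have key: "\<phi> l \<le> B + \<epsilon> / 2 + norm l * (\<epsilon> / 2)"
    if "\<And>v. v \<in> charged K \<Longrightarrow> l \<bullet> v / a K + logp K v \<le> B" for l B
    using ln_Z_le_max[OF K that] close[of l] ent by linarith
  let ?H = "convex hull (pt ` charged K)" and ?D = "cball x0 \<epsilon> \<times> {..c + \<epsilon>}"
  have "?H \<inter> ?D \<noteq> {}"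
  proof
    assume "?H \<inter> ?D = {}"
    moreover have "compact ?H" using finite_charged by (intro finite_imp_compact_convex_hull) simp
    moreover have "closed ?D" by (intro closed_Times) auto
    moreover have "convex ?D" by (intro convex_Times) auto
    moreover have "?H \<noteq> {}" using charged_nonempty by simp
    ultimately obtain p b where p: "\<And>y. y \<in> ?H \<Longrightarrow> p \<bullet> y < b" "\<And>y. y \<in> ?D \<Longrightarrow> p \<bullet> y > b"
      using separating_hyperplane_compact_closed[of ?H ?D] by (metis convex_convex_hull)
    obtain l0 \<mu> where p_eq: "p = (l0, \<mu>)" by (cases p)
    have H: "l0 \<bullet> v / a K - \<mu> * logp K v < b" if "v \<in> charged K" for v
    proof -
      have "pt v \<in> ?H" using that by (intro hull_inc) simp
      from p(1)[OF this] show ?thesis by (simp add: p_eq pt_def)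
    qed
    have D: "l0 \<bullet> y + \<mu> * r > b" if "norm (y - x0) \<le> \<epsilon>" "r \<le> c + \<epsilon>" for y r
      using p(2)[of "(y, r)"] that by (simp add: p_eq dist_norm norm_minus_commute)
    \<comment> \<open>The second factor of \<open>?D\<close> is unbounded below, which excludes a
      positive last coordinate of the normal.\<close>
    have \<mu>: "\<mu> \<le> 0"
    proof (rule ccontr)
      assume "\<not> \<mu> \<le> 0"
      then have m: "\<mu> > 0" by simp
      define r where "r = min (c + \<epsilon>) ((b - l0 \<bullet> x0) / \<mu>)"
      have "l0 \<bullet> x0 + \<mu> * r > b" using \<epsilon> by (intro D) (auto simp: r_def)
      moreover have "\<mu> * r \<le> \<mu> * ((b - l0 \<bullet> x0) / \<mu>)" using m by (intro mult_left_mono) (auto simp: r_def)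
      then have "\<mu> * r \<le> b - l0 \<bullet> x0" using m by simp
      ultimately show False by linarith
    qed
    have D': "b < l0 \<bullet> x0 - \<epsilon> * norm l0 + \<mu> * (c + \<epsilon>)"
    proof -
      \<comment> \<open>The point of the ball where \<open>l0\<close> is smallest; for
        \<open>l0 = 0\<close> the quotient is 0 and \<open>?y\<close> is \<open>x0\<close>. The
        margin \<open>\<epsilon> * norm l0\<close> is twice the error that \<open>key\<close>
        introduces.\<close>
      let ?y = "x0 - (\<epsilon> / norm l0) *\<^sub>R l0"
      have "norm (?y - x0) \<le> \<epsilon>" using \<epsilon> by simp
      from D[OF this, of "c + \<epsilon>"] have "b < l0 \<bullet> ?y + \<mu> * (c + \<epsilon>)" by simp
      moreover have "l0 \<bullet> ?y = l0 \<bullet> x0 - \<epsilon> * norm l0"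
        by (simp add: inner_diff_right dot_square_norm power2_eq_square)
      ultimately show ?thesis by simp
    qed
    show False
    proof (cases "\<mu> = 0")
      \<comment> \<open>A hyperplane that is not vertical: after division by \<open>- \<mu>\<close>
        it bounds each \<open>l \<bullet> v / a K + logp K v\<close>, and \<open>key\<close> gives
        \<open>l \<bullet> x0 - \<phi> l > c\<close>.\<close>
      case False
      define m where "m = - \<mu>"
      have m: "m > 0" using \<mu> False by (simp add: m_def)
      define l where "l = (1 / m) *\<^sub>R l0"
      have l0: "l0 = m *\<^sub>R l" using m by (simp add: l_def)
      have "l \<bullet> v / a K + logp K v \<le> l \<bullet> x0 - \<epsilon> * norm l - (c + \<epsilon>)" if "v \<in> charged K" for v
      proof -
        have "m * (l \<bullet> v / a K + logp K v) < m * (l \<bullet> x0 - \<epsilon> * norm l - (c + \<epsilon>))"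
          using H[OF that] D' m unfolding l0 m_def by (simp add: algebra_simps)
        then show ?thesis using m by simp
      qed
      from key[OF this] have "\<phi> l \<le> l \<bullet> x0 - c - \<epsilon> / 2 - norm l * (\<epsilon> / 2)" by (simp add: algebra_simps)
      moreover have "0 \<le> norm l * (\<epsilon> / 2)" using \<epsilon> by simp
      ultimately show False using x0[of l] \<epsilon> by linarith
    next
      \<comment> \<open>A vertical hyperplane bounds only \<open>l0 \<bullet> v\<close>, but
        \<open>logp\<close> is nonpositive. The margin is homogeneous in \<open>l0\<close>, so a
        large multiple contradicts the bound at \<open>x0\<close>; \<open>t\<close> makes half the
        scaled margin equal to \<open>\<bar>c\<bar> + \<epsilon> / 2 + 1\<close>.\<close>
      case True
      have l0: "l0 \<noteq> 0"
      proof
        assume "l0 = 0"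
        moreover obtain v where "v \<in> charged K" using charged_nonempty by blast
        ultimately show False using H[of v] D' True by simp
      qed
      define t where "t = 2 * (\<bar>c\<bar> + \<epsilon> / 2 + 1) / (\<epsilon> * norm l0)"
      have t: "t > 0" using \<epsilon> l0 by (simp add: t_def)
      have "(t *\<^sub>R l0) \<bullet> v / a K + logp K v \<le> t * (l0 \<bullet> x0 - \<epsilon> * norm l0)" if v: "v \<in> charged K" for v
      proof -
        have "t * (l0 \<bullet> v / a K) \<le> t * (l0 \<bullet> x0 - \<epsilon> * norm l0)"
          using H[OF v] D' True t by (intro mult_left_mono) auto
        then show ?thesis using logp_nonpos[OF K v] by simp
      qed
      from key[OF this] have "\<phi> (t *\<^sub>R l0) \<le> t * (l0 \<bullet> x0) - t * (\<epsilon> * norm l0) / 2 + \<epsilon> / 2"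
        using t by (simp add: algebra_simps)
      moreover have "(t *\<^sub>R l0) \<bullet> x0 - \<phi> (t *\<^sub>R l0) \<le> c" by (rule x0)
      ultimately have "t * (\<epsilon> * norm l0) / 2 - \<epsilon> / 2 \<le> c" by simp
      moreover have "t * (\<epsilon> * norm l0) / 2 = \<bar>c\<bar> + \<epsilon> / 2 + 1" using \<epsilon> l0 by (simp add: t_def)
      ultimately show False by linarith
    qed
  qed
  then obtain y where y: "y \<in> ?H" "y \<in> ?D" by blast
  then obtain u where u: "\<forall>p\<in>pt ` charged K. 0 \<le> u p" "sum u (pt ` charged K) = 1"
    "(\<Sum>p\<in>pt ` charged K. u p *\<^sub>R p) = y"
    using convex_hull_finite[OF finite_imageI[OF finite_charged]] by blast
  define \<theta> where "\<theta> v = u (pt v)" for v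
  have "sum \<theta> (charged K) = 1" using u(2) inj by (simp add: sum.reindex \<theta>_def o_def)
  moreover have y_eq: "y = (\<Sum>v\<in>charged K. \<theta> v *\<^sub>R pt v)"
    using u(3) inj by (simp add: sum.reindex \<theta>_def o_def)
  have "fst y = (\<Sum>v\<in>charged K. \<theta> v *\<^sub>R ((1 / a K) *\<^sub>R v))"
    unfolding y_eq fst_sum by (simp add: pt_def)
  moreover have "snd y = (\<Sum>v\<in>charged K. \<theta> v * (- logp K v))"
    unfolding y_eq snd_sum by (simp add: pt_def)
  moreover have "norm (fst y - x0) \<le> \<epsilon>" "snd y \<le> c + \<epsilon>"
    using y(2) by (cases y; simp add: dist_norm norm_minus_commute)+
  moreover have "\<forall>v\<in>charged K. 0 \<le> \<theta> v" using u(1) by (simp add: \<theta>_def)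
  ultimately show ?thesis by (intro exI[of _ \<theta>]) simp
qed

text \<open>Each block is assigned a value so that the frequencies approximate
  \<open>\<theta>\<close>; the event that all blocks take their values has an exact product
  probability. The terms \<open>w\<close> and \<open>w'\<close> account for rounding, in the sum and
  in the logarithm of the probability. They depend on \<open>K\<close> alone and are negligible
  against \<open>a N\<close>.\<close>

lemma prob_blocks_ge:
  assumes NK: "N > 0" "K > 0" and \<theta>: "\<And>v. v \<in> charged K \<Longrightarrow> 0 \<le> \<theta> v" "sum \<theta> (charged K) = 1"
    and small: "e N K \<le> \<delta> * a N" "(1 - \<delta>) * a N \<le> real (L N K) * a K"
  defines "x \<equiv> (\<Sum>v\<in>charged K. \<theta> v *\<^sub>R ((1 / a K) *\<^sub>R v))"
    and "r \<equiv> (\<Sum>v\<in>charged K. \<theta> v * (- logp K v))"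
    and "w \<equiv> real (card (charged K)) * (\<Sum>v\<in>charged K. norm v)"
    and "w' \<equiv> real (card (charged K)) * (\<Sum>v\<in>charged K. a K * logp K v)"
  shows "exp (- (a N * r) + w') \<le> prob {\<omega> \<in> space M. norm (S N \<omega> - x) \<le> \<delta> + w / a N + \<delta> * norm x}"
proof -
  have aN: "a N > 0" and aK: "a K > 0" using a_pos NK by auto
  let ?n = "L N K"
  obtain g where g: "\<And>j. j < ?n \<Longrightarrow> g j \<in> charged K"
    "\<And>v. v \<in> charged K \<Longrightarrow> \<bar>real (card {j \<in> {..<?n}. g j = v}) - \<theta> v * real ?n\<bar> \<le> real (card (charged K))"
    using ex_assignment_with_frequencies[OF finite_charged \<theta>] by metis
  define k where "k v = real (card {j \<in> {..<?n}. g j = v})" for v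
  have group: "(\<Sum>j<?n. h (g j)) = (\<Sum>v\<in>charged K. k v *\<^sub>R h v)" for h :: "_ \<Rightarrow> 'z::real_vector"
  proof -
    have "(\<Sum>j<?n. h (g j)) = (\<Sum>v\<in>charged K. \<Sum>j\<in>{j \<in> {..<?n}. g j = v}. h (g j))"
      using g(1) by (intro sum.group[symmetric] finite_charged) auto
    also have "\<dots> = (\<Sum>v\<in>charged K. \<Sum>j\<in>{j \<in> {..<?n}. g j = v}. h v)"
      by (intro sum.cong refl) auto
    also have "\<dots> = (\<Sum>v\<in>charged K. k v *\<^sub>R h v)"
      unfolding k_def by (intro sum.cong refl) (simp only: sum_constant_scaleR)
    finally show ?thesis .
  qed
  obtain b :: "nat \<Rightarrow> 'w \<Rightarrow> real ^ 'h" where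
    b: "\<And>\<omega>. \<omega> \<in> space M \<Longrightarrow> norm (\<beta> N \<omega> - (\<Sum>j<L N K. b j \<omega>)) \<le> e N K"
      "\<And>j. b j \<in> M \<rightarrow>\<^sub>M count_space UNIV" "\<And>j \<omega>. \<omega> \<in> space M \<Longrightarrow> b j \<omega> \<in> V K"
      "\<And>f :: nat \<Rightarrow> real ^ 'h \<Rightarrow> real. expectation (\<lambda>\<omega>. \<Prod>j<L N K. f j (b j \<omega>))
           = (\<Prod>j<L N K. expectation (\<lambda>\<omega>. f j (\<beta> K \<omega>)))"
    using blocks[OF NK] by blast
  let ?E = "{\<omega> \<in> space M. \<forall>j\<in>{..<?n}. b j \<omega> = g j}"
  have bj: "{\<omega> \<in> space M. b j \<omega> = g j} \<in> sets M" for j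
    using measurable_sets[OF b(2)[of j], of "{g j}"] by (simp add: vimage_def Int_def conj_commute)
  have E: "?E \<in> sets M" using bj by (intro sets.sets_Collect_finite_All) auto
  have probE: "prob ?E = exp (\<Sum>j<?n. a K * logp K (g j))"
  proof -
    have "prob ?E = expectation (\<lambda>\<omega>. indicator ?E \<omega>)" using E by simp
    also have "\<dots> = expectation (\<lambda>\<omega>. \<Prod>j<?n. indicator {g j} (b j \<omega>))"
    proof (intro Bochner_Integration.integral_cong refl)
      fix \<omega> assume "\<omega> \<in> space M"
      then show "indicator ?E \<omega> = (\<Prod>j<?n. indicator {g j} (b j \<omega>) :: real)"
        by (auto simp: indicator_def)
    qed
    also have "\<dots> = (\<Prod>j<?n. expectation (\<lambda>\<omega>. indicator {g j} (\<beta> K \<omega>)))" by (rule b(4))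
    also have "\<dots> = (\<Prod>j<?n. exp (a K * logp K (g j)))"
    proof (rule prod.cong[OF refl])
      fix j assume j: "j \<in> {..<?n}"
      have ev: "{\<omega> \<in> space M. \<beta> K \<omega> = g j} \<in> sets M" using event_\<beta>[of K "{g j}"] by simp
      have "expectation (\<lambda>\<omega>. indicator {g j} (\<beta> K \<omega>)) = expectation (indicator {\<omega> \<in> space M. \<beta> K \<omega> = g j})"
        by (intro Bochner_Integration.integral_cong refl) (auto simp: indicator_def)
      also have "\<dots> = prob {\<omega> \<in> space M. \<beta> K \<omega> = g j}" using ev by simp
      finally show "expectation (\<lambda>\<omega>. indicator {g j} (\<beta> K \<omega>)) = exp (a K * logp K (g j))"
        using j g(1)[of j] exp_logp[OF NK(2)] by simp
    qed
    also have "\<dots> = exp (\<Sum>j<?n. a K * logp K (g j))" by (simp add: exp_sum)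
    finally show ?thesis .
  qed
  have r0: "0 \<le> r" unfolding r_def using \<theta>(1) logp_nonpos[OF NK(2)]
    by (intro sum_nonneg mult_nonneg_nonneg) auto
  have "- (a N * r) + w' \<le> (\<Sum>j<?n. a K * logp K (g j))"
  proof -
    have "real ?n * a K * r \<le> a N * r" using L_le[OF NK] r0 by (intro mult_right_mono)
    moreover have "- (real ?n * a K * r) + w' = (\<Sum>v\<in>charged K. (\<theta> v * real ?n + real (card (charged K))) * (a K * logp K v))"
      unfolding r_def w'_def by (simp add: sum_distrib_left sum.distrib[symmetric] sum_negf[symmetric] algebra_simps)
    moreover have "\<dots> \<le> (\<Sum>v\<in>charged K. k v * (a K * logp K v))"
    proof (rule sum_mono)
      fix v assume v: "v \<in> charged K"
      \<comment> \<open>As \<open>logp\<close> is nonpositive, bounding the probability from below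
        requires an upper bound on the count.\<close>
      have "k v \<le> \<theta> v * real ?n + real (card (charged K))" using g(2)[OF v] by (simp add: k_def abs_le_iff)
      moreover have "a K * logp K v \<le> 0" using logp_nonpos[OF NK(2) v] aK by (simp add: mult_nonneg_nonpos)
      ultimately show "(\<theta> v * real ?n + real (card (charged K))) * (a K * logp K v) \<le> k v * (a K * logp K v)"
        by (rule mult_right_mono_neg)
    qed
    moreover have "(\<Sum>j<?n. a K * logp K (g j)) = (\<Sum>v\<in>charged K. k v * (a K * logp K v))"
      using group[of "\<lambda>v. a K * logp K v"] by simp
    ultimately show ?thesis by linarith
  qed
  then have "exp (- (a N * r) + w') \<le> prob ?E" unfolding probE by simp
  also have "\<dots> \<le> prob {\<omega> \<in> space M. norm (S N \<omega> - x) \<le> \<delta> + w / a N + \<delta> * norm x}"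
  proof (rule finite_measure_mono)
    show "{\<omega> \<in> space M. norm (S N \<omega> - x) \<le> \<delta> + w / a N + \<delta> * norm x} \<in> events"
      by (rule event_S[of N "{y. norm (y - x) \<le> \<delta> + w / a N + \<delta> * norm x}", unfolded mem_Collect_eq])
    show "?E \<subseteq> {\<omega> \<in> space M. norm (S N \<omega> - x) \<le> \<delta> + w / a N + \<delta> * norm x}"
    proof clarify
      fix \<omega> assume \<omega>: "\<omega> \<in> space M" "\<forall>j\<in>{..<?n}. b j \<omega> = g j"
      \<comment> \<open>Three errors add up: the rounding of the frequencies, the failure of exact
        additivity, and the volume not covered by blocks.\<close>
      have sum_b: "(\<Sum>j<?n. b j \<omega>) = (\<Sum>v\<in>charged K. k v *\<^sub>R v)"
        using \<omega>(2) group[of "\<lambda>v. v"] by simp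
      have x_eq: "(real ?n * a K) *\<^sub>R x = (\<Sum>v\<in>charged K. (\<theta> v * real ?n) *\<^sub>R v)"
        unfolding x_def using aK by (simp add: scaleR_sum_right mult.commute)
      have "norm ((\<Sum>v\<in>charged K. k v *\<^sub>R v) - (real ?n * a K) *\<^sub>R x)
          = norm (\<Sum>v\<in>charged K. (k v - \<theta> v * real ?n) *\<^sub>R v)"
        unfolding x_eq by (simp add: sum_subtractf scaleR_diff_left)
      also have "\<dots> \<le> (\<Sum>v\<in>charged K. real (card (charged K)) * norm v)"
        using g(2) unfolding k_def by (intro sum_norm_le) (simp add: mult_right_mono)
      also have "\<dots> = w" by (simp add: w_def sum_distrib_left)
      finally have 1: "norm ((\<Sum>v\<in>charged K. k v *\<^sub>R v) - (real ?n * a K) *\<^sub>R x) \<le> w" .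
      have 2: "norm (\<beta> N \<omega> - (\<Sum>v\<in>charged K. k v *\<^sub>R v)) \<le> \<delta> * a N"
        using b(1)[OF \<omega>(1)] small(1) unfolding sum_b by linarith
      have "norm ((real ?n * a K) *\<^sub>R x - a N *\<^sub>R x) = \<bar>real ?n * a K - a N\<bar> * norm x"
        by (simp add: scaleR_diff_left[symmetric])
      also have "\<dots> \<le> (\<delta> * a N) * norm x"
        using small(2) L_le[OF NK] by (intro mult_right_mono) (auto simp: algebra_simps)
      finally have 3: "norm ((real ?n * a K) *\<^sub>R x - a N *\<^sub>R x) \<le> \<delta> * a N * norm x" .
      have "norm (\<beta> N \<omega> - a N *\<^sub>R x) \<le> \<delta> * a N + w + \<delta> * a N * norm x"
        using norm_triangle_le[OF add_mono[OF norm_triangle_le[OF add_mono[OF 2 1]] 3]] by simp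
      then have "norm (\<beta> N \<omega> - a N *\<^sub>R x) / a N \<le> (\<delta> * a N + w + \<delta> * a N * norm x) / a N"
        using aN by (intro divide_right_mono) auto
      moreover have "norm (S N \<omega> - x) = norm (\<beta> N \<omega> - a N *\<^sub>R x) / a N"
      proof -
        have "S N \<omega> - x = (1 / a N) *\<^sub>R (\<beta> N \<omega> - a N *\<^sub>R x)" using aN by (simp add: S_def algebra_simps)
        then show ?thesis using aN by simp
      qed
      ultimately show "norm (S N \<omega> - x) \<le> \<delta> + w / a N + \<delta> * norm x"
        using aN by (simp add: add_divide_distrib)
    qed
  qed
  finally show ?thesis .
qed

lemma lower_bound:
  assumes x0: "fenchel_legendre \<phi> x0 \<le> ereal c" and G: "open G" "x0 \<in> G" and \<eta>: "\<eta> > 0"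
  shows "\<forall>\<^sub>F n in sequentially. exp (- (a n * (c + \<eta>))) \<le> prob {\<omega> \<in> space M. S n \<omega> \<in> G}"
proof -
  obtain d where d: "d > 0" "cball x0 d \<subseteq> G" using G by (meson open_contains_cball)
  \<comment> \<open>The bound 1 gives \<open>norm x \<le> norm x0 + 1\<close>. The bound
    \<open>\<eta> / 2\<close> leaves room for two errors in the exponent, from the cost of the
    mixture and from \<open>w'\<close>. The factor \<open>4 + norm x0\<close> dominates the total
    distance to \<open>x0\<close>.\<close>
  define \<epsilon> where "\<epsilon> = min 1 (min (\<eta> / 2) (d / (4 + norm x0)))"
  have n4: "0 < 4 + norm x0" by (simp add: add_pos_nonneg)
  have \<epsilon>: "\<epsilon> > 0" "\<epsilon> \<le> 1" "\<epsilon> \<le> \<eta> / 2" "\<epsilon> \<le> d / (4 + norm x0)"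
    unfolding \<epsilon>_def using \<eta> d n4 by (simp, linarith, linarith, linarith)
  have \<epsilon>d: "\<epsilon> * (4 + norm x0) \<le> d" using \<epsilon>(4) n4 by (simp add: field_simps)
  have \<epsilon>2: "\<epsilon> / 2 > 0" using \<epsilon> by simp
  have "\<forall>\<^sub>F K in sequentially. ln (real (card (V K))) / a K < \<epsilon> / 2"
    by (rule order_tendstoD(2)[OF entropy \<epsilon>2])
  \<comment> \<open>One \<open>K\<close> must serve the entropy, the volume fraction and the
    approximation of \<open>\<phi>\<close> simultaneously for all \<open>l\<close>; the mixture is
    then chosen for this \<open>K\<close>, and only \<open>N\<close> grows.\<close>
  from eventually_happens[OF eventually_conj[OF eventually_conj[OF eventually_gt_at_top[of 0] this]
        eventually_conj[OF nearly_add_limit_close[OF \<epsilon>2] scale[OF \<epsilon>2]]]]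
  obtain K where K: "K > 0" "ln (real (card (V K))) / a K < \<epsilon> / 2"
    and cl: "\<forall>A c x. nearly_add A c \<longrightarrow> (\<lambda>n. A n / a n) \<longlonglongrightarrow> x \<longrightarrow> \<bar>x - A K / a K\<bar> \<le> c * (\<epsilon> / 2)"
    and sc: "\<forall>\<^sub>F N in sequentially. e N K \<le> \<epsilon> / 2 * a N \<and> (1 - \<epsilon> / 2) * a N \<le> real (L N K) * a K"
    by auto
  have close: "\<bar>\<phi> l - ln (Z K l) / a K\<bar> \<le> norm l * (\<epsilon> / 2)" for l
    using cl nearly_add_ln_Z \<phi>_limit by blast
  obtain \<theta> where \<theta>: "\<And>v. v \<in> charged K \<Longrightarrow> 0 \<le> \<theta> v" "sum \<theta> (charged K) = 1"
    and near: "norm ((\<Sum>v\<in>charged K. \<theta> v *\<^sub>R ((1 / a K) *\<^sub>R v)) - x0) \<le> \<epsilon>"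
    and cost: "(\<Sum>v\<in>charged K. \<theta> v * (- logp K v)) \<le> c + \<epsilon>"
    using ex_mixture_near[OF x0[unfolded fenchel_le_iff, rule_format] \<epsilon>(1) K(1) close less_imp_le[OF K(2)]] by blast
  define x where "x = (\<Sum>v\<in>charged K. \<theta> v *\<^sub>R ((1 / a K) *\<^sub>R v))"
  define r where "r = (\<Sum>v\<in>charged K. \<theta> v * (- logp K v))"
  define w where "w = real (card (charged K)) * (\<Sum>v\<in>charged K. norm v)"
  define w' where "w' = real (card (charged K)) * (\<Sum>v\<in>charged K. a K * logp K v)"
  have nx: "norm x \<le> norm x0 + 1" using near \<epsilon>(2) norm_triangle_ineq2[of x x0] unfolding x_def by linarith
  have "\<forall>\<^sub>F n in sequentially. a n \<ge> max (w / \<epsilon>) (- w' / \<epsilon>)"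
    using a_top unfolding filterlim_at_top by blast
  with sc eventually_gt_at_top[of 0] show ?thesis
  proof eventually_elim
    case (elim N)
    have aN: "a N > 0" by (rule a_pos[OF elim(2)])
    have wN: "w / a N \<le> \<epsilon>" "- w' \<le> a N * \<epsilon>"
      using elim(3) aN \<epsilon>(1) by (auto simp: field_simps)
    have "exp (- (a N * (c + \<eta>))) \<le> exp (- (a N * r) + w')"
    proof -
      have "a N * r \<le> a N * (c + \<epsilon>)" using cost aN unfolding r_def by (intro mult_left_mono) auto
      moreover have "a N * (2 * \<epsilon>) \<le> a N * \<eta>" using \<epsilon>(3) aN by (intro mult_left_mono) auto
      ultimately show ?thesis using wN(2) by (simp add: algebra_simps)
    qed
    also have "\<dots> \<le> prob {\<omega> \<in> space M. norm (S N \<omega> - x) \<le> \<epsilon> / 2 + w / a N + \<epsilon> / 2 * norm x}"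
      unfolding x_def r_def w_def w'_def
      using prob_blocks_ge[OF elim(2) K(1) \<theta>, of "\<epsilon> / 2"] elim(1) by blast
    also have "\<dots> \<le> prob {\<omega> \<in> space M. S N \<omega> \<in> G}"
    proof (rule finite_measure_mono[OF _ event_S], clarify)
      fix \<omega> assume "norm (S N \<omega> - x) \<le> \<epsilon> / 2 + w / a N + \<epsilon> / 2 * norm x"
      moreover have "\<epsilon> / 2 * norm x \<le> \<epsilon> / 2 * (norm x0 + 1)" using nx \<epsilon> by (intro mult_left_mono) auto
      ultimately have "norm (S N \<omega> - x) + norm (x - x0) \<le> \<epsilon> / 2 + \<epsilon> + \<epsilon> / 2 * (norm x0 + 1) + \<epsilon>"
        using wN(1) near unfolding x_def by linarith
      also have "\<dots> \<le> \<epsilon> * (4 + norm x0)"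
      proof -
        have "0 \<le> \<epsilon> * norm x0" using \<epsilon>(1) by simp
        then show ?thesis using \<epsilon>(1) by (simp add: field_simps)
      qed
      finally have "norm (S N \<omega> - x0) \<le> d"
        using norm_triangle_ineq[of "S N \<omega> - x" "x - x0"] \<epsilon>d by simp
      then show "S N \<omega> \<in> G" using d(2) by (auto simp: dist_norm norm_minus_commute)
    qed
    finally show ?case .
  qed
qed

section \<open>The large deviation principle for nearly additive vectors\<close>

theorem LDP_nearly_additive: "LDP M S a (fenchel_legendre \<phi>)"
  unfolding LDP_def
proof (intro conjI allI impI rate_function_fenchel)
  fix F :: "(real ^ 'h) set" assume F: "closed F"
  let ?I = "INF x\<in>F. fenchel_legendre \<phi> x"
  let ?s = "\<lambda>n. log_ereal (prob {\<omega> \<in> space M. S n \<omega> \<in> F}) / ereal (a n)"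
  have "limsup ?s \<le> - ereal \<gamma>" if \<gamma>: "ereal \<gamma> < ?I" for \<gamma>
  proof -
    \<comment> \<open>The room between \<open>\<gamma>\<close> and \<open>\<alpha>\<close> serves as
      the error allowed in \<open>upper_bound\<close>. Working with reals below the infimum also
      covers an infinite infimum.\<close>
    obtain \<alpha> where \<alpha>: "\<gamma> < \<alpha>" "ereal \<alpha> < ?I" using ereal_dense2[OF \<gamma>] by auto
    have "ereal \<alpha> < fenchel_legendre \<phi> x" if "x \<in> F" for x
      using \<alpha>(2) INF_lower[OF that, of "fenchel_legendre \<phi>"] by (rule less_le_trans)
    from upper_bound[OF F this, of "\<alpha> - \<gamma>"] \<alpha>(1)
    have "\<forall>\<^sub>F n in sequentially. prob {\<omega> \<in> space M. S n \<omega> \<in> F} \<le> exp (- (a n * \<gamma>))" by simp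
    then have "\<forall>\<^sub>F n in sequentially. ?s n \<le> - ereal \<gamma>"
      using eventually_gt_at_top[of 0]
    proof eventually_elim
      case (elim n)
      have a: "a n > 0" by (rule a_pos[OF elim(2)])
      show ?case
      proof (cases "prob {\<omega> \<in> space M. S n \<omega> \<in> F} = 0")
        case True
        then show ?thesis using a by (simp add: log_ereal_def)
      next
        case False
        then have "prob {\<omega> \<in> space M. S n \<omega> \<in> F} > 0" by (simp add: zero_less_measure_iff)
        then have "ln (prob {\<omega> \<in> space M. S n \<omega> \<in> F}) \<le> - (a n * \<gamma>)"
          using elim(1) by (metis ln_exp ln_mono)
        then show ?thesis using a False by (simp add: log_ereal_def field_simps)
      qed
    qed
    then show ?thesis by (rule Limsup_bounded)
  qed
  then show "limsup ?s \<le> - ?I"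
    by (metis (no_types, lifting) ereal_dense2 ereal_minus_le_minus
        ereal_uminus_uminus linorder_not_le)
next
  fix G :: "(real ^ 'h) set" assume G: "open G"
  let ?s = "\<lambda>n. log_ereal (prob {\<omega> \<in> space M. S n \<omega> \<in> G}) / ereal (a n)"
  have "- fenchel_legendre \<phi> x \<le> liminf ?s" if x: "x \<in> G" for x
  proof (cases "fenchel_legendre \<phi> x")
    case PInf
    then show ?thesis by simp
  next
    case MInf
    then show ?thesis using fenchel_nonneg[of x] by simp
  next
    case (real c)
    have "ereal (- c - \<eta>) \<le> liminf ?s" if \<eta>: "\<eta> > 0" for \<eta>
    proof (rule Liminf_bounded)
      have "fenchel_legendre \<phi> x \<le> ereal c" using real by simp
      from lower_bound[OF this G x \<eta>] eventually_gt_at_top[of 0]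
      show "\<forall>\<^sub>F n in sequentially. ereal (- c - \<eta>) \<le> ?s n"
      proof eventually_elim
        case (elim n)
        have a: "a n > 0" by (rule a_pos[OF elim(2)])
        have p: "prob {\<omega> \<in> space M. S n \<omega> \<in> G} > 0" using elim(1) exp_gt_zero less_le_trans by blast
        have "- (a n * (c + \<eta>)) \<le> ln (prob {\<omega> \<in> space M. S n \<omega> \<in> G})"
          using p elim(1) by (simp add: ln_ge_iff)
        then show ?case using a p by (simp add: log_ereal_def field_simps)
      qed
    qed
    then have "ereal (- c) \<le> liminf ?s + ereal \<eta>" if "\<eta> > 0" for \<eta>
      using that by (cases "liminf ?s") (auto simp: algebra_simps)
    then have "ereal (- c) \<le> liminf ?s" by (rule ereal_le_epsilon2)
    then show ?thesis using real by simp
  qed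
  then have "- liminf ?s \<le> (INF x\<in>G. fenchel_legendre \<phi> x)"
    by (intro INF_greatest) (simp only: ereal_uminus_le_reorder)
  then show "- (INF x\<in>G. fenchel_legendre \<phi> x) \<le> liminf ?s"
    by (simp only: ereal_uminus_le_reorder)
qed

end

section \<open>Block asymptotics\<close>

lemma filterlim_power_real_at_top:
  assumes "d > 0" shows "filterlim (\<lambda>n. (2 * real n) ^ d) at_top sequentially"
proof (rule filterlim_at_top_mono[OF filterlim_real_sequentially])
  show "\<forall>\<^sub>F n in sequentially. real n \<le> (2 * real n) ^ d"
    using eventually_ge_at_top[of 1]
  proof eventually_elim
    case (elim n)
    have "real n \<le> 2 * real n" by simp
    also have "\<dots> \<le> (2 * real n) ^ d" using assms elim by (intro self_le_power) auto
    finally show ?case .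
  qed
qed

lemma block_number_mult_le: "real (block_number R N K) * real (2 * K + R + 1) \<le> 2 * real N"
proof -
  have "block_number R N K * (2 * K + R + 1) \<le> 2 * N"
    unfolding block_number_def by (rule div_times_less_eq_dividend)
  then have "real (block_number R N K * (2 * K + R + 1)) \<le> real (2 * N)" by (simp only: of_nat_le_iff)
  then show ?thesis by (simp only: of_nat_mult of_nat_numeral)
qed

lemma block_number_limit:
  "(\<lambda>N. real (block_number R N K) / (2 * real N)) \<longlonglongrightarrow> 1 / real (2 * K + R + 1)"
proof (rule tendsto_sandwich)
  let ?s = "real (2 * K + R + 1)"
  show "(\<lambda>N. 1 / ?s - 1 / (2 * real N)) \<longlonglongrightarrow> 1 / ?s" by real_asymp
  show "(\<lambda>N. 1 / ?s) \<longlonglongrightarrow> 1 / ?s" by simp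
  show "\<forall>\<^sub>F N in sequentially. real (block_number R N K) / (2 * real N) \<le> 1 / ?s"
    using eventually_gt_at_top[of 0]
    by eventually_elim (use block_number_mult_le[of R _ K] in \<open>simp add: field_simps\<close>)
  show "\<forall>\<^sub>F N in sequentially. 1 / ?s - 1 / (2 * real N) \<le> real (block_number R N K) / (2 * real N)"
    using eventually_gt_at_top[of 0]
  proof eventually_elim
    case (elim N)
    let ?m = "block_number R N K"
    have "2 * N < ?m * (2 * K + R + 1) + (2 * K + R + 1)"
      unfolding block_number_def using mod_less_divisor[of "2 * K + R + 1" "2 * N"]
        div_mult_mod_eq[of "2 * N" "2 * K + R + 1"] by linarith
    then have "real (2 * N) \<le> real (?m * (2 * K + R + 1) + (2 * K + R + 1))" by (simp only: of_nat_le_iff)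
    then have "2 * real N \<le> real ?m * ?s + ?s" by (simp only: of_nat_mult of_nat_add of_nat_numeral)
    then have "2 * real N / ?s \<le> real ?m + 1" by (simp add: divide_le_eq field_simps del: of_nat_add of_nat_mult)
    then have "(2 * real N / ?s - 1) / (2 * real N) \<le> real ?m / (2 * real N)"
      by (intro divide_right_mono) auto
    then show ?case using elim by (simp add: diff_divide_distrib)
  qed
qed

lemma block_volume_limit:
  "(\<lambda>N. real (block_number R N K ^ d) * (2 * real K) ^ d / (2 * real N) ^ d)
     \<longlonglongrightarrow> (2 * real K / real (2 * K + R + 1)) ^ d"
proof -
  have "(\<lambda>N. (real (block_number R N K) / (2 * real N) * (2 * real K)) ^ d)
      \<longlonglongrightarrow> (1 / real (2 * K + R + 1) * (2 * real K)) ^ d"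
    by (intro tendsto_intros block_number_limit)
  then show ?thesis by (simp add: power_mult_distrib power_divide)
qed

text \<open>A box holds about \<open>2 ^ d\<close> cubes per unit of volume, since
  \<open>4 * N + 1\<close> intervals fill a length \<open>2 * N\<close>. The subtracted limit is the
  share of the blocks; it tends to \<open>2 ^ d\<close> as \<open>K\<close> grows.\<close>

lemma block_defect_limit:
  "(\<lambda>N. (real ((4 * N + 1) ^ d) - real (block_number R N K ^ d) * real ((4 * K + 1) ^ d)) / (2 * real N) ^ d)
     \<longlonglongrightarrow> 2 ^ d - (real (4 * K + 1) / real (2 * K + R + 1)) ^ d"
proof -
  have "(\<lambda>N. ((4 * real N + 1) / (2 * real N)) ^ d
        - (real (block_number R N K) / (2 * real N) * real (4 * K + 1)) ^ d)
      \<longlonglongrightarrow> 2 ^ d - (1 / real (2 * K + R + 1) * real (4 * K + 1)) ^ d"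
  proof (intro tendsto_diff tendsto_power tendsto_mult tendsto_const block_number_limit)
    show "(\<lambda>N. (4 * real N + 1) / (2 * real N)) \<longlonglongrightarrow> 2" by real_asymp
  qed
  then show ?thesis by (simp add: power_mult_distrib power_divide diff_divide_distrib add.commute)
qed

text \<open>The number of cubes outside all blocks, times the price \<open>c\<close> of one cube,
  for which \<open>2 * real CARD('h)\<close> is inserted later.\<close>

definition block_defect :: "real \<Rightarrow> nat \<Rightarrow> nat \<Rightarrow> nat \<Rightarrow> nat \<Rightarrow> real" where
  "block_defect c d R N K =
    c * (real ((4 * N + 1) ^ d) - real (block_number R N K ^ d) * real ((4 * K + 1) ^ d))"

lemma block_scale:
  fixes c :: real
  assumes \<epsilon>: "\<epsilon> > 0" and c: "c > 0"
  shows "\<forall>\<^sub>F K in sequentially. \<forall>\<^sub>F N in sequentially.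
    block_defect c d R N K \<le> \<epsilon> * (2 * real N) ^ d \<and>
    (1 - \<epsilon>) * (2 * real N) ^ d \<le> real (block_number R N K ^ d) * (2 * real K) ^ d"
proof -
  have "(\<lambda>K. (2 * real K / real (2 * K + R + 1)) ^ d) \<longlonglongrightarrow> 1 ^ d"
    by (intro tendsto_intros) real_asymp
  then have 1: "\<forall>\<^sub>F K in sequentially. (2 * real K / real (2 * K + R + 1)) ^ d > 1 - \<epsilon>"
    using \<epsilon> by (intro order_tendstoD(1)) auto
  have "(\<lambda>K. 2 ^ d - (real (4 * K + 1) / real (2 * K + R + 1)) ^ d) \<longlonglongrightarrow> 2 ^ d - 2 ^ d"
    by (intro tendsto_intros) real_asymp
  then have 2: "\<forall>\<^sub>F K in sequentially. 2 ^ d - (real (4 * K + 1) / real (2 * K + R + 1)) ^ d < \<epsilon> / c"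
    using \<epsilon> c by (intro order_tendstoD(2)) auto
  show ?thesis
    using 1 2
  proof eventually_elim
    case (elim K)
    show ?case
      using order_tendstoD(1)[OF block_volume_limit elim(1)] order_tendstoD(2)[OF block_defect_limit elim(2)]
        eventually_gt_at_top[of 0]
    proof eventually_elim
      case (elim N)
      then have p: "(2 * real N) ^ d > 0" by simp
      show ?case
        unfolding block_defect_def using elim(1,2) c by (simp only: pos_less_divide_eq[OF p] pos_divide_less_eq[OF p])
          (auto simp: field_simps less_imp_le)
    qed
  qed
qed

section \<open>Number and size of the possible values\<close>

definition value_box :: "nat \<Rightarrow> (real ^ 'h::finite) set" where
  "value_box m = {v. \<forall>i. v $ i \<in> real ` {0..m}}"

lemma value_box_eq: "value_box m = vec_lambda ` PiE UNIV (\<lambda>_. real ` {0..m})"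
proof (intro set_eqI iffI)
  fix v :: "real ^ 'h" assume "v \<in> value_box m"
  then show "v \<in> vec_lambda ` PiE UNIV (\<lambda>_. real ` {0..m})"
    by (intro image_eqI[of _ _ "vec_nth v"]) (auto simp: value_box_def)
qed (auto simp: value_box_def PiE_def Pi_def)

lemma finite_value_box: "finite (value_box m)"
  unfolding value_box_eq by (intro finite_imageI finite_PiE) auto

lemma card_value_box_le: "card (value_box m :: (real ^ 'h::finite) set) \<le> (m + 1) ^ CARD('h)"
proof -
  have "card (value_box m :: (real ^ 'h) set) \<le> card (PiE (UNIV :: 'h set) (\<lambda>_. real ` {0..m}))"
    unfolding value_box_eq by (intro card_image_le finite_PiE) auto
  also have "\<dots> = (m + 1) ^ CARD('h)" by (subst card_PiE) (auto simp: card_image)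
  finally show ?thesis .
qed

text \<open>The coordinates are integers bounded by a polynomial in \<open>n\<close>, so the
  logarithm of their number is of order \<open>ln n\<close>, whereas the volume is at least
  \<open>n\<close>.\<close>

lemma value_box_entropy:
  assumes d: "d > 0"
  shows "(\<lambda>n. ln (real (card (value_box (2 * (4 * n + 1) ^ d) :: (real ^ 'h::finite) set))) / (2 * real n) ^ d)
    \<longlonglongrightarrow> 0"
proof (rule tendsto_sandwich[where f = "\<lambda>_. 0"])
  let ?h = "real CARD('h)"
  let ?c = "\<lambda>n. card (value_box (2 * (4 * n + 1) ^ d) :: (real ^ 'h) set)"
  have pos: "?c n > 0" for n
  proof -
    have "0 \<in> (value_box (2 * (4 * n + 1) ^ d) :: (real ^ 'h) set)"
      unfolding value_box_def by (auto intro!: image_eqI[of _ _ 0])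
    then show ?thesis using finite_value_box by (auto simp: card_gt_0_iff)
  qed
  show "(\<lambda>n. ?h * (ln 3 + real d * ln (5 * real n)) / real n) \<longlonglongrightarrow> 0" by real_asymp
  show "\<forall>\<^sub>F n in sequentially. 0 \<le> ln (real (?c n)) / (2 * real n) ^ d"
    using pos by (intro always_eventually allI divide_nonneg_nonneg) (auto simp: Suc_le_eq)
  show "\<forall>\<^sub>F n in sequentially. ln (real (?c n)) / (2 * real n) ^ d
      \<le> ?h * (ln 3 + real d * ln (5 * real n)) / real n"
    using eventually_ge_at_top[of 1]
  proof eventually_elim
    case (elim n)
    have n: "1 \<le> real n" using elim by simp
    have "(4 * n + 1) ^ d \<le> (5 * n) ^ d" using elim by (intro power_mono) auto
    moreover have "1 \<le> (5 * n) ^ d" using elim by simp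
    ultimately have "2 * (4 * n + 1) ^ d + 1 \<le> 3 * (5 * n) ^ d" by linarith
    then have "(2 * (4 * n + 1) ^ d + 1) ^ CARD('h) \<le> (3 * (5 * n) ^ d) ^ CARD('h)" by (intro power_mono) auto
    with card_value_box_le[of "2 * (4 * n + 1) ^ d", where 'h = 'h]
    have "?c n \<le> (3 * (5 * n) ^ d) ^ CARD('h)" by (rule order_trans)
    then have "real (?c n) \<le> real ((3 * (5 * n) ^ d) ^ CARD('h))" by (simp only: of_nat_le_iff)
    then have "real (?c n) \<le> (3 * (5 * real n) ^ d) ^ CARD('h)"
      by (simp only: of_nat_mult of_nat_numeral of_nat_power)
    then have "ln (real (?c n)) \<le> ln ((3 * (5 * real n) ^ d) ^ CARD('h))"
      using pos[of n] n by simp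
    also have "\<dots> = ?h * (ln 3 + real d * ln (5 * real n))"
      using n by (simp add: ln_realpow ln_mult_pos algebra_simps)
    finally have num: "ln (real (?c n)) \<le> ?h * (ln 3 + real d * ln (5 * real n))" .
    have "real n \<le> 2 * real n" by simp
    also have "\<dots> \<le> (2 * real n) ^ d" using d n by (intro self_le_power) auto
    finally have den: "real n \<le> (2 * real n) ^ d" .
    have "0 \<le> ln (real (?c n))" using pos[of n] by (simp add: Suc_le_eq)
    then show ?case using num den n by (intro frac_le) auto
  qed
qed auto

text \<open>The constant comes from \<open>4 * n + 1 \<le> 5 * n\<close>, with \<open>5 * n\<close>
  rewritten as \<open>5 / 2\<close> times the side length \<open>2 * n\<close>.\<close>

lemma norm_value_box_le:
  fixes v :: "real ^ 'h::finite"
  assumes n: "n > 0" and v: "v \<in> value_box (2 * (4 * n + 1) ^ d)"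
  shows "norm v \<le> 2 * real CARD('h) * (5 / 2) ^ d * (2 * real n) ^ d"
proof -
  have "norm v \<le> (\<Sum>i\<in>UNIV. \<bar>v $ i\<bar>)" by (rule norm_le_l1_cart)
  also have "\<dots> \<le> (\<Sum>i\<in>(UNIV :: 'h set). 2 * (5 * real n) ^ d)"
  proof (rule sum_mono)
    fix i
    obtain k where k: "v $ i = real k" "k \<le> 2 * (4 * n + 1) ^ d"
      using v unfolding value_box_def by fastforce
    have "k \<le> 2 * (5 * n) ^ d"
      using k(2) power_mono[of "4 * n + 1" "5 * n" d] n by linarith
    then have "real k \<le> real (2 * (5 * n) ^ d)" by (simp only: of_nat_le_iff)
    then have "real k \<le> 2 * (5 * real n) ^ d"
      by (simp only: of_nat_mult of_nat_numeral of_nat_power)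
    then show "\<bar>v $ i\<bar> \<le> 2 * (5 * real n) ^ d" using k(1) by simp
  qed
  also have "\<dots> = 2 * real CARD('h) * (5 / 2) ^ d * (2 * real n) ^ d"
  proof -
    have "(5 * real n) ^ d = (5 / 2) ^ d * (2 * real n) ^ d"
      by (subst power_mult_distrib[symmetric]) simp
    then show ?thesis by simp
  qed
  finally show ?thesis .
qed

section \<open>Persistent Betti numbers as nearly additive vectors\<close>

context random_filtration
begin

lemma block_centres_sep:
  assumes "j \<noteq> k"
  shows "\<exists>i. \<bar>block_centre R N K j i - block_centre R N K k i\<bar> \<ge> 2 * int K + int (Suc R)"
  using block_centre_separated[OF assms] by metis

lemma block_decomposition:
  assumes \<omega>: "\<omega> \<in> space M"
  shows "norm (block_betti (\<lambda>_. 0) N \<omega> - (\<Sum>j\<in>block_index (block_number R N K). block_betti (block_centre R N K j) K \<omega>))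
    \<le> block_defect (2 * real CARD('h)) CARD('d) R N K"
proof -
  let ?J = "block_index (block_number R N K) :: ('d \<Rightarrow> int) set"
  have "norm (block_betti (\<lambda>_. 0) N \<omega> - (\<Sum>j\<in>?J. block_betti (block_centre R N K j) K \<omega>))
     \<le> 2 * real CARD('h) * (real (card (box_cubes (\<lambda>_. 0) N :: 'd cube set))
        - (\<Sum>j\<in>?J. real (card (box_cubes (block_centre R N K j) K))))"
    unfolding block_betti_def
  proof (rule betti_vec_nearly_additive)
    show "cubical_filtration (X \<omega>)" using rcf \<omega> unfolding random_cubical_filtration_def by blast
    show "box_cubes (block_centre R N K j) K \<inter> box_cubes (block_centre R N K k) K = {}" if jk: "j \<noteq> k" for j k :: "'d \<Rightarrow> int"
    proof -
      obtain i where "\<bar>block_centre R N K j i - block_centre R N K k i\<bar> \<ge> 2 * int K + int (Suc R)"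
        using block_centres_sep[OF jk] by blast
      then show ?thesis by (intro box_cubes_disjoint[where i = i]) simp
    qed
  qed (rule P_ok finite_block_index finite_box_cubes block_subset cubical_complex_box_cubes, assumption?)+
  then show ?thesis by (simp add: card_box_cubes card_block_index block_defect_def)
qed

lemma nearly_additive_block_betti:
  "nearly_additive M (block_betti (\<lambda>_. 0)) (vol_Lambda TYPE('d)) (\<lambda>N K. block_number R N K ^ CARD('d))
     (block_defect (2 * real CARD('h)) CARD('d) R) (\<lambda>n. value_box (2 * (4 * n + 1) ^ CARD('d))) (2 * real CARD('h) * (5 / 2) ^ CARD('d))"
proof
  have d: "CARD('d) > 0" and h: "CARD('h) > 0" by auto
  show "block_betti (\<lambda>_. 0) n \<in> M \<rightarrow>\<^sub>M count_space UNIV" for n by (rule block_betti_measurable)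
  show "finite (value_box (2 * (4 * n + 1) ^ CARD('d)) :: (real ^ 'h) set)" for n by (rule finite_value_box)
  show "block_betti (\<lambda>_. 0) n \<omega> \<in> value_box (2 * (4 * n + 1) ^ CARD('d))" for n \<omega>
    unfolding block_betti_def value_box_def card_box_cubes[symmetric, where z = "\<lambda>_. 0" and 'd = 'd]
    by (rule betti_vec_range[OF finite_box_cubes])
  show "norm v \<le> 2 * real CARD('h) * (5 / 2) ^ CARD('d) * vol_Lambda TYPE('d) n"
    if "n > 0" "v \<in> value_box (2 * (4 * n + 1) ^ CARD('d))" for n and v :: "real ^ 'h"
    using norm_value_box_le[OF that] by (simp add: vol_Lambda_def)
  show "vol_Lambda TYPE('d) n > 0" if "n > 0" for n using that by (simp add: vol_Lambda_def)
  show "filterlim (vol_Lambda TYPE('d)) at_top sequentially"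
    unfolding vol_Lambda_def[abs_def] by (rule filterlim_power_real_at_top[OF d])
  show "real (block_number R N K ^ CARD('d)) * vol_Lambda TYPE('d) K \<le> vol_Lambda TYPE('d) N" for N K
  proof -
    have "real (block_number R N K) * (2 * real K) \<le> real (block_number R N K) * real (2 * K + R + 1)"
      by (intro mult_left_mono) auto
    also have "\<dots> \<le> 2 * real N" by (rule block_number_mult_le)
    finally have "(real (block_number R N K) * (2 * real K)) ^ CARD('d) \<le> (2 * real N) ^ CARD('d)"
      by (intro power_mono) auto
    then show ?thesis by (simp add: vol_Lambda_def power_mult_distrib)
  qed
  show "(\<lambda>n. ln (real (card (value_box (2 * (4 * n + 1) ^ CARD('d)) :: (real ^ 'h) set))) / vol_Lambda TYPE('d) n) \<longlonglongrightarrow> 0"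
    unfolding vol_Lambda_def by (rule value_box_entropy[OF d])
  show "\<forall>\<^sub>F K in sequentially. \<forall>\<^sub>F N in sequentially. block_defect (2 * real CARD('h)) CARD('d) R N K \<le> \<epsilon> * vol_Lambda TYPE('d) N \<and>
      (1 - \<epsilon>) * vol_Lambda TYPE('d) N \<le> real (block_number R N K ^ CARD('d)) * vol_Lambda TYPE('d) K"
    if "\<epsilon> > 0" for \<epsilon>
    unfolding vol_Lambda_def using h by (intro block_scale that) simp
  show "\<exists>b :: nat \<Rightarrow> 'w \<Rightarrow> real ^ 'h.
      (\<forall>\<omega>\<in>space M. norm (block_betti (\<lambda>_. 0) N \<omega> - (\<Sum>j<block_number R N K ^ CARD('d). b j \<omega>)) \<le> block_defect (2 * real CARD('h)) CARD('d) R N K) \<and>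
      (\<forall>j. b j \<in> M \<rightarrow>\<^sub>M count_space UNIV) \<and>
      (\<forall>j. \<forall>\<omega>\<in>space M. b j \<omega> \<in> value_box (2 * (4 * K + 1) ^ CARD('d))) \<and>
      (\<forall>f :: nat \<Rightarrow> real ^ 'h \<Rightarrow> real. expectation (\<lambda>\<omega>. \<Prod>j<block_number R N K ^ CARD('d). f j (b j \<omega>))
         = (\<Prod>j<block_number R N K ^ CARD('d). expectation (\<lambda>\<omega>. f j (block_betti (\<lambda>_. 0) K \<omega>))))" for N K
  proof -
    let ?J = "block_index (block_number R N K) :: ('d \<Rightarrow> int) set" and ?n = "block_number R N K ^ CARD('d)"
    \<comment> \<open>The locale numbers the blocks, so the grid is enumerated by \<open>g\<close>.
      Outside \<open>{..<?n}\<close> its values are arbitrary, but measurability and range hold for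
      a box around any centre.\<close>
    obtain g where g: "bij_betw g {..<?n} ?J"
      using ex_bij_betw_nat_finite[OF finite_block_index[of "block_number R N K"]]
      unfolding card_block_index atLeast0LessThan by blast
    let ?b = "\<lambda>j. block_betti (block_centre R N K (g j)) K"
    show ?thesis
    proof (intro exI[of _ ?b] conjI ballI allI)
      fix \<omega> assume "\<omega> \<in> space M"
      then show "norm (block_betti (\<lambda>_. 0) N \<omega> - (\<Sum>j<?n. ?b j \<omega>)) \<le> block_defect (2 * real CARD('h)) CARD('d) R N K"
        using block_decomposition[of \<omega> N K] sum.reindex_bij_betw[OF g, of "\<lambda>j. block_betti (block_centre R N K j) K \<omega>"]
        by simp
    next
      fix j show "?b j \<in> M \<rightarrow>\<^sub>M count_space UNIV" by (rule block_betti_measurable)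
    next
      fix j \<omega>
      show "?b j \<omega> \<in> value_box (2 * (4 * K + 1) ^ CARD('d))"
        unfolding block_betti_def value_box_def
          card_box_cubes[symmetric, where z = "block_centre R N K (g j)" and 'd = 'd]
        by (rule betti_vec_range[OF finite_box_cubes])
    next
      fix f :: "nat \<Rightarrow> real ^ 'h \<Rightarrow> real"
      show "expectation (\<lambda>\<omega>. \<Prod>j<?n. f j (?b j \<omega>)) = (\<Prod>j<?n. expectation (\<lambda>\<omega>. f j (block_betti (\<lambda>_. 0) K \<omega>)))"
      proof (rule expectation_prod_block_betti)
        fix j k assume "j \<in> {..<?n}" "k \<in> {..<?n}" "j \<noteq> k"
        then have "g j \<noteq> g k" using g by (auto simp: bij_betw_def inj_on_def)
        then show "\<exists>i. \<bar>block_centre R N K (g j) i - block_centre R N K (g k) i\<bar> \<ge> 2 * int K + int (Suc R)"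
          by (rule block_centres_sep)
      qed simp
    qed
  qed
qed

end

theorem mainTheorem3:
  fixes M :: "'w measure"
    and X :: "'w \<Rightarrow> real \<Rightarrow> ('d::{finite,linorder}) cube set"
    and R :: nat and q :: nat
    and P :: "'h::finite \<Rightarrow> real \<times> real"
  assumes rcf: "random_cubical_filtration M X"
    and stat: "stationary M X"
    and Rdep: "R_dependent M X R"
    and q_lt: "q < CARD('d)"
    and P_ok: "\<And>i. 0 \<le> fst (P i) \<and> fst (P i) \<le> snd (P i)"
  shows "\<exists>\<phi> :: real ^ 'h \<Rightarrow> real.
     (\<forall>l. (\<lambda>n. ln (integral\<^sup>L M (\<lambda>\<omega>. exp (\<Sum>i\<in>UNIV. l $ i *
              real (pbetti (restrict_box n (X \<omega>)) q (fst (P i)) (snd (P i))))))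
            / vol_Lambda TYPE('d) n) \<longlonglongrightarrow> \<phi> l)
   \<and> LDP M (\<lambda>n \<omega>. \<chi> i. real (pbetti (restrict_box n (X \<omega>)) q (fst (P i)) (snd (P i)))
                          / vol_Lambda TYPE('d) n)
         (vol_Lambda TYPE('d)) (fenchel_legendre \<phi>)
   \<and> good_rate_function (fenchel_legendre \<phi>)
   \<and> convex_ereal_fun (fenchel_legendre \<phi>)
   \<and> (\<exists>bhat :: real ^ 'h.
        (\<forall>i. (\<lambda>n. integral\<^sup>L M (\<lambda>\<omega>. real (pbetti (restrict_box n (X \<omega>)) q (fst (P i)) (snd (P i))))
                 / vol_Lambda TYPE('d) n) \<longlonglongrightarrow> bhat $ i)
      \<and> (\<forall>x. fenchel_legendre \<phi> x = 0 \<longleftrightarrow> x = bhat))"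
proof -
  interpret prob_space M using rcf unfolding random_cubical_filtration_def by blast
  interpret F: random_filtration M X R q P by unfold_locales (fact rcf stat Rdep P_ok)+
  interpret N: nearly_additive M "F.block_betti (\<lambda>_. 0)" "vol_Lambda TYPE('d)"
      "\<lambda>N K. block_number R N K ^ CARD('d)" "block_defect (2 * real CARD('h)) CARD('d) R" "\<lambda>n. value_box (2 * (4 * n + 1) ^ CARD('d))"
      "2 * real CARD('h) * (5 / 2) ^ CARD('d)"
    by (rule F.nearly_additive_block_betti)
  \<comment> \<open>It remains to express the abstract vector, its moment generating function and
    its mean through \<open>pbetti\<close> of the filtration restricted to the box.\<close>
  have nth: "F.block_betti (\<lambda>_. 0) n \<omega> $ i = real (pbetti (restrict_box n (X \<omega>)) q (fst (P i)) (snd (P i)))" for n \<omega> i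
    by (simp add: F.block_betti_def betti_vec_restrict_box)
  have Z: "N.Z n l = integral\<^sup>L M (\<lambda>\<omega>. exp (\<Sum>i\<in>UNIV. l $ i *
              real (pbetti (restrict_box n (X \<omega>)) q (fst (P i)) (snd (P i)))))" for n l
    by (simp add: N.Z_def inner_vec_def nth)
  have S: "N.S = (\<lambda>n \<omega>. \<chi> i. real (pbetti (restrict_box n (X \<omega>)) q (fst (P i)) (snd (P i)))
                          / vol_Lambda TYPE('d) n)"
    by (simp add: fun_eq_iff N.S_def vec_eq_iff nth)
  have mean: "N.mean n $ i = integral\<^sup>L M (\<lambda>\<omega>. real (pbetti (restrict_box n (X \<omega>)) q (fst (P i)) (snd (P i))))" for n i
    by (simp add: N.mean_def nth)
  show ?thesis
    using N.\<phi>_limit[unfolded Z] N.LDP_nearly_additive[unfolded S] N.good_rate_function_fenchel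
      N.convex_fenchel N.bhat_limit_nth[unfolded mean] N.fenchel_eq_zero_iff
    by blast
qed

end
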